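(* Let $p$ be a strong type of an algebraically closed tuple. The following conditions are equivalent: (1) $p$ is a Lascar strong type (i.e. $a\equiv^L b$ for all $a,b\models p$); (2) $\mathrm{Gal}_L^{\mathrm{fix},1}(p)$ is abelian and $H_1(p)=0$; (3) both $\mathrm{Gal}_L^{\mathrm{fix},1}(p)$ and $H_1(p)$ are trivial. In particular, if $\mathrm{Gal}_L^{\mathrm{fix}}(p)$ is abelian, then $p$ is a Lascar strong type if and only if $H_1(p)=0$. Moreover, if $p$ is a strong type of a model, then $p$ is a Lascar strong type if and only if $\mathrm{Gal}_L(T)$ is abelian and $H_1(p)=0$.
   Context: **Setting.** $T$ is an arbitrary complete theory and $\mathcal M=\mathcal M^{\mathrm{eq}}$ a large saturated (monster) model; sets and tuples are small, tuples possibly infinite; $a\equiv b$ means equality of types over $\emptyset$. Fix an $\mathrm{Aut}(\mathcal M)$-invariant ternary relation $A\perp^*_C D$ between small sets satisfying, for all sets: (finite character) $A\perp^*_CD$ iff $a\perp^*_Cd$ for all finite tuples $a\in A$, $d\in D$; (normality) $A\perp^*_CD$ implies $A\perp^*_C\mathrm{acl}(DC)$; (symmetry) $A\perp^*_CD$ iff $D\perp^*_CA$; (transitivity) for $E\subseteq C\subseteq D$, $A\perp^*_ED$ iff $A\perp^*_EC$ and $A\perp^*_CD$; (extension) for $E\subseteq C$ there is $A'\equiv_E A$ with $A'\perp^*_EC$. (One example: $\perp^*$ always holds.) A family is $*$-independent over $C$ if each member is $*$-independent over $C$ from the union of the others. $p$ is a strong type over $B=\mathrm{acl}(B)$; the elements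 of $B$ are named by constants, so that $B=\mathrm{acl}(\emptyset)=\mathrm{dcl}(\emptyset)$ and "over $\emptyset$" means "over $B$". $p=\mathrm{tp}(a)$ where $a$ enumerates $\mathrm{acl}(a)$ (the paper's standing convention also allows $\mathrm{acl}(a)=\mathrm{dcl}(a)$). "Strong type of a model" means $p=\mathrm{tp}(M)$ for an enumerated small $M\prec\mathcal M$. **Simplices and homology.** For a finite $s\subset\omega$, the power set $\mathcal P(s)$ is a category with one morphism $u\to v$ when $u\subseteq v$ and none otherwise. $\mathcal C$ is the category of small subsets of $\mathcal M$ containing $B$, with elementary maps over $B$ as morphisms. For a functor $f$ write $f^u_v:f(u)\to f(v)$ for the image of $u\to v$, and $f^u_v(u)$ for the set $f^u_v[f(u)]$. An $n$-simplex of $p$ is a functor $f:\mathcal P(s)\to\mathcal C$ with $|s|=n+1$ such that $f(\emptyset)=B$, each $f(\{i\})$ is of the form $\mathrm{acl}(b)$ with $b\models p$, and for nonempty $u\subseteq s$, $f(u)=\mathrm{acl}(\bigcup_{i\in u}f^{\{i\}}_u(\{i\}))$ and $\{f^{\{i\}}_u(\{i\}): i\in u\}$ is $*$-independent over $B$. $C_n$ is the free abelian group on $n$-simplices. For $s=\{s_0<\dots<s_n\}$ put $\partial^i f=f\restriction\mathcal P(s\setminus\{s_i\})$, $\partial f=\sum_{i}(-1)^i\partial^i f$ (extended linearly), and $H^*_n(p)=\ker\partial_n/\mathrm{Im}\,\partial_{n+1}$. $H_1^*(p)$ does not depend on the choice of $\perp^*$ and is written $H_1(p)$. **Lascar groups.**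 $\mathrm{Autf}(\mathcal M)$ is the subgroup of $\mathrm{Aut}(\mathcal M)$ generated by automorphisms fixing pointwise some small elementary submodel; $\bar a\equiv^L\bar b$ iff $\bar b=\sigma(\bar a)$ for some $\sigma\in\mathrm{Autf}(\mathcal M)$; $\mathrm{Gal}_L(T)=\mathrm{Aut}(\mathcal M)/\mathrm{Autf}(\mathcal M)$. $\mathrm{Aut}(p(\mathcal M))=\{\sigma\restriction p(\mathcal M):\sigma\in\mathrm{Aut}(\mathcal M)\}$. For $\lambda\in\{1,\omega\}$, $\mathrm{Autf}^\lambda_{\mathrm{fix}}(p(\mathcal M))$ consists of the restrictions to $p(\mathcal M)$ of those $\sigma\in\mathrm{Aut}(\mathcal M)$ with $\bar a\equiv^L\sigma(\bar a)$ for every $\lambda$-sequence $\bar a$ of realizations of $p$; $\mathrm{Gal}_L^{\mathrm{fix},1}(p)=\mathrm{Aut}(p(\mathcal M))/\mathrm{Autf}^1_{\mathrm{fix}}(p(\mathcal M))$ and $\mathrm{Gal}_L^{\mathrm{fix}}(p)=\mathrm{Aut}(p(\mathcal M))/\mathrm{Autf}^\omega_{\mathrm{fix}}(p(\mathcal M))$ (the latter subgroup equals the set of restrictions of $\sigma$ with $\bar a\equiv^L\sigma(\bar a)$ for an enumeration $\bar a$ of $p(\mathcal M)$). *)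

theory Defs
  imports Main "HOL-Algebra.Bij" "HOL-Algebra.Generated_Groups" "HOL-Algebra.Elementary_Groups"
    "HOL-Algebra.Free_Abelian_Groups"
begin

unbundle cardinal_syntax

section \<open>Many-sorted first-order logic\<close>

text \<open>
  The universe of a structure is the whole type \<open>'a\<close>, partitioned into sorts by \<open>sort_of\<close>; the sorts
  are the elements of the type \<open>'s\<close>. A function symbol has a list of argument sorts and a value sort.
  Interpretations on ill-sorted arguments are never used.
\<close>

record ('f, 'r, 's, 'a) struct =
  sort_of :: "'a \<Rightarrow> 's"
  funs :: "'f set"
  fun_sorts :: "'f \<Rightarrow> 's list \<times> 's"
  fun_int :: "'f \<Rightarrow> 'a list \<Rightarrow> 'a"
  rels :: "'r set"
  rel_sorts :: "'r \<Rightarrow> 's list"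
  rel_int :: "'r \<Rightarrow> 'a list set"

text \<open>
  Elements of the universe occur in formulas as parameters (\<open>Par\<close>), so that an \<open>L(C)\<close>-formula is a
  formula all of whose parameters lie in \<open>C\<close>. A variable is bound together with its sort; the sorts
  of the free variables are given by a context \<open>nat \<Rightarrow> 's\<close>.
\<close>

datatype ('f, tpars: 'a) trm =
    Var nat
  | Par 'a
  | App 'f "('f, 'a) trm list"

datatype ('f, 'r, 's, pars: 'a) fm =
    Eq "('f, 'a) trm" "('f, 'a) trm"
  | Rel 'r "('f, 'a) trm list"
  | Neg "('f, 'r, 's, 'a) fm"
  | Conj "('f, 'r, 's, 'a) fm" "('f, 'r, 's, 'a) fm"
  | Ex nat 's "('f, 'r, 's, 'a) fm"

inductive has_sort :: "('f, 'r, 's, 'a) struct \<Rightarrow> (nat \<Rightarrow> 's) \<Rightarrow> ('f, 'a) trm \<Rightarrow> 's \<Rightarrow> bool"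
  for M :: "('f, 'r, 's, 'a) struct" and \<Gamma> :: "nat \<Rightarrow> 's" where
  "has_sort M \<Gamma> (Var n) (\<Gamma> n)"
| "has_sort M \<Gamma> (Par x) (sort_of M x)"
| "f \<in> funs M \<Longrightarrow> list_all2 (has_sort M \<Gamma>) ts (fst (fun_sorts M f))
    \<Longrightarrow> has_sort M \<Gamma> (App f ts) (snd (fun_sorts M f))"

primrec well_sorted :: "('f, 'r, 's, 'a) struct \<Rightarrow> (nat \<Rightarrow> 's) \<Rightarrow> ('f, 'r, 's, 'a) fm \<Rightarrow> bool" where
  "well_sorted M \<Gamma> (Eq t u) \<longleftrightarrow> (\<exists>s. has_sort M \<Gamma> t s \<and> has_sort M \<Gamma> u s)"
| "well_sorted M \<Gamma> (Rel r ts) \<longleftrightarrow> r \<in> rels M \<and> list_all2 (has_sort M \<Gamma>) ts (rel_sorts M r)"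
| "well_sorted M \<Gamma> (Neg \<phi>) \<longleftrightarrow> well_sorted M \<Gamma> \<phi>"
| "well_sorted M \<Gamma> (Conj \<phi> \<psi>) \<longleftrightarrow> well_sorted M \<Gamma> \<phi> \<and> well_sorted M \<Gamma> \<psi>"
| "well_sorted M \<Gamma> (Ex n s \<phi>) \<longleftrightarrow> well_sorted M (\<Gamma>(n := s)) \<phi>"

primrec tvars :: "('f, 'a) trm \<Rightarrow> nat set" where
  "tvars (Var n) = {n}"
| "tvars (Par x) = {}"
| "tvars (App f ts) = \<Union> (set (map tvars ts))"

primrec fvars :: "('f, 'r, 's, 'a) fm \<Rightarrow> nat set" where
  "fvars (Eq t u) = tvars t \<union> tvars u"
| "fvars (Rel r ts) = \<Union> (set (map tvars ts))"
| "fvars (Neg \<phi>) = fvars \<phi>"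
| "fvars (Conj \<phi> \<psi>) = fvars \<phi> \<union> fvars \<psi>"
| "fvars (Ex n s \<phi>) = fvars \<phi> - {n}"

definition formula :: "('f, 'r, 's, 'a) struct \<Rightarrow> 'a set \<Rightarrow> (nat \<Rightarrow> 's) \<Rightarrow> ('f, 'r, 's, 'a) fm \<Rightarrow> bool" where
  "formula M C \<Gamma> \<phi> \<longleftrightarrow> well_sorted M \<Gamma> \<phi> \<and> pars \<phi> \<subseteq> C"

primrec eval :: "('f, 'r, 's, 'a) struct \<Rightarrow> (nat \<Rightarrow> 'a) \<Rightarrow> ('f, 'a) trm \<Rightarrow> 'a" where
  "eval M e (Var n) = e n"
| "eval M e (Par x) = x"
| "eval M e (App f ts) = fun_int M f (map (eval M e) ts)"

text \<open>\<open>sat M D e \<phi>\<close> is satisfaction in the substructure of \<open>M\<close> with universe \<open>D\<close>.\<close>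

primrec sat :: "('f, 'r, 's, 'a) struct \<Rightarrow> 'a set \<Rightarrow> (nat \<Rightarrow> 'a) \<Rightarrow> ('f, 'r, 's, 'a) fm \<Rightarrow> bool" where
  "sat M D e (Eq t u) \<longleftrightarrow> eval M e t = eval M e u"
| "sat M D e (Rel r ts) \<longleftrightarrow> map (eval M e) ts \<in> rel_int M r"
| "sat M D e (Neg \<phi>) \<longleftrightarrow> \<not> sat M D e \<phi>"
| "sat M D e (Conj \<phi> \<psi>) \<longleftrightarrow> sat M D e \<phi> \<and> sat M D e \<psi>"
| "sat M D e (Ex n s \<phi>) \<longleftrightarrow> (\<exists>x\<in>D. sort_of M x = s \<and> sat M D (e(n := x)) \<phi>)"

text \<open>All sorts are nonempty, as usual in many-sorted logic.\<close>

definition is_structure :: "('f, 'r, 's, 'a) struct \<Rightarrow> bool" where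
  "is_structure M \<longleftrightarrow> surj (sort_of M) \<and>
    (\<forall>f\<in>funs M. \<forall>xs. map (sort_of M) xs = fst (fun_sorts M f)
       \<longrightarrow> sort_of M (fun_int M f xs) = snd (fun_sorts M f))"


section \<open>The monster model\<close>

definition small :: "('f, 'r, 's, 'a) struct \<Rightarrow> 'b set \<Rightarrow> bool" where
  "small M A \<longleftrightarrow> |A| <o |UNIV :: 'a set|"

definition saturated :: "('f, 'r, 's, 'a) struct \<Rightarrow> bool" where
  "saturated M \<longleftrightarrow> (\<forall>C s \<Phi>. small M C
     \<and> (\<forall>\<phi>\<in>\<Phi>. formula M C (\<lambda>_. s) \<phi> \<and> fvars \<phi> \<subseteq> {0})
     \<and> (\<forall>\<Psi>\<subseteq>\<Phi>. finite \<Psi> \<longrightarrow> (\<exists>x. sort_of M x = s \<and> (\<forall>\<phi>\<in>\<Psi>. sat M UNIV (\<lambda>_. x) \<phi>)))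
     \<longrightarrow> (\<exists>x. sort_of M x = s \<and> (\<forall>\<phi>\<in>\<Phi>. sat M UNIV (\<lambda>_. x) \<phi>)))"

definition definable :: "('f, 'r, 's, 'a) struct \<Rightarrow> 'a set \<Rightarrow> 's list \<Rightarrow> 'a list set \<Rightarrow> bool" where
  "definable M C ss X \<longleftrightarrow> (\<exists>\<phi>. formula M C ((!) ss) \<phi> \<and> fvars \<phi> \<subseteq> {..<length ss}
     \<and> X = {xs. map (sort_of M) xs = ss \<and> sat M UNIV ((!) xs) \<phi>})"

text \<open>
  \<open>M = M\<^sup>e\<^sup>q\<close>: every quotient of a finite product of sorts by a \<open>\<emptyset>\<close>-definable equivalence relation is
  itself a sort, the quotient map being \<open>\<emptyset>\<close>-definable.
\<close>

definition eq_closed :: "('f, 'r, 's, 'a) struct \<Rightarrow> bool" where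
  "eq_closed M \<longleftrightarrow> (\<forall>ss E. ss \<noteq> [] \<longrightarrow> equiv {xs. map (sort_of M) xs = ss} E
     \<longrightarrow> definable M {} (ss @ ss) {xs @ ys |xs ys. (xs, ys) \<in> E}
     \<longrightarrow> (\<exists>s \<pi>. definable M {} (ss @ [s]) {xs @ [\<pi> xs] |xs. map (sort_of M) xs = ss}
           \<and> \<pi> ` {xs. map (sort_of M) xs = ss} = {z. sort_of M z = s}
           \<and> (\<forall>xs ys. map (sort_of M) xs = ss \<and> map (sort_of M) ys = ss
                \<longrightarrow> ((xs, ys) \<in> E \<longleftrightarrow> \<pi> xs = \<pi> ys))))"

text \<open>
  The complete theory \<open>T\<close> is the theory of \<open>M\<close>. ``Large'' means that \<open>M\<close> has more elements than there
  are \<open>L\<close>-formulas, that is, cardinality greater than \<open>|T|\<close>.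
\<close>

definition monster :: "('f, 'r, 's, 'a) struct \<Rightarrow> bool" where
  "monster M \<longleftrightarrow> is_structure M \<and> saturated M \<and> small M {\<phi>. \<exists>\<Gamma>. formula M {} \<Gamma> \<phi>} \<and> eq_closed M"

definition acl :: "('f, 'r, 's, 'a) struct \<Rightarrow> 'a set \<Rightarrow> 'a set" where
  "acl M C = {b. \<exists>\<phi>. formula M C (\<lambda>_. sort_of M b) \<phi> \<and> fvars \<phi> \<subseteq> {0} \<and> sat M UNIV (\<lambda>_. b) \<phi>
     \<and> finite {c. sort_of M c = sort_of M b \<and> sat M UNIV (\<lambda>_. c) \<phi>}}"

text \<open>
  The type over \<open>C\<close> of a possibly infinite tuple \<open>a\<close>. A pair \<open>(\<phi>, \<eta>)\<close> stands for the \<open>L(C)\<close>-formula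
  obtained from \<open>\<phi>\<close> by putting the variable \<open>x\<^sub>i\<close>, \<open>i = \<eta> n\<close>, of the type for the \<open>n\<close>th variable of \<open>\<phi>\<close>.
  The sorts of the components of \<open>a\<close> are part of the type, since they determine which formulas
  are well sorted.
\<close>

type_synonym ('f, 'r, 's, 'a, 'i) tuple_type = "(('f, 'r, 's, 'a) fm \<times> (nat \<Rightarrow> 'i)) set"

definition tp :: "('f, 'r, 's, 'a) struct \<Rightarrow> 'a set \<Rightarrow> ('i \<Rightarrow> 'a) \<Rightarrow> ('f, 'r, 's, 'a, 'i) tuple_type" where
  "tp M C a = {(\<phi>, \<eta>). formula M C (sort_of M \<circ> a \<circ> \<eta>) \<phi> \<and> sat M UNIV (a \<circ> \<eta>) \<phi>}"

definition realizations ::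
  "('f, 'r, 's, 'a) struct \<Rightarrow> 'a set \<Rightarrow> ('f, 'r, 's, 'a, 'i) tuple_type \<Rightarrow> ('i \<Rightarrow> 'a) set" where
  "realizations M B p = {b. tp M B b = p}"

definition elem_map_on ::
  "('f, 'r, 's, 'a) struct \<Rightarrow> 'a set \<Rightarrow> 'a set \<Rightarrow> ('a \<Rightarrow> 'a) \<Rightarrow> bool" where
  "elem_map_on M C A h \<longleftrightarrow> (\<forall>x\<in>A. sort_of M (h x) = sort_of M x) \<and>
     (\<forall>\<phi> e. range e \<subseteq> A \<and> formula M C (sort_of M \<circ> e) \<phi>
        \<longrightarrow> (sat M UNIV e \<phi> \<longleftrightarrow> sat M UNIV (h \<circ> e) \<phi>))"

definition elem_submodel :: "('f, 'r, 's, 'a) struct \<Rightarrow> 'a set \<Rightarrow> bool" where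
  "elem_submodel M N \<longleftrightarrow> N \<noteq> {} \<and>
     (\<forall>f\<in>funs M. \<forall>xs. set xs \<subseteq> N \<and> map (sort_of M) xs = fst (fun_sorts M f) \<longrightarrow> fun_int M f xs \<in> N) \<and>
     (\<forall>\<phi> e. range e \<subseteq> N \<and> formula M {} (sort_of M \<circ> e) \<phi> \<longrightarrow> (sat M N e \<phi> \<longleftrightarrow> sat M UNIV e \<phi>))"


section \<open>Lascar groups\<close>

text \<open>
  Throughout, \<open>B\<close> is the algebraically closed set whose elements are named by constants:
  automorphisms fix \<open>B\<close> pointwise, and elementary submodels contain \<open>B\<close>.
\<close>

definition Auts :: "('f, 'r, 's, 'a) struct \<Rightarrow> 'a set \<Rightarrow> ('a \<Rightarrow> 'a) set" where
  "Auts M B = {\<sigma>. bij \<sigma> \<and> (\<forall>x\<in>B. \<sigma> x = x) \<and> (\<forall>x. sort_of M (\<sigma> x) = sort_of M x) \<and>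
     (\<forall>f\<in>funs M. \<forall>xs. map (sort_of M) xs = fst (fun_sorts M f)
        \<longrightarrow> \<sigma> (fun_int M f xs) = fun_int M f (map \<sigma> xs)) \<and>
     (\<forall>r\<in>rels M. \<forall>xs. map (sort_of M) xs = rel_sorts M r
        \<longrightarrow> (xs \<in> rel_int M r \<longleftrightarrow> map \<sigma> xs \<in> rel_int M r))}"

definition Aut_group :: "('f, 'r, 's, 'a) struct \<Rightarrow> 'a set \<Rightarrow> ('a \<Rightarrow> 'a) monoid" where
  "Aut_group M B = BijGroup UNIV\<lparr>carrier := Auts M B\<rparr>"

definition Autf :: "('f, 'r, 's, 'a) struct \<Rightarrow> 'a set \<Rightarrow> ('a \<Rightarrow> 'a) set" where
  "Autf M B = generate (Aut_group M B)
     {\<sigma> \<in> Auts M B. \<exists>N. elem_submodel M N \<and> B \<subseteq> N \<and> small M N \<and> (\<forall>x\<in>N. \<sigma> x = x)}"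

definition Gal_L :: "('f, 'r, 's, 'a) struct \<Rightarrow> 'a set \<Rightarrow> ('a \<Rightarrow> 'a) set monoid" where
  "Gal_L M B = Aut_group M B Mod Autf M B"

definition lascar_equiv ::
  "('f, 'r, 's, 'a) struct \<Rightarrow> 'a set \<Rightarrow> ('j \<Rightarrow> 'a) \<Rightarrow> ('j \<Rightarrow> 'a) \<Rightarrow> bool" where
  "lascar_equiv M B a b \<longleftrightarrow> (\<exists>\<sigma>\<in>Autf M B. b = \<sigma> \<circ> a)"

definition lascar_strong_type ::
  "('f, 'r, 's, 'a) struct \<Rightarrow> 'a set \<Rightarrow> ('f, 'r, 's, 'a, 'i) tuple_type \<Rightarrow> bool" where
  "lascar_strong_type M B p \<longleftrightarrow>
     (\<forall>a\<in>realizations M B p. \<forall>b\<in>realizations M B p. lascar_equiv M B a b)"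

definition restr ::
  "('f, 'r, 's, 'a) struct \<Rightarrow> 'a set \<Rightarrow> ('f, 'r, 's, 'a, 'i) tuple_type
    \<Rightarrow> ('a \<Rightarrow> 'a) \<Rightarrow> ('i \<Rightarrow> 'a) \<Rightarrow> ('i \<Rightarrow> 'a)" where
  "restr M B p \<sigma> = (\<lambda>a\<in>realizations M B p. \<sigma> \<circ> a)"

definition Aut_p_group ::
  "('f, 'r, 's, 'a) struct \<Rightarrow> 'a set \<Rightarrow> ('f, 'r, 's, 'a, 'i) tuple_type
    \<Rightarrow> (('i \<Rightarrow> 'a) \<Rightarrow> ('i \<Rightarrow> 'a)) monoid" where
  "Aut_p_group M B p = BijGroup (realizations M B p)\<lparr>carrier := restr M B p ` Auts M B\<rparr>"

definition Autf_fix_1 ::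
  "('f, 'r, 's, 'a) struct \<Rightarrow> 'a set \<Rightarrow> ('f, 'r, 's, 'a, 'i) tuple_type
    \<Rightarrow> (('i \<Rightarrow> 'a) \<Rightarrow> ('i \<Rightarrow> 'a)) set" where
  "Autf_fix_1 M B p = restr M B p `
     {\<sigma> \<in> Auts M B. \<forall>a\<in>realizations M B p. lascar_equiv M B a (\<sigma> \<circ> a)}"

text \<open>An \<open>\<omega>\<close>-sequence of \<open>'i\<close>-tuples is read as a single tuple indexed by \<open>nat \<times> 'i\<close>.\<close>

definition Autf_fix_omega ::
  "('f, 'r, 's, 'a) struct \<Rightarrow> 'a set \<Rightarrow> ('f, 'r, 's, 'a, 'i) tuple_type
    \<Rightarrow> (('i \<Rightarrow> 'a) \<Rightarrow> ('i \<Rightarrow> 'a)) set" where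
  "Autf_fix_omega M B p = restr M B p `
     {\<sigma> \<in> Auts M B. \<forall>a :: nat \<Rightarrow> 'i \<Rightarrow> 'a. (\<forall>n. a n \<in> realizations M B p)
        \<longrightarrow> lascar_equiv M B (\<lambda>(n, i). a n i) (\<sigma> \<circ> (\<lambda>(n, i). a n i))}"

definition Gal_L_fix_1 ::
  "('f, 'r, 's, 'a) struct \<Rightarrow> 'a set \<Rightarrow> ('f, 'r, 's, 'a, 'i) tuple_type
    \<Rightarrow> (('i \<Rightarrow> 'a) \<Rightarrow> ('i \<Rightarrow> 'a)) set monoid" where
  "Gal_L_fix_1 M B p = Aut_p_group M B p Mod Autf_fix_1 M B p"

definition Gal_L_fix ::
  "('f, 'r, 's, 'a) struct \<Rightarrow> 'a set \<Rightarrow> ('f, 'r, 's, 'a, 'i) tuple_type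
    \<Rightarrow> (('i \<Rightarrow> 'a) \<Rightarrow> ('i \<Rightarrow> 'a)) set monoid" where
  "Gal_L_fix M B p = Aut_p_group M B p Mod Autf_fix_omega M B p"


section \<open>The independence relation\<close>

text \<open>
  \<open>ind A C D\<close> stands for \<open>A \<bottom>\<^sub>C D\<close>. In the extension axiom, \<open>A' \<equiv>\<^sub>E A\<close> is witnessed by an elementary
  map over \<open>E\<close> from \<open>A\<close> onto \<open>A'\<close>.
\<close>

definition indep_relation ::
  "('f, 'r, 's, 'a) struct \<Rightarrow> ('a set \<Rightarrow> 'a set \<Rightarrow> 'a set \<Rightarrow> bool) \<Rightarrow> bool" where
  "indep_relation M ind \<longleftrightarrow>
    \<comment> \<open>invariance\<close>
    (\<forall>\<sigma>\<in>Auts M {}. \<forall>A C D. small M A \<and> small M C \<and> small M D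
       \<longrightarrow> (ind A C D \<longleftrightarrow> ind (\<sigma> ` A) (\<sigma> ` C) (\<sigma> ` D))) \<and>
    \<comment> \<open>finite character\<close>
    (\<forall>A C D. small M A \<and> small M C \<and> small M D
       \<longrightarrow> (ind A C D \<longleftrightarrow> (\<forall>A0 D0. finite A0 \<and> A0 \<subseteq> A \<and> finite D0 \<and> D0 \<subseteq> D \<longrightarrow> ind A0 C D0))) \<and>
    \<comment> \<open>normality\<close>
    (\<forall>A C D. small M A \<and> small M C \<and> small M D
       \<longrightarrow> ind A C D \<longrightarrow> ind A C (acl M (D \<union> C))) \<and>
    \<comment> \<open>symmetry\<close>
    (\<forall>A C D. small M A \<and> small M C \<and> small M D
       \<longrightarrow> (ind A C D \<longleftrightarrow> ind D C A)) \<and>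
    \<comment> \<open>transitivity\<close>
    (\<forall>A E C D. small M A \<and> small M D \<and> E \<subseteq> C \<and> C \<subseteq> D
       \<longrightarrow> (ind A E D \<longleftrightarrow> ind A E C \<and> ind A C D)) \<and>
    \<comment> \<open>extension\<close>
    (\<forall>A E C. small M A \<and> small M C \<and> E \<subseteq> C
       \<longrightarrow> (\<exists>h. elem_map_on M E A h \<and> ind (h ` A) E C))"


section \<open>Simplices and homology groups of a type\<close>

text \<open>
  A functor defined on a power set \<open>\<P>(supp)\<close>, with object map \<open>ob\<close> and morphism map \<open>mor\<close>: the map
  \<open>f\<^sup>u\<^sub>v\<close> is \<open>mor f (u, v)\<close>. The values outside the domains are normalised by \<open>extensional\<close>, so
  that equal functors are equal as HOL values.
\<close>

record 'a simplex =
  supp :: "nat set"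
  ob :: "nat set \<Rightarrow> 'a set"
  mor :: "nat set \<times> nat set \<Rightarrow> 'a \<Rightarrow> 'a"

definition arrows :: "nat set \<Rightarrow> (nat set \<times> nat set) set" where
  "arrows s = {(u, v). u \<subseteq> v \<and> v \<subseteq> s}"

definition is_functor :: "('f, 'r, 's, 'a) struct \<Rightarrow> 'a set \<Rightarrow> 'a simplex \<Rightarrow> bool" where
  "is_functor M B f \<longleftrightarrow>
     ob f \<in> extensional (Pow (supp f)) \<and> mor f \<in> extensional (arrows (supp f)) \<and>
     (\<forall>u. u \<subseteq> supp f \<longrightarrow> B \<subseteq> ob f u \<and> small M (ob f u)) \<and>
     (\<forall>u v. (u, v) \<in> arrows (supp f) \<longrightarrow>
        mor f (u, v) \<in> ob f u \<rightarrow>\<^sub>E ob f v \<and> elem_map_on M B (ob f u) (mor f (u, v))) \<and>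
     (\<forall>u. u \<subseteq> supp f \<longrightarrow> mor f (u, u) = (\<lambda>x\<in>ob f u. x)) \<and>
     (\<forall>u v w. (u, v) \<in> arrows (supp f) \<and> (v, w) \<in> arrows (supp f)
        \<longrightarrow> mor f (u, w) = compose (ob f u) (mor f (v, w)) (mor f (u, v)))"

text \<open>\<open>vertex f u i\<close> is \<open>f\<^sup>{\<^sup>i\<^sup>}\<^sub>u({i})\<close>, the image of the vertex \<open>f({i})\<close> in \<open>f(u)\<close>.\<close>

definition vertex :: "'a simplex \<Rightarrow> nat set \<Rightarrow> nat \<Rightarrow> 'a set" where
  "vertex f u i = mor f ({i}, u) ` ob f {i}"

definition simplices ::
  "('f, 'r, 's, 'a) struct \<Rightarrow> ('a set \<Rightarrow> 'a set \<Rightarrow> 'a set \<Rightarrow> bool) \<Rightarrow> 'a set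
    \<Rightarrow> ('f, 'r, 's, 'a, 'i) tuple_type \<Rightarrow> nat \<Rightarrow> 'a simplex set" where
  "simplices M ind B p n = {f. finite (supp f) \<and> card (supp f) = n + 1 \<and> is_functor M B f \<and>
     ob f {} = B \<and>
     (\<forall>i\<in>supp f. \<exists>b\<in>realizations M B p. ob f {i} = acl M (B \<union> range b)) \<and>
     (\<forall>u. u \<noteq> {} \<and> u \<subseteq> supp f \<longrightarrow>
        ob f u = acl M (B \<union> (\<Union>i\<in>u. vertex f u i)) \<and>
        (\<forall>i\<in>u. ind (vertex f u i) B (\<Union>j\<in>u - {i}. vertex f u j)))}"

definition face :: "nat \<Rightarrow> 'a simplex \<Rightarrow> 'a simplex" where
  "face i f = (let s = supp f - {sorted_list_of_set (supp f) ! i}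
     in \<lparr>supp = s, ob = restrict (ob f) (Pow s), mor = restrict (mor f) (arrows s)\<rparr>)"

definition chain_group ::
  "('f, 'r, 's, 'a) struct \<Rightarrow> ('a set \<Rightarrow> 'a set \<Rightarrow> 'a set \<Rightarrow> bool) \<Rightarrow> 'a set
    \<Rightarrow> ('f, 'r, 's, 'a, 'i) tuple_type \<Rightarrow> nat \<Rightarrow> ('a simplex \<Rightarrow>\<^sub>0 int) monoid" where
  "chain_group M ind B p n = free_Abelian_group (simplices M ind B p n)"

text \<open>As usual, the boundary of a \<open>0\<close>-chain is \<open>0\<close>.\<close>

definition boundary :: "nat \<Rightarrow> ('a simplex \<Rightarrow>\<^sub>0 int) \<Rightarrow> ('a simplex \<Rightarrow>\<^sub>0 int)" where
  "boundary n c = (if n = 0 then 0 else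
     frag_extend (\<lambda>f. \<Sum>i\<le>n. frag_cmul ((-1) ^ i) (frag_of (face i f))) c)"

definition homology_group ::
  "('f, 'r, 's, 'a) struct \<Rightarrow> ('a set \<Rightarrow> 'a set \<Rightarrow> 'a set \<Rightarrow> bool) \<Rightarrow> 'a set
    \<Rightarrow> ('f, 'r, 's, 'a, 'i) tuple_type \<Rightarrow> nat \<Rightarrow> ('a simplex \<Rightarrow>\<^sub>0 int) set monoid" where
  "homology_group M ind B p n =
     (chain_group M ind B p n)
       \<lparr>carrier := kernel (chain_group M ind B p n) (chain_group M ind B p (n - 1)) (boundary n)\<rparr>
     Mod (boundary (n + 1) ` carrier (chain_group M ind B p (n + 1)))"

end

theory Submission
  imports Defs
begin

text \<open>
  The proof compares \<open>1\<close>-simplices with automorphisms over \<open>B\<close>. Write \<open>[a, c]\<close> for a \<open>1\<close>-simplex whose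
  vertices are placed at independent realizations \<open>a\<close>, \<open>c\<close> of \<open>p\<close>. Strong homogeneity of \<open>M\<close>
  turns all maps occurring in a simplex into restrictions of automorphisms
  (\<open>simplex_normal_form\<close>); the boundaries are then generated by the triangle relations
  \<open>[a, b] + [b, c] = [a, c]\<close> for independent \<open>a, b, c\<close>, in which each edge may be replaced by a
  conjugate.

  If \<open>p\<close> is a Lascar strong type, put \<open>D(a, a') = [a, c] - [a', c]\<close> for \<open>c\<close> independent from \<open>a a'\<close>.
  Modulo boundaries this does not depend on \<open>c\<close>, is additive, \<open>D(a, a') + D(a', a'') = D(a, a'')\<close>, and
  invariant under automorphisms. Hence \<open>\<sigma> \<mapsto> D(a, \<sigma>(a))\<close> is a homomorphism independent of \<open>a\<close>, and
  it vanishes on every \<open>\<sigma>\<close> fixing a realization of \<open>p\<close>. If \<open>\<sigma>\<close> fixes a small submodel \<open>N\<close>, let \<open>c\<close>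
  realize a coheir of the type of \<open>a\<close> over \<open>N\<close>; the coheir does not distinguish \<open>a\<close> from \<open>\<sigma>(a)\<close>, so \<open>a\<close>
  is moved to \<open>\<sigma>(a)\<close> by an automorphism fixing \<open>c\<close> (\<open>fixes_conjugate\<close>). No independence of
  \<open>c\<close> is needed here, so \<open>D(a, \<sigma>(a)) = 0\<close>. Thus \<open>D\<close> vanishes on Lascar equivalent pairs, all
  edges between two given vertices are homologous, and the edge classes are the differences of a
  potential on the vertices, whence every cycle is a boundary (\<open>lascar_imp_cycles\<close>).

  Conversely, let automorphisms commute up to Lascar equivalence on the realizations of \<open>p\<close>; this
  is what each of the three commutativity hypotheses gives. Sending \<open>[a, c]\<close> to the class of an
  automorphism taking \<open>a\<close> to \<open>c\<close>, modulo those preserving all Lascar classes of realizations, is well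
  defined and respects the triangle relations. For \<open>c\<close> independent from \<open>b b'\<close> the cycle
  \<open>[b, c] - [b', c]\<close> goes to the class of an automorphism taking \<open>b\<close> to \<open>b'\<close>; so if all cycles
  are boundaries, then \<open>b\<close> and \<open>b'\<close> are Lascar equivalent (\<open>cycles_imp_lascar\<close>). The groups become
  trivial for a Lascar strong type directly from their definitions.
\<close>

section \<open>Substitution and definable predicates\<close>

lemma tvars_App [simp]: "tvars (App f ts) = (\<Union>t\<in>set ts. tvars t)"
  by auto

declare tvars.simps(3) [simp del]

lemma eval_cong: "(\<And>n. n \<in> tvars t \<Longrightarrow> e n = e' n) \<Longrightarrow> eval M e t = eval M e' t"
proof (induction t)
  case (App f ts)
  have "map (eval M e) ts = map (eval M e') ts"
    by (rule map_cong[OF refl]) (use App in auto)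
  then show ?case by (metis eval.simps(3))
qed auto

lemma sat_cong: "(\<And>n. n \<in> fvars \<phi> \<Longrightarrow> e n = e' n) \<Longrightarrow> sat M D e \<phi> = sat M D e' \<phi>"
proof (induction \<phi> arbitrary: e e')
  case (Eq t u)
  then show ?case using eval_cong[of t e e' M] eval_cong[of u e e' M] by auto
next
  case (Rel r ts)
  have "map (eval M e) ts = map (eval M e') ts"
    by (rule map_cong[OF refl], rule eval_cong) (use Rel in auto)
  then show ?case by (metis sat.simps(2))
next
  case (Conj \<phi> \<psi>)
  then show ?case by (metis UnCI fvars.simps(4) sat.simps(4))
next
  case (Ex n s \<phi>)
  have "sat M D (e(n := x)) \<phi> = sat M D (e'(n := x)) \<phi>" for x
    by (rule Ex.IH) (use Ex.prems in auto)
  then show ?case by simp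
next
  case (Neg \<phi>)
  then show ?case by (metis fvars.simps(3) sat.simps(3))
qed

lemma has_sort_cong:
  "has_sort M \<Gamma> t s \<Longrightarrow> (\<And>n. n \<in> tvars t \<Longrightarrow> \<Gamma> n = \<Gamma>' n) \<Longrightarrow> has_sort M \<Gamma>' t s"
proof (induction rule: has_sort.induct)
  case (1 n)
  then show ?case by (metis has_sort.intros(1) insertI1 tvars.simps(1))
next
  case (2 x)
  show ?case by (rule has_sort.intros(2))
next
  case (3 f ts)
  have "list_all2 (has_sort M \<Gamma>') ts (fst (fun_sorts M f))"
    using 3(2) by (rule list.rel_mono_strong) (use 3(3) in auto)
  with 3(1) show ?case by (rule has_sort.intros(3))
qed

lemma well_sorted_cong:
  "(\<And>n. n \<in> fvars \<phi> \<Longrightarrow> \<Gamma> n = \<Gamma>' n) \<Longrightarrow> well_sorted M \<Gamma> \<phi> \<Longrightarrow> well_sorted M \<Gamma>' \<phi>"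
proof (induction \<phi> arbitrary: \<Gamma> \<Gamma>')
  case (Eq t u)
  then show ?case using has_sort_cong by (metis UnCI fvars.simps(1) well_sorted.simps(1))
next
  case (Rel r ts)
  have "list_all2 (has_sort M \<Gamma>) ts (rel_sorts M r)" using Rel by simp
  then have "list_all2 (has_sort M \<Gamma>') ts (rel_sorts M r)"
    by (rule list.rel_mono_strong) (erule has_sort_cong, use Rel.prems(1) in auto)
  then show ?case using Rel by simp
next
  case (Ex n s \<phi>)
  have "well_sorted M (\<Gamma>'(n := s)) \<phi>"
    by (rule Ex.IH[of "\<Gamma>(n := s)"]) (use Ex.prems in \<open>auto simp del: fun_upd_apply simp: fun_upd_def\<close>)
  then show ?case by simp
next
  case (Conj \<phi> \<psi>)
  then show ?case by (metis UnCI fvars.simps(4) well_sorted.simps(4))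
next
  case (Neg \<phi>)
  then show ?case by (metis fvars.simps(3) well_sorted.simps(3))
qed

lemma finite_tvars: "finite (tvars t)"
  by (induction t) auto

lemma finite_fvars: "finite (fvars \<phi>)"
  by (induction \<phi>) (auto simp: finite_tvars)

lemma finite_tpars: "finite (tpars t)"
  by (induction t) auto

lemma finite_pars: "finite (pars \<phi>)"
  by (induction \<phi>) (auto simp: finite_tpars)

text \<open>
  Simultaneous substitution of terms \<open>\<theta> n\<close> for free variables and \<open>\<pi> c\<close> for parameters, a bound
  variable \<open>n\<close> being renamed to \<open>\<beta> n\<close>.
\<close>

primrec tsub :: "(nat \<Rightarrow> ('f, 'a) trm) \<Rightarrow> ('a \<Rightarrow> ('f, 'a) trm) \<Rightarrow> ('f, 'a) trm \<Rightarrow> ('f, 'a) trm" where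
  "tsub \<theta> \<pi> (Var n) = \<theta> n"
| "tsub \<theta> \<pi> (Par c) = \<pi> c"
| "tsub \<theta> \<pi> (App f ts) = App f (map (tsub \<theta> \<pi>) ts)"

primrec sub :: "(nat \<Rightarrow> nat) \<Rightarrow> (nat \<Rightarrow> ('f, 'a) trm) \<Rightarrow> ('a \<Rightarrow> ('f, 'a) trm)
    \<Rightarrow> ('f, 'r, 's, 'a) fm \<Rightarrow> ('f, 'r, 's, 'a) fm" where
  "sub \<beta> \<theta> \<pi> (Eq t u) = Eq (tsub \<theta> \<pi> t) (tsub \<theta> \<pi> u)"
| "sub \<beta> \<theta> \<pi> (Rel r ts) = Rel r (map (tsub \<theta> \<pi>) ts)"
| "sub \<beta> \<theta> \<pi> (Neg \<phi>) = Neg (sub \<beta> \<theta> \<pi> \<phi>)"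
| "sub \<beta> \<theta> \<pi> (Conj \<phi> \<psi>) = Conj (sub \<beta> \<theta> \<pi> \<phi>) (sub \<beta> \<theta> \<pi> \<psi>)"
| "sub \<beta> \<theta> \<pi> (Ex n s \<phi>) = Ex (\<beta> n) s (sub \<beta> (\<theta>(n := Var (\<beta> n))) \<pi> \<phi>)"

text \<open>
  \<open>\<theta> n\<close> itself may contain \<open>\<beta> n\<close>: this is the situation below a quantifier over \<open>n\<close>, where \<open>n\<close> is
  mapped to \<open>Var (\<beta> n)\<close>.
\<close>

definition capture_free ::
  "(nat \<Rightarrow> nat) \<Rightarrow> (nat \<Rightarrow> ('f, 'a) trm) \<Rightarrow> ('a \<Rightarrow> ('f, 'a) trm) \<Rightarrow> bool" where
  "capture_free \<beta> \<theta> \<pi> \<longleftrightarrow> inj \<beta> \<and> (\<forall>m n. m \<noteq> n \<longrightarrow> \<beta> n \<notin> tvars (\<theta> m)) \<and> (\<forall>c n. \<beta> n \<notin> tvars (\<pi> c))"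

lemma capture_free_upd: "capture_free \<beta> \<theta> \<pi> \<Longrightarrow> capture_free \<beta> (\<theta>(n := Var (\<beta> n))) \<pi>"
  by (auto simp: capture_free_def inj_eq)

lemma eval_tsub:
  "eval M e (tsub \<theta> \<pi> t) = eval M (\<lambda>n. eval M e (\<theta> n)) (map_trm (\<lambda>x. x) (\<lambda>c. eval M e (\<pi> c)) t)"
  by (induction t) (auto simp: comp_def cong: map_cong)

lemma map_trm_cong_pars: "(\<And>c. c \<in> tpars t \<Longrightarrow> h c = h' c) \<Longrightarrow> map_trm (\<lambda>x. x) h t = map_trm (\<lambda>x. x) h' t"
  by (rule trm.map_cong) auto

lemma map_fm_cong_pars: "(\<And>c. c \<in> pars t \<Longrightarrow> h c = h' c) \<Longrightarrow> map_fm (\<lambda>x. x) (\<lambda>x. x) (\<lambda>x. x) h t = map_fm (\<lambda>x. x) (\<lambda>x. x) (\<lambda>x. x) h' t"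
  by (rule fm.map_cong) auto

text \<open>
  Satisfaction of a substituted formula; \<open>h c\<close> is the element by which the parameter \<open>c\<close> is replaced.
\<close>

lemma sat_sub_map:
  assumes "capture_free \<beta> \<theta> \<pi>" and "\<And>c. c \<in> pars \<phi> \<Longrightarrow> eval M e (\<pi> c) = h c"
  shows "sat M D e (sub \<beta> \<theta> \<pi> \<phi>) \<longleftrightarrow> sat M D (\<lambda>n. eval M e (\<theta> n)) (map_fm (\<lambda>x. x) (\<lambda>x. x) (\<lambda>x. x) h \<phi>)"
  using assms
proof (induction \<phi> arbitrary: e \<theta>)
  case (Eq t u)
  have "map_trm (\<lambda>x. x) (\<lambda>c. eval M e (\<pi> c)) t = map_trm (\<lambda>x. x) h t" "map_trm (\<lambda>x. x) (\<lambda>c. eval M e (\<pi> c)) u = map_trm (\<lambda>x. x) h u"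
    by (rule map_trm_cong_pars; use Eq in auto)+
  then show ?case by (simp add: eval_tsub)
next
  case (Rel r ts)
  have "map_trm (\<lambda>x. x) (\<lambda>c. eval M e (\<pi> c)) t = map_trm (\<lambda>x. x) h t" if "t \<in> set ts" for t
    by (rule map_trm_cong_pars; use Rel that in auto)
  then show ?case by (simp add: eval_tsub comp_def cong: map_cong)
next
  case (Neg \<phi>)
  then show ?case by simp
next
  case (Conj \<phi> \<psi>)
  then show ?case by simp
next
  case (Ex n s \<phi>)
  have "sat M D (e(\<beta> n := x)) (sub \<beta> (\<theta>(n := Var (\<beta> n))) \<pi> \<phi>) \<longleftrightarrow>
      sat M D ((\<lambda>n. eval M e (\<theta> n))(n := x)) (map_fm (\<lambda>x. x) (\<lambda>x. x) (\<lambda>x. x) h \<phi>)" for x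
  proof -
    have 1: "eval M (e(\<beta> n := x)) (\<pi> c) = eval M e (\<pi> c)" for c
      by (rule eval_cong) (use Ex.prems(1) in \<open>auto simp: capture_free_def\<close>)
    have 2: "(\<lambda>m. eval M (e(\<beta> n := x)) ((\<theta>(n := Var (\<beta> n))) m)) = (\<lambda>n. eval M e (\<theta> n))(n := x)"
    proof
      fix m
      show "eval M (e(\<beta> n := x)) ((\<theta>(n := Var (\<beta> n))) m) = ((\<lambda>n. eval M e (\<theta> n))(n := x)) m"
      proof (cases "m = n")
        case False
        then have "eval M (e(\<beta> n := x)) (\<theta> m) = eval M e (\<theta> m)"
          by (intro eval_cong) (use Ex.prems(1) in \<open>auto simp: capture_free_def\<close>)
        then show ?thesis using False by simp
      qed simp
    qed
    have "eval M (e(\<beta> n := x)) (\<pi> c) = h c" if "c \<in> pars \<phi>" for c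
      using Ex.prems(2) that unfolding 1 by simp
    then have "sat M D (e(\<beta> n := x)) (sub \<beta> (\<theta>(n := Var (\<beta> n))) \<pi> \<phi>) \<longleftrightarrow>
      sat M D (\<lambda>m. eval M (e(\<beta> n := x)) ((\<theta>(n := Var (\<beta> n))) m)) (map_fm (\<lambda>x. x) (\<lambda>x. x) (\<lambda>x. x) h \<phi>)"
      by (intro Ex.IH capture_free_upd Ex.prems(1)) blast
    then show ?thesis unfolding 2 .
  qed
  then show ?case by simp
qed

lemma map_fm_id: "(\<And>c. c \<in> pars \<phi> \<Longrightarrow> h c = c) \<Longrightarrow> map_fm (\<lambda>x. x) (\<lambda>x. x) (\<lambda>x. x) h \<phi> = \<phi>"
  using map_fm_cong_pars[of \<phi> h "\<lambda>x. x"] by (simp add: fm.map_ident)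

lemma sat_sub:
  assumes "capture_free \<beta> \<theta> \<pi>" and "\<And>c. c \<in> pars \<phi> \<Longrightarrow> eval M e (\<pi> c) = c"
  shows "sat M D e (sub \<beta> \<theta> \<pi> \<phi>) \<longleftrightarrow> sat M D (\<lambda>n. eval M e (\<theta> n)) \<phi>"
  using sat_sub_map[of \<beta> \<theta> \<pi> \<phi> M e "\<lambda>x. x" D] assms by (simp add: fm.map_ident)

lemma has_sort_tsub:
  assumes "has_sort M \<Gamma> t s"
    and "\<And>n. n \<in> tvars t \<Longrightarrow> has_sort M \<Gamma>' (\<theta> n) (\<Gamma> n)"
    and "\<And>c. c \<in> tpars t \<Longrightarrow> has_sort M \<Gamma>' (\<pi> c) (sort_of M c)"
  shows "has_sort M \<Gamma>' (tsub \<theta> \<pi> t) s"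
  using assms
proof (induction rule: has_sort.induct)
  case (3 f ts)
  have "list_all2 (has_sort M \<Gamma>') (map (tsub \<theta> \<pi>) ts) (fst (fun_sorts M f))"
    unfolding list.rel_map using 3(2) by (rule list.rel_mono_strong) (use 3(2,3,4) in auto)
  then show ?case using 3(1) has_sort.intros(3) by fastforce
qed auto

lemma well_sorted_sub:
  assumes "well_sorted M \<Gamma> \<phi>" "capture_free \<beta> \<theta> \<pi>"
    and "\<And>n. n \<in> fvars \<phi> \<Longrightarrow> has_sort M \<Gamma>' (\<theta> n) (\<Gamma> n)"
    and "\<And>c. c \<in> pars \<phi> \<Longrightarrow> has_sort M \<Gamma>' (\<pi> c) (sort_of M c)"
  shows "well_sorted M \<Gamma>' (sub \<beta> \<theta> \<pi> \<phi>)"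
  using assms
proof (induction \<phi> arbitrary: \<Gamma> \<Gamma>' \<theta>)
  case (Eq t u)
  then obtain s where "has_sort M \<Gamma> t s" "has_sort M \<Gamma> u s" by auto
  then have "has_sort M \<Gamma>' (tsub \<theta> \<pi> t) s" "has_sort M \<Gamma>' (tsub \<theta> \<pi> u) s"
    using Eq by (auto intro!: has_sort_tsub[of M \<Gamma>])
  then show ?case by auto
next
  case (Rel r ts)
  have "list_all2 (has_sort M \<Gamma>) ts (rel_sorts M r)" using Rel by simp
  then have "list_all2 (has_sort M \<Gamma>') (map (tsub \<theta> \<pi>) ts) (rel_sorts M r)"
    unfolding list.rel_map by (rule list.rel_mono_strong) (use Rel in \<open>auto intro!: has_sort_tsub[of M \<Gamma>]\<close>)
  then show ?case using Rel by simp
next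
  case (Ex n s \<phi>)
  have "well_sorted M (\<Gamma>'(\<beta> n := s)) (sub \<beta> (\<theta>(n := Var (\<beta> n))) \<pi> \<phi>)"
  proof (rule Ex.IH[of "\<Gamma>(n := s)"])
    show "well_sorted M (\<Gamma>(n := s)) \<phi>" using Ex.prems by simp
    show "capture_free \<beta> (\<theta>(n := Var (\<beta> n))) \<pi>" using Ex.prems capture_free_upd by blast
    show "has_sort M (\<Gamma>'(\<beta> n := s)) ((\<theta>(n := Var (\<beta> n))) m) ((\<Gamma>(n := s)) m)" if "m \<in> fvars \<phi>" for m
    proof (cases "m = n")
      case True
      then show ?thesis using has_sort.intros(1)[of M "\<Gamma>'(\<beta> n := s)" "\<beta> n"] by simp
    next
      case False
      then have "has_sort M \<Gamma>' (\<theta> m) (\<Gamma> m)" using Ex.prems that by auto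
      then have "has_sort M (\<Gamma>'(\<beta> n := s)) (\<theta> m) (\<Gamma> m)"
        by (rule has_sort_cong) (use Ex.prems(2) False in \<open>auto simp: capture_free_def\<close>)
      then show ?thesis using False by simp
    qed
    show "has_sort M (\<Gamma>'(\<beta> n := s)) (\<pi> c) (sort_of M c)" if "c \<in> pars \<phi>" for c
    proof -
      have "has_sort M \<Gamma>' (\<pi> c) (sort_of M c)" using Ex.prems that by auto
      then show ?thesis
        by (rule has_sort_cong) (use Ex.prems(2) in \<open>auto simp: capture_free_def\<close>)
    qed
  qed
  then show ?case by simp
next
  case (Conj \<phi> \<psi>)
  then show ?case by (auto)
next
  case (Neg \<phi>)
  then show ?case by (auto)
qed

lemma tvars_tsub: "tvars (tsub \<theta> \<pi> t) = (\<Union>n\<in>tvars t. tvars (\<theta> n)) \<union> (\<Union>c\<in>tpars t. tvars (\<pi> c))"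
  by (induction t) auto

lemma tpars_tsub: "tpars (tsub \<theta> \<pi> t) = (\<Union>n\<in>tvars t. tpars (\<theta> n)) \<union> (\<Union>c\<in>tpars t. tpars (\<pi> c))"
  by (induction t) auto

lemma fvars_sub:
  "capture_free \<beta> \<theta> \<pi> \<Longrightarrow> fvars (sub \<beta> \<theta> \<pi> \<phi>) \<subseteq> (\<Union>n\<in>fvars \<phi>. tvars (\<theta> n)) \<union> (\<Union>c\<in>pars \<phi>. tvars (\<pi> c))"
proof (induction \<phi> arbitrary: \<theta>)
  case (Ex n s \<phi>)
  have "fvars (sub \<beta> (\<theta>(n := Var (\<beta> n))) \<pi> \<phi>)
      \<subseteq> (\<Union>m\<in>fvars \<phi>. tvars ((\<theta>(n := Var (\<beta> n))) m)) \<union> (\<Union>c\<in>pars \<phi>. tvars (\<pi> c))"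
    using Ex.IH[OF capture_free_upd[OF Ex.prems]] .
  then show ?case by (fastforce split: if_splits)
next
  case (Conj \<phi> \<psi>)
  then show ?case by fastforce
qed (auto simp: tvars_tsub)

lemma pars_sub:
  "pars (sub \<beta> \<theta> \<pi> \<phi>) \<subseteq> (\<Union>n\<in>fvars \<phi>. tpars (\<theta> n)) \<union> (\<Union>c\<in>pars \<phi>. tpars (\<pi> c))"
proof (induction \<phi> arbitrary: \<theta>)
  case (Ex n s \<phi>)
  have "pars (sub \<beta> (\<theta>(n := Var (\<beta> n))) \<pi> \<phi>)
      \<subseteq> (\<Union>m\<in>fvars \<phi>. tpars ((\<theta>(n := Var (\<beta> n))) m)) \<union> (\<Union>c\<in>pars \<phi>. tpars (\<pi> c))"
    by (rule Ex.IH)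
  then show ?case by (fastforce split: if_splits)
next
  case (Conj \<phi> \<psi>)
  from Conj.IH[of \<theta>] show ?case by fastforce
qed (auto simp: tpars_tsub)

text \<open>
  A predicate on tuples \<open>c :: 'k \<Rightarrow> 'a\<close> is \<open>dfn M \<sigma> K\<close> if it is given by a parameter-free formula in
  the components with indices in \<open>K\<close>, the component \<open>k\<close> having the sort \<open>\<sigma> k\<close>. Parameters are
  treated as further components of a tuple.
\<close>

definition dfn :: "('f, 'r, 's, 'a) struct \<Rightarrow> ('k \<Rightarrow> 's) \<Rightarrow> 'k set \<Rightarrow> (('k \<Rightarrow> 'a) \<Rightarrow> bool) \<Rightarrow> bool" where
  "dfn M \<sigma> K P \<longleftrightarrow> (\<exists>\<phi> \<eta>. formula M {} (\<sigma> \<circ> \<eta>) \<phi> \<and> \<eta> ` fvars \<phi> \<subseteq> K \<and> P = (\<lambda>c. sat M UNIV (c \<circ> \<eta>) \<phi>))"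

lemma dfnI: "formula M {} (\<sigma> \<circ> \<eta>) \<phi> \<Longrightarrow> \<eta> ` fvars \<phi> \<subseteq> K \<Longrightarrow> dfn M \<sigma> K (\<lambda>c. sat M UNIV (c \<circ> \<eta>) \<phi>)"
  unfolding dfn_def by blast

lemma dfnE:
  assumes "dfn M \<sigma> K P"
  obtains \<phi> \<eta> where "formula M {} (\<sigma> \<circ> \<eta>) \<phi>" "\<eta> ` fvars \<phi> \<subseteq> K" "P = (\<lambda>c. sat M UNIV (c \<circ> \<eta>) \<phi>)"
  using assms unfolding dfn_def by blast

lemma dfn_mono: "dfn M \<sigma> K P \<Longrightarrow> K \<subseteq> K' \<Longrightarrow> dfn M \<sigma> K' P"
  unfolding dfn_def by blast

lemma formula_cong:
  "(\<And>n. n \<in> fvars \<phi> \<Longrightarrow> \<Gamma> n = \<Gamma>' n) \<Longrightarrow> formula M C \<Gamma> \<phi> \<Longrightarrow> formula M C \<Gamma>' \<phi>"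
  unfolding formula_def using well_sorted_cong by blast

lemma dfn_cong:
  assumes "dfn M \<sigma> K P" and "\<And>k. k \<in> K \<Longrightarrow> \<sigma> k = \<sigma>' k"
  shows "dfn M \<sigma>' K P"
proof -
  obtain \<phi> \<eta> where *: "formula M {} (\<sigma> \<circ> \<eta>) \<phi>" "\<eta> ` fvars \<phi> \<subseteq> K" "P = (\<lambda>c. sat M UNIV (c \<circ> \<eta>) \<phi>)"
    using assms(1) by (rule dfnE)
  have "formula M {} (\<sigma>' \<circ> \<eta>) \<phi>"
    by (rule formula_cong[OF _ *(1)]) (use *(2) assms(2) in auto)
  then show ?thesis using * unfolding dfn_def by blast
qed

lemma dfn_agree:
  assumes "dfn M \<sigma> K P" and "\<And>k. k \<in> K \<Longrightarrow> c k = c' k"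
  shows "P c \<longleftrightarrow> P c'"
proof -
  obtain \<phi> \<eta> where *: "\<eta> ` fvars \<phi> \<subseteq> K" "P = (\<lambda>c. sat M UNIV (c \<circ> \<eta>) \<phi>)"
    using assms(1) by (rule dfnE)
  show ?thesis unfolding *(2) by (rule sat_cong) (use * assms(2) in auto)
qed

lemma dfn_finite:
  assumes "dfn M \<sigma> K P"
  obtains K0 where "finite K0" "K0 \<subseteq> K" "dfn M \<sigma> K0 P"
  using assms unfolding dfn_def by (metis finite_fvars finite_imageI order_refl)

lemma dfn_reindex:
  assumes "dfn M \<sigma> K P" and "\<And>k. k \<in> K \<Longrightarrow> \<sigma> k = \<sigma>' (\<rho> k)"
  shows "dfn M \<sigma>' (\<rho> ` K) (\<lambda>d. P (d \<circ> \<rho>))"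
proof -
  obtain \<phi> \<eta> where *: "formula M {} (\<sigma> \<circ> \<eta>) \<phi>" "\<eta> ` fvars \<phi> \<subseteq> K" "P = (\<lambda>c. sat M UNIV (c \<circ> \<eta>) \<phi>)"
    using assms(1) by (rule dfnE)
  have "formula M {} (\<sigma>' \<circ> (\<rho> \<circ> \<eta>)) \<phi>"
    by (rule formula_cong[OF _ *(1)]) (use *(2) assms(2) in auto)
  moreover have "(\<rho> \<circ> \<eta>) ` fvars \<phi> \<subseteq> \<rho> ` K" using *(2) by auto
  ultimately have "dfn M \<sigma>' (\<rho> ` K) (\<lambda>c. sat M UNIV (c \<circ> (\<rho> \<circ> \<eta>)) \<phi>)" by (rule dfnI)
  then show ?thesis unfolding *(3) by (simp add: comp_assoc)
qed

lemma dfn_not: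
  assumes "dfn M \<sigma> K P" shows "dfn M \<sigma> K (\<lambda>c. \<not> P c)"
proof -
  obtain \<phi> \<eta> where *: "formula M {} (\<sigma> \<circ> \<eta>) \<phi>" "\<eta> ` fvars \<phi> \<subseteq> K" "P = (\<lambda>c. sat M UNIV (c \<circ> \<eta>) \<phi>)"
    using assms by (rule dfnE)
  have "dfn M \<sigma> K (\<lambda>c. sat M UNIV (c \<circ> \<eta>) (Neg \<phi>))"
    by (rule dfnI) (use * in \<open>auto simp: formula_def\<close>)
  then show ?thesis using * by simp
qed

lemma dfn_conj:
  fixes M :: "('f, 'r, 's, 'a) struct" and \<sigma> :: "'k \<Rightarrow> 's"
  assumes "dfn M \<sigma> K P" "dfn M \<sigma> K Q" shows "dfn M \<sigma> K (\<lambda>c. P c \<and> Q c)"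
proof -
  obtain \<phi> \<eta> where 1: "formula M {} (\<sigma> \<circ> \<eta>) \<phi>" "\<eta> ` fvars \<phi> \<subseteq> K" "P = (\<lambda>c. sat M UNIV (c \<circ> \<eta>) \<phi>)"
    using assms(1) by (rule dfnE)
  obtain \<psi> \<zeta> where 2: "formula M {} (\<sigma> \<circ> \<zeta>) \<psi>" "\<zeta> ` fvars \<psi> \<subseteq> K" "Q = (\<lambda>c. sat M UNIV (c \<circ> \<zeta>) \<psi>)"
    using assms(2) by (rule dfnE)
  \<comment> \<open>The variables of the two formulas are made disjoint: even ones for the first, odd ones for the second.\<close>
  define \<beta>1 \<beta>2 where "\<beta>1 = (\<lambda>n::nat. 2 * n)" and "\<beta>2 = (\<lambda>n::nat. 2 * n + 1)"
  define \<theta>1 \<theta>2 :: "nat \<Rightarrow> ('f, 'a) trm" where "\<theta>1 = (\<lambda>n. Var (\<beta>1 n))" and "\<theta>2 = (\<lambda>n. Var (\<beta>2 n))"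
  have cf: "capture_free \<beta>1 \<theta>1 Par" "capture_free \<beta>2 \<theta>2 Par"
    by (auto simp: capture_free_def inj_def \<theta>1_def \<theta>2_def \<beta>1_def \<beta>2_def)
  define \<eta>' where "\<eta>' = (\<lambda>n. if even n then \<eta> (n div 2) else \<zeta> (n div 2))"
  have \<eta>': "\<eta>' (\<beta>1 n) = \<eta> n" "\<eta>' (\<beta>2 n) = \<zeta> n" for n
    by (auto simp: \<eta>'_def \<beta>1_def \<beta>2_def)
  have "sat M UNIV (c \<circ> \<eta>') (sub \<beta>1 \<theta>1 Par \<phi>) = sat M UNIV (c \<circ> \<eta>) \<phi>"
    "sat M UNIV (c \<circ> \<eta>') (sub \<beta>2 \<theta>2 Par \<psi>) = sat M UNIV (c \<circ> \<zeta>) \<psi>" for c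
    by (subst sat_sub[OF cf(1)] sat_sub[OF cf(2)]; simp add: \<theta>1_def \<theta>2_def \<eta>' comp_def)+
  then have eq: "(\<lambda>c. P c \<and> Q c) = (\<lambda>c. sat M UNIV (c \<circ> \<eta>') (Conj (sub \<beta>1 \<theta>1 Par \<phi>) (sub \<beta>2 \<theta>2 Par \<psi>)))"
    using 1(3) 2(3) by auto
  have ws: "well_sorted M (\<sigma> \<circ> \<eta>') (sub \<beta>1 \<theta>1 Par \<phi>)"
  proof (rule well_sorted_sub[OF _ cf(1)])
    show "well_sorted M (\<sigma> \<circ> \<eta>) \<phi>" using 1(1) by (simp add: formula_def)
    show "has_sort M (\<sigma> \<circ> \<eta>') (\<theta>1 n) ((\<sigma> \<circ> \<eta>) n)" for n
      using has_sort.intros(1)[of M "\<sigma> \<circ> \<eta>'" "\<beta>1 n"] by (simp add: \<theta>1_def \<eta>')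
  qed (rule has_sort.intros(2))
  have ws': "well_sorted M (\<sigma> \<circ> \<eta>') (sub \<beta>2 \<theta>2 Par \<psi>)"
  proof (rule well_sorted_sub[OF _ cf(2)])
    show "well_sorted M (\<sigma> \<circ> \<zeta>) \<psi>" using 2(1) by (simp add: formula_def)
    show "has_sort M (\<sigma> \<circ> \<eta>') (\<theta>2 n) ((\<sigma> \<circ> \<zeta>) n)" for n
      using has_sort.intros(1)[of M "\<sigma> \<circ> \<eta>'" "\<beta>2 n"] by (simp add: \<theta>2_def \<eta>')
  qed (rule has_sort.intros(2))
  have fv: "fvars (sub \<beta>1 \<theta>1 Par \<phi>) \<subseteq> \<beta>1 ` fvars \<phi>" "fvars (sub \<beta>2 \<theta>2 Par \<psi>) \<subseteq> \<beta>2 ` fvars \<psi>"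
    using fvars_sub[OF cf(1), of \<phi>] fvars_sub[OF cf(2), of \<psi>] by (auto simp: \<theta>1_def \<theta>2_def)
  have pr: "pars (sub \<beta>1 \<theta>1 Par \<phi>) = {}" "pars (sub \<beta>2 \<theta>2 Par \<psi>) = {}"
    using pars_sub[of \<beta>1 \<theta>1 Par \<phi>] pars_sub[of \<beta>2 \<theta>2 Par \<psi>] 1(1) 2(1) by (auto simp: \<theta>1_def \<theta>2_def formula_def)
  show ?thesis unfolding eq
  proof (rule dfnI)
    show "formula M {} (\<sigma> \<circ> \<eta>') (Conj (sub \<beta>1 \<theta>1 Par \<phi>) (sub \<beta>2 \<theta>2 Par \<psi>))"
      using ws ws' pr by (simp add: formula_def)
    have "\<eta>' n \<in> K" if "n \<in> \<beta>1 ` fvars \<phi> \<union> \<beta>2 ` fvars \<psi>" for n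
      using that 1(2) 2(2) by (auto simp: \<eta>')
    then show "\<eta>' ` fvars (Conj (sub \<beta>1 \<theta>1 Par \<phi>) (sub \<beta>2 \<theta>2 Par \<psi>)) \<subseteq> K"
      using fv by auto
  qed
qed

lemma dfn_disj: "dfn M \<sigma> K P \<Longrightarrow> dfn M \<sigma> K Q \<Longrightarrow> dfn M \<sigma> K (\<lambda>c. P c \<or> Q c)"
  using dfn_not[OF dfn_conj[OF dfn_not dfn_not], of M \<sigma> K P Q] by simp

text \<open>The formula can be chosen such that a given component \<open>k\<close> only interprets the variable \<open>0\<close>.\<close>

lemma dfn_isolate:
  fixes M :: "('f, 'r, 's, 'a) struct" and \<sigma> :: "'k \<Rightarrow> 's"
  assumes "dfn M \<sigma> K P"
  obtains \<phi> \<eta> where "formula M {} (\<sigma> \<circ> \<eta>) \<phi>" "\<eta> 0 = k" "\<And>n. n \<in> fvars \<phi> - {0} \<Longrightarrow> \<eta> n \<in> K - {k}"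
    "\<And>c. P c \<longleftrightarrow> sat M UNIV (c \<circ> \<eta>) \<phi>"
proof -
  obtain \<phi> \<eta> where *: "formula M {} (\<sigma> \<circ> \<eta>) \<phi>" "\<eta> ` fvars \<phi> \<subseteq> K" "P = (\<lambda>c. sat M UNIV (c \<circ> \<eta>) \<phi>)"
    using assms by (rule dfnE)
  define \<theta> :: "nat \<Rightarrow> ('f, 'a) trm" where "\<theta> = (\<lambda>n. if \<eta> n = k then Var 0 else Var (Suc n))"
  have cf: "capture_free Suc \<theta> Par" by (auto simp: capture_free_def \<theta>_def)
  define \<eta>' where "\<eta>' = (\<lambda>n. case n of 0 \<Rightarrow> k | Suc m \<Rightarrow> \<eta> m)"
  define \<psi> where "\<psi> = sub Suc \<theta> Par \<phi>"
  have "(\<lambda>n. eval M (c \<circ> \<eta>') (\<theta> n)) = c \<circ> \<eta>" for c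
    by (auto simp: \<theta>_def \<eta>'_def)
  then have "P c \<longleftrightarrow> sat M UNIV (c \<circ> \<eta>') \<psi>" for c
    unfolding \<psi>_def *(3) by (subst sat_sub[OF cf]) auto
  moreover have hs: "has_sort M (\<sigma> \<circ> \<eta>') (\<theta> n) ((\<sigma> \<circ> \<eta>) n)" for n
    using has_sort.intros(1)[of M "\<sigma> \<circ> \<eta>'" 0] has_sort.intros(1)[of M "\<sigma> \<circ> \<eta>'" "Suc n"]
    by (auto simp: \<theta>_def \<eta>'_def)
  have "well_sorted M (\<sigma> \<circ> \<eta>') \<psi>" unfolding \<psi>_def
    by (rule well_sorted_sub[of _ "\<sigma> \<circ> \<eta>"]) (use * cf hs in \<open>auto simp: formula_def intro: has_sort.intros(2)\<close>)
  moreover have "pars \<psi> = {}"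
    using pars_sub[of Suc \<theta> Par \<phi>] *(1) by (auto simp: \<psi>_def formula_def \<theta>_def split: if_splits)
  moreover have "\<eta>' n \<in> K - {k}" if "n \<in> fvars \<psi> - {0}" for n
  proof -
    have "\<exists>m. n = Suc m \<and> m \<in> fvars \<phi> \<and> \<eta> m \<noteq> k"
      using that fvars_sub[OF cf, of \<phi>] by (auto simp: \<psi>_def \<theta>_def split: if_splits)
    then show ?thesis using *(2) by (auto simp: \<eta>'_def)
  qed
  ultimately show thesis using that[of \<eta>' \<psi>] unfolding formula_def by (simp add: \<eta>'_def)
qed

lemma sat_isolate:
  assumes "\<eta> 0 = k" "\<And>n. n \<in> fvars \<phi> - {0} \<Longrightarrow> \<eta> n \<noteq> k"
  shows "sat M D (c(k := x) \<circ> \<eta>) \<phi> \<longleftrightarrow> sat M D ((c \<circ> \<eta>)(0 := x)) \<phi>"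
  by (rule sat_cong) (use assms in auto)

lemma dfn_ex:
  assumes "dfn M \<sigma> K P"
  shows "dfn M \<sigma> (K - {k}) (\<lambda>c. \<exists>x. sort_of M x = \<sigma> k \<and> P (c(k := x)))"
proof -
  obtain \<phi> \<eta> where *: "formula M {} (\<sigma> \<circ> \<eta>) \<phi>" "\<eta> 0 = k" "\<And>n. n \<in> fvars \<phi> - {0} \<Longrightarrow> \<eta> n \<in> K - {k}"
    "\<And>c. P c \<longleftrightarrow> sat M UNIV (c \<circ> \<eta>) \<phi>"
    by (rule dfn_isolate[OF assms, of k]) (rule that)
  have "sat M UNIV (c(k := x) \<circ> \<eta>) \<phi> \<longleftrightarrow> sat M UNIV ((c \<circ> \<eta>)(0 := x)) \<phi>" for c x
    by (rule sat_isolate) (use * in auto)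
  then have eq: "(\<lambda>c. \<exists>x. sort_of M x = \<sigma> k \<and> P (c(k := x))) = (\<lambda>c. sat M UNIV (c \<circ> \<eta>) (Ex 0 (\<sigma> k) \<phi>))"
    by (simp add: *(4))
  have "(\<sigma> \<circ> \<eta>)(0 := \<sigma> k) = \<sigma> \<circ> \<eta>" using *(2) by auto
  then show ?thesis unfolding eq by (intro dfnI) (use *(1,3) in \<open>auto simp: formula_def\<close>)
qed

text \<open>The Tarski--Vaught test.\<close>

lemma elem_submodel_witness:
  assumes "elem_submodel M N" "dfn M \<sigma> K P"
    and c: "\<And>j. j \<in> K - {k} \<Longrightarrow> c j \<in> N \<and> sort_of M (c j) = \<sigma> j"
    and ex: "\<exists>x. sort_of M x = \<sigma> k \<and> P (c(k := x))"
  shows "\<exists>x\<in>N. sort_of M x = \<sigma> k \<and> P (c(k := x))"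
proof -
  obtain \<phi> \<eta> where *: "formula M {} (\<sigma> \<circ> \<eta>) \<phi>" "\<eta> 0 = k" "\<And>n. n \<in> fvars \<phi> - {0} \<Longrightarrow> \<eta> n \<in> K - {k}"
    "\<And>c. P c \<longleftrightarrow> sat M UNIV (c \<circ> \<eta>) \<phi>"
    by (rule dfn_isolate[OF assms(2), of k]) (rule that)
  obtain n0 where n0: "n0 \<in> N" using assms(1) by (auto simp: elem_submodel_def)
  define e where "e n = (if n \<in> fvars \<phi> - {0} then c (\<eta> n) else n0)" for n
  have e: "e n \<in> N" for n using c *(3) n0 by (auto simp: e_def)
  have eq: "P (c(k := x)) \<longleftrightarrow> sat M UNIV (e(0 := x)) \<phi>" for x
    unfolding *(4) by (rule sat_cong) (use *(2,3) in \<open>auto simp: e_def\<close>)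
  have f: "formula M {} (sort_of M \<circ> e(0 := x)) \<phi>" if "sort_of M x = \<sigma> k" for x
    by (rule formula_cong[OF _ *(1)]) (use that c *(2,3) in \<open>auto simp: e_def\<close>)
  have el: "sat M N e' \<psi> \<longleftrightarrow> sat M UNIV e' \<psi>"
    if "\<And>n. e' n \<in> N" "formula M {} (sort_of M \<circ> e') \<psi>" for e' \<psi>
  proof -
    have "range e' \<subseteq> N" using that(1) by auto
    then show ?thesis using assms(1) that(2) unfolding elem_submodel_def by blast
  qed
  obtain x0 where x0: "sort_of M x0 = \<sigma> k" "P (c(k := x0))" using ex by blast
  have "(sort_of M \<circ> e)(0 := \<sigma> k) = sort_of M \<circ> e(0 := x0)" using x0(1) by auto
  then have "formula M {} (sort_of M \<circ> e) (Ex 0 (\<sigma> k) \<phi>)"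
    using f[OF x0(1)] unfolding formula_def by (simp only: well_sorted.simps fm.set)
  moreover have "sat M UNIV e (Ex 0 (\<sigma> k) \<phi>)" using x0 eq by auto
  ultimately have "sat M N e (Ex 0 (\<sigma> k) \<phi>)" using el[of e] e by blast
  then obtain x where x: "x \<in> N" "sort_of M x = \<sigma> k" "sat M N (e(0 := x)) \<phi>" by auto
  then have "sat M UNIV (e(0 := x)) \<phi>" using el[of "e(0 := x)" \<phi>] e f by simp
  then show ?thesis using x eq by blast
qed

lemma dfn_eq: "\<sigma> k = \<sigma> l \<Longrightarrow> k \<in> K \<Longrightarrow> l \<in> K \<Longrightarrow> dfn M \<sigma> K (\<lambda>c. c k = c l)"
proof -
  assume a: "\<sigma> k = \<sigma> l" "k \<in> K" "l \<in> K"
  define \<eta> where "\<eta> = (\<lambda>n::nat. if n = 0 then k else l)"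
  have "dfn M \<sigma> K (\<lambda>c. sat M UNIV (c \<circ> \<eta>) (Eq (Var 0) (Var 1)))"
    by (rule dfnI) (use a has_sort.intros(1)[of M "\<sigma> \<circ> \<eta>" 0] has_sort.intros(1)[of M "\<sigma> \<circ> \<eta>" 1]
      in \<open>auto simp: formula_def \<eta>_def\<close>)
  then show ?thesis by (simp add: \<eta>_def)
qed

text \<open>Fixing all but one component of a tuple turns a definable predicate into a formula with parameters.\<close>

lemma dfn_instance:
  fixes M :: "('f, 'r, 's, 'a) struct" and \<sigma> :: "'k \<Rightarrow> 's"
  assumes "dfn M \<sigma> K P" and "\<And>j. j \<in> K - {k} \<Longrightarrow> sort_of M (c j) = \<sigma> j"
  shows "\<exists>\<chi>. formula M (c ` (K - {k})) (\<lambda>_. \<sigma> k) \<chi> \<and> fvars \<chi> \<subseteq> {0} \<and>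
    (\<forall>x. sat M UNIV (\<lambda>_. x) \<chi> \<longleftrightarrow> P (c(k := x)))"
proof -
  obtain \<phi> \<eta> where *: "formula M {} (\<sigma> \<circ> \<eta>) \<phi>" "\<eta> ` fvars \<phi> \<subseteq> K" "P = (\<lambda>c. sat M UNIV (c \<circ> \<eta>) \<phi>)"
    using assms(1) by (rule dfnE)
  define \<theta> :: "nat \<Rightarrow> ('f, 'a) trm" where "\<theta> = (\<lambda>n. if \<eta> n = k then Var 0 else Par (c (\<eta> n)))"
  define \<chi> where "\<chi> = sub Suc \<theta> Par \<phi>"
  have cf: "capture_free Suc \<theta> Par" by (auto simp: capture_free_def \<theta>_def)
  have "(\<lambda>n. eval M (\<lambda>_. x) (\<theta> n)) = c(k := x) \<circ> \<eta>" for x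
    by (auto simp: \<theta>_def)
  then have "sat M UNIV (\<lambda>_. x) \<chi> \<longleftrightarrow> P (c(k := x))" for x
    unfolding \<chi>_def by (subst sat_sub[OF cf]) (auto simp: *(3))
  moreover have "has_sort M (\<lambda>_. \<sigma> k) (\<theta> n) ((\<sigma> \<circ> \<eta>) n)" if "n \<in> fvars \<phi>" for n
    using has_sort.intros(1)[of M "\<lambda>_. \<sigma> k" 0] has_sort.intros(2)[of M "\<lambda>_. \<sigma> k" "c (\<eta> n)"] assms(2) *(2) that
    by (auto simp: \<theta>_def)
  then have "well_sorted M (\<lambda>_. \<sigma> k) \<chi>" unfolding \<chi>_def
    by (intro well_sorted_sub[of _ "\<sigma> \<circ> \<eta>"]) (use * cf in \<open>auto simp: formula_def intro: has_sort.intros(2)\<close>)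
  moreover have "pars \<chi> \<subseteq> c ` (K - {k})"
  proof -
    have "pars \<chi> \<subseteq> (\<Union>n\<in>fvars \<phi>. tpars (\<theta> n))"
      using pars_sub[of Suc \<theta> Par \<phi>] *(1) by (simp add: \<chi>_def formula_def)
    also have "\<dots> \<subseteq> c ` (K - {k})" using *(2) by (auto simp: \<theta>_def split: if_splits)
    finally show ?thesis .
  qed
  moreover have "fvars \<chi> \<subseteq> {0}"
    using fvars_sub[OF cf, of \<phi>] *(1) by (auto simp: \<chi>_def \<theta>_def formula_def split: if_splits)
  ultimately show ?thesis unfolding formula_def by blast
qed

text \<open>
  Saturation for the \<open>k\<close>th component of a tuple whose other components are given. As \<open>\<P>\<close> is closed
  under conjunction, it is enough to satisfy each of its members.
\<close>

lemma saturated_dfn: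
  assumes "saturated M" and "small M (c ` (K - {k}))" and "\<And>j. j \<in> K - {k} \<Longrightarrow> sort_of M (c j) = \<sigma> j"
    and dfn: "\<And>P. P \<in> \<P> \<Longrightarrow> dfn M \<sigma> K P"
    and conj: "\<And>P Q. P \<in> \<P> \<Longrightarrow> Q \<in> \<P> \<Longrightarrow> (\<lambda>c. P c \<and> Q c) \<in> \<P>"
    and "\<P> \<noteq> {}"
    and ex: "\<And>P. P \<in> \<P> \<Longrightarrow> \<exists>x. sort_of M x = \<sigma> k \<and> P (c(k := x))"
  shows "\<exists>x. sort_of M x = \<sigma> k \<and> (\<forall>P\<in>\<P>. P (c(k := x)))"
proof -
  define is_inst where "is_inst \<chi> P \<longleftrightarrow> formula M (c ` (K - {k})) (\<lambda>_. \<sigma> k) \<chi> \<and> fvars \<chi> \<subseteq> {0} \<and>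
    (\<forall>x. sat M UNIV (\<lambda>_. x) \<chi> \<longleftrightarrow> P (c(k := x)))" for \<chi> P
  define \<Phi> where "\<Phi> = {\<chi>. \<exists>P\<in>\<P>. is_inst \<chi> P}"
  have inst: "\<exists>\<chi>. is_inst \<chi> P" if "P \<in> \<P>" for P
    unfolding is_inst_def by (rule dfn_instance) (use that dfn assms(3) in auto)
  have fin: "\<exists>P\<in>\<P>. \<forall>x. P (c(k := x)) \<longrightarrow> (\<forall>\<phi>\<in>\<Psi>. sat M UNIV (\<lambda>_. x) \<phi>)" if "finite \<Psi>" "\<Psi> \<subseteq> \<Phi>" for \<Psi>
    using that
  proof (induction \<Psi> rule: finite_induct)
    case empty
    then show ?case using \<open>\<P> \<noteq> {}\<close> by auto
  next
    case (insert \<phi> \<Psi>)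
    then obtain P where P: "P \<in> \<P>" "\<forall>x. P (c(k := x)) \<longrightarrow> (\<forall>\<phi>\<in>\<Psi>. sat M UNIV (\<lambda>_. x) \<phi>)" by blast
    obtain Q where Q: "Q \<in> \<P>" "is_inst \<phi> Q" using insert by (auto simp: \<Phi>_def)
    show ?case
      by (rule bexI[OF _ conj[OF P(1) Q(1)]]) (use P Q in \<open>unfold is_inst_def, blast\<close>)
  qed
  have "\<exists>x. sort_of M x = \<sigma> k \<and> (\<forall>\<phi>\<in>\<Phi>. sat M UNIV (\<lambda>_. x) \<phi>)"
  proof (rule assms(1)[unfolded saturated_def, rule_format, of "c ` (K - {k})"], intro conjI ballI allI impI)
    fix \<phi> assume "\<phi> \<in> \<Phi>"
    then show "formula M (c ` (K - {k})) (\<lambda>_. \<sigma> k) \<phi>" "fvars \<phi> \<subseteq> {0}" by (auto simp: \<Phi>_def is_inst_def)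
  next
    fix \<Psi> assume "\<Psi> \<subseteq> \<Phi>" "finite \<Psi>"
    then show "\<exists>x. sort_of M x = \<sigma> k \<and> (\<forall>\<phi>\<in>\<Psi>. sat M UNIV (\<lambda>_. x) \<phi>)"
      using fin ex by meson
  qed (use assms in auto)
  then show ?thesis using inst unfolding \<Phi>_def is_inst_def by blast
qed

text \<open>The subtuples of \<open>c\<close> and \<open>c'\<close> with indices in \<open>K\<close> have the same type over \<open>\<emptyset>\<close>.\<close>

definition eqtp :: "('f, 'r, 's, 'a) struct \<Rightarrow> 'k set \<Rightarrow> ('k \<Rightarrow> 'a) \<Rightarrow> ('k \<Rightarrow> 'a) \<Rightarrow> bool" where
  "eqtp M K c c' \<longleftrightarrow> (\<forall>k\<in>K. sort_of M (c k) = sort_of M (c' k)) \<and>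
     (\<forall>P. dfn M (sort_of M \<circ> c) K P \<longrightarrow> (P c \<longleftrightarrow> P c'))"

lemma eqtp_sort: "eqtp M K c c' \<Longrightarrow> k \<in> K \<Longrightarrow> sort_of M (c k) = sort_of M (c' k)"
  by (simp add: eqtp_def)

lemma eqtpD: "eqtp M K c c' \<Longrightarrow> dfn M (sort_of M \<circ> c) K P \<Longrightarrow> P c \<longleftrightarrow> P c'"
  by (simp add: eqtp_def)

lemma eqtp_sym: "eqtp M K c c' \<Longrightarrow> eqtp M K c' c"
proof -
  assume a: "eqtp M K c c'"
  have "P c' \<longleftrightarrow> P c" if "dfn M (sort_of M \<circ> c') K P" for P
    using eqtpD[OF a dfn_cong[OF that]] eqtp_sort[OF a] by simp
  then show ?thesis using a by (simp add: eqtp_def)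
qed

lemma eqtp_agree:
  assumes "eqtp M K c c'" "\<And>k. k \<in> K \<Longrightarrow> d k = c k" "\<And>k. k \<in> K \<Longrightarrow> d' k = c' k"
  shows "eqtp M K d d'"
  unfolding eqtp_def
proof (intro conjI ballI allI impI)
  fix k assume "k \<in> K" then show "sort_of M (d k) = sort_of M (d' k)" using assms by (simp add: eqtp_def)
next
  fix P assume P: "dfn M (sort_of M \<circ> d) K P"
  have "dfn M (sort_of M \<circ> c) K P" by (rule dfn_cong[OF P]) (use assms in auto)
  then have "P c \<longleftrightarrow> P c'" using assms(1) by (simp add: eqtp_def)
  moreover have "P d \<longleftrightarrow> P c" "P d' \<longleftrightarrow> P c'" using dfn_agree[OF P] assms by blast+
  ultimately show "P d \<longleftrightarrow> P d'" by simp
qed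

lemma eqtp_mono: "eqtp M K c c' \<Longrightarrow> K0 \<subseteq> K \<Longrightarrow> eqtp M K0 c c'"
  unfolding eqtp_def using dfn_mono by blast

lemma eqtp_finite:
  assumes "\<And>K0. finite K0 \<Longrightarrow> K0 \<subseteq> K \<Longrightarrow> eqtp M K0 c c'"
  shows "eqtp M K c c'"
  unfolding eqtp_def
proof (intro conjI ballI allI impI)
  fix k assume "k \<in> K" then show "sort_of M (c k) = sort_of M (c' k)"
    using assms[of "{k}"] by (simp add: eqtp_def)
next
  fix P assume P: "dfn M (sort_of M \<circ> c) K P"
  then obtain K0 where "finite K0" "K0 \<subseteq> K" "dfn M (sort_of M \<circ> c) K0 P" by (rule dfn_finite)
  then show "P c \<longleftrightarrow> P c'" using assms[of K0] by (simp add: eqtp_def)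
qed

section \<open>Smallness\<close>

lemma monsterD:
  assumes "monster M"
  shows "is_structure M" "saturated M"
  using assms by (auto simp: monster_def)

lemma formula_var: "formula M {} (\<lambda>_. s) (Eq (Var n) (Var n))"
  using has_sort.intros(1)[of M "\<lambda>_. s" n] by (auto simp: formula_def)

lemma infinite_formulas: "infinite {\<phi> :: ('f, 'r, 's, 'a) fm. \<exists>\<Gamma>. formula M {} \<Gamma> \<phi>}"
proof
  assume fin: "finite {\<phi> :: ('f, 'r, 's, 'a) fm. \<exists>\<Gamma>. formula M {} \<Gamma> \<phi>}"
  have "range (\<lambda>n. Eq (Var n) (Var n)) \<subseteq> {\<phi> :: ('f, 'r, 's, 'a) fm. \<exists>\<Gamma>. formula M {} \<Gamma> \<phi>}"
    using formula_var[of M] by blast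
  then have "finite (range (\<lambda>n. Eq (Var n) (Var n) :: ('f, 'r, 's, 'a) fm))" using fin finite_subset by blast
  moreover have "inj (\<lambda>n. Eq (Var n) (Var n) :: ('f, 'r, 's, 'a) fm)" by (auto simp: inj_def)
  ultimately show False by (simp add: finite_image_iff)
qed

lemma monster_infinite:
  assumes "monster (M :: ('f, 'r, 's, 'a) struct)"
  shows "infinite (UNIV :: 'a set)"
  using assms infinite_formulas[of M] card_of_ordLeq_finite[OF ordLess_imp_ordLeq]
  unfolding monster_def small_def by blast

lemma small_subset: "small M A \<Longrightarrow> A' \<subseteq> A \<Longrightarrow> small M A'"
  unfolding small_def using card_of_mono1 ordLeq_ordLess_trans by blast

lemma small_image: "small M A \<Longrightarrow> small M (h ` A)"
  unfolding small_def using card_of_image ordLeq_ordLess_trans by blast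

lemma small_finite: "monster M \<Longrightarrow> finite A \<Longrightarrow> small M A"
  unfolding small_def using finite_ordLess_infinite2 monster_infinite by blast

lemma small_Un: "monster M \<Longrightarrow> small M A \<Longrightarrow> small M A' \<Longrightarrow> small M (A \<union> A')"
  unfolding small_def by (intro card_of_Un_ordLess_infinite) (auto simp: monster_infinite)

lemma small_UN:
  assumes "monster M" "finite I" "\<And>i. i \<in> I \<Longrightarrow> small M (A i)"
  shows "small M (\<Union>i\<in>I. A i)"
  using assms(2,3) by (induction I rule: finite_induct) (auto simp: small_finite[OF assms(1)] small_Un[OF assms(1)])

section \<open>Automorphisms preserve satisfaction\<close>

lemma AutsD:
  assumes "\<sigma> \<in> Auts M B"
  shows "bij \<sigma>" "inj \<sigma>" "surj \<sigma>" "x \<in> B \<Longrightarrow> \<sigma> x = x" "sort_of M (\<sigma> x) = sort_of M x"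
  using assms by (auto simp: Auts_def bij_def)

lemma Auts_mono: "\<sigma> \<in> Auts M B \<Longrightarrow> B' \<subseteq> B \<Longrightarrow> \<sigma> \<in> Auts M B'"
  by (auto simp: Auts_def)

lemma Auts_image: "\<sigma> \<in> Auts M B \<Longrightarrow> \<sigma> ` B = B"
  by (auto simp: Auts_def image_iff)

lemma id_Auts: "id \<in> Auts M B"
  by (auto simp: Auts_def)

lemma Auts_fun:
  "\<sigma> \<in> Auts M B \<Longrightarrow> f \<in> funs M \<Longrightarrow> map (sort_of M) xs = fst (fun_sorts M f)
    \<Longrightarrow> \<sigma> (fun_int M f xs) = fun_int M f (map \<sigma> xs)"
  unfolding Auts_def by blast

lemma Auts_rel:
  "\<sigma> \<in> Auts M B \<Longrightarrow> r \<in> rels M \<Longrightarrow> map (sort_of M) xs = rel_sorts M r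
    \<Longrightarrow> xs \<in> rel_int M r \<longleftrightarrow> map \<sigma> xs \<in> rel_int M r"
  unfolding Auts_def by blast

lemma AutsI:
  assumes "bij \<sigma>" "\<And>x. x \<in> B \<Longrightarrow> \<sigma> x = x" "\<And>x. sort_of M (\<sigma> x) = sort_of M x"
    and "\<And>f xs. f \<in> funs M \<Longrightarrow> map (sort_of M) xs = fst (fun_sorts M f)
      \<Longrightarrow> \<sigma> (fun_int M f xs) = fun_int M f (map \<sigma> xs)"
    and "\<And>r xs. r \<in> rels M \<Longrightarrow> map (sort_of M) xs = rel_sorts M r
      \<Longrightarrow> xs \<in> rel_int M r \<longleftrightarrow> map \<sigma> xs \<in> rel_int M r"
  shows "\<sigma> \<in> Auts M B"
  using assms unfolding Auts_def by blast

lemma comp_Auts: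
  assumes "\<sigma> \<in> Auts M B" "\<tau> \<in> Auts M B" shows "\<sigma> \<circ> \<tau> \<in> Auts M B"
proof (rule AutsI)
  have m: "map (sort_of M) (map \<tau> xs) = map (sort_of M) xs" for xs
    by (simp add: AutsD(5)[OF assms(2)])
  show "(\<sigma> \<circ> \<tau>) (fun_int M f xs) = fun_int M f (map (\<sigma> \<circ> \<tau>) xs)"
    if "f \<in> funs M" "map (sort_of M) xs = fst (fun_sorts M f)" for f xs
    using Auts_fun[OF assms(2) that] Auts_fun[OF assms(1) that(1), of "map \<tau> xs"] that(2) m[of xs] by simp
  show "xs \<in> rel_int M r \<longleftrightarrow> map (\<sigma> \<circ> \<tau>) xs \<in> rel_int M r"
    if "r \<in> rels M" "map (sort_of M) xs = rel_sorts M r" for r xs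
    using Auts_rel[OF assms(2) that] Auts_rel[OF assms(1) that(1), of "map \<tau> xs"] that(2) m[of xs] by simp
qed (use AutsD[OF assms(1)] AutsD[OF assms(2)] in \<open>auto simp: bij_comp\<close>)

text \<open>The inverse of a permutation of the universe.\<close>

abbreviation finv :: "('a \<Rightarrow> 'a) \<Rightarrow> 'a \<Rightarrow> 'a" where
  "finv \<sigma> \<equiv> inv_into UNIV \<sigma>"

lemma inv_Auts:
  assumes "is_structure M" "\<sigma> \<in> Auts M B" shows "finv \<sigma> \<in> Auts M B"
proof -
  note b = AutsD[OF assms(2)]
  have c: "\<sigma> (finv \<sigma> x) = x" "finv \<sigma> (\<sigma> x) = x" for x
    using b surj_f_inv_f inv_f_f by metis+
  have s: "sort_of M (finv \<sigma> x) = sort_of M x" for x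
    using b(5)[of "finv \<sigma> x"] c by simp
  have m: "map (sort_of M) (map (finv \<sigma>) xs) = map (sort_of M) xs" for xs
    by (simp add: s comp_def)
  have mm: "map \<sigma> (map (finv \<sigma>) xs) = xs" for xs by (simp add: c comp_def)
  have "finv \<sigma> (fun_int M f xs) = fun_int M f (map (finv \<sigma>) xs)"
    if "f \<in> funs M" "map (sort_of M) xs = fst (fun_sorts M f)" for f xs
  proof -
    have "\<sigma> (fun_int M f (map (finv \<sigma>) xs)) = fun_int M f (map \<sigma> (map (finv \<sigma>) xs))"
      by (rule Auts_fun[OF assms(2) that(1)]) (use that(2) m[of xs] in simp)
    then show ?thesis unfolding mm using c by metis
  qed
  moreover have "xs \<in> rel_int M r \<longleftrightarrow> map (finv \<sigma>) xs \<in> rel_int M r"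
    if "r \<in> rels M" "map (sort_of M) xs = rel_sorts M r" for r xs
  proof -
    have "map (finv \<sigma>) xs \<in> rel_int M r \<longleftrightarrow> map \<sigma> (map (finv \<sigma>) xs) \<in> rel_int M r"
      by (rule Auts_rel[OF assms(2) that(1)]) (use that(2) m[of xs] in simp)
    then show ?thesis unfolding mm by simp
  qed
  moreover have "finv \<sigma> x = x" if "x \<in> B" for x using b(4)[OF that] c(2)[of x] by simp
  ultimately show ?thesis using b(1) s by (intro AutsI) (auto simp: bij_imp_bij_inv)
qed

lemma eval_aut:
  assumes "is_structure M" "\<sigma> \<in> Auts M {}" "has_sort M (sort_of M \<circ> e) t s"
  shows "eval M (\<sigma> \<circ> e) (map_trm (\<lambda>x. x) \<sigma> t) = \<sigma> (eval M e t) \<and> sort_of M (eval M e t) = s"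
  using assms(3)
proof (induction rule: has_sort.induct)
  case (3 f ts)
  have l: "list_all2 (\<lambda>t s. eval M (\<sigma> \<circ> e) (map_trm (\<lambda>x. x) \<sigma> t) = \<sigma> (eval M e t) \<and> sort_of M (eval M e t) = s)
      ts (fst (fun_sorts M f))"
    using 3(2) by (rule list.rel_mono_strong) blast
  have m: "map (sort_of M) (map (eval M e) ts) = fst (fun_sorts M f)"
    using l unfolding list_all2_conv_all_nth by (intro nth_equalityI) simp_all
  have "map (eval M (\<sigma> \<circ> e)) (map (map_trm (\<lambda>x. x) \<sigma>) ts) = map \<sigma> (map (eval M e) ts)"
    using l unfolding list_all2_conv_all_nth by (intro nth_equalityI) simp_all
  moreover have "\<sigma> (fun_int M f (map (eval M e) ts)) = fun_int M f (map \<sigma> (map (eval M e) ts))"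
    using assms(2) 3(1) m by (simp add: Auts_def)
  moreover have "sort_of M (fun_int M f (map (eval M e) ts)) = snd (fun_sorts M f)"
    using assms(1) 3(1) m by (simp add: is_structure_def)
  ultimately show ?case by (simp only: trm.map eval.simps)
qed auto

text \<open>
  The automorphism also moves the universe \<open>D\<close> over which the quantifiers range; this is needed for
  images of elementary submodels.
\<close>

lemma sat_aut:
  assumes "is_structure M" "\<sigma> \<in> Auts M {}" "well_sorted M (sort_of M \<circ> e) \<phi>"
  shows "sat M (\<sigma> ` D) (\<sigma> \<circ> e) (map_fm (\<lambda>x. x) (\<lambda>x. x) (\<lambda>x. x) \<sigma> \<phi>) \<longleftrightarrow> sat M D e \<phi>"
  using assms(3)
proof (induction \<phi> arbitrary: e)
  case (Eq t u)
  then obtain s where *: "has_sort M (sort_of M \<circ> e) t s" "has_sort M (sort_of M \<circ> e) u s"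
    unfolding well_sorted.simps by blast
  show ?case
    using eval_aut[OF assms(1,2) *(1)] eval_aut[OF assms(1,2) *(2)] inj_eq[OF AutsD(2)[OF assms(2)]]
    by (simp only: fm.map sat.simps)
next
  case (Rel r ts)
  have l0: "list_all2 (has_sort M (sort_of M \<circ> e)) ts (rel_sorts M r)"
    using Rel.prems unfolding well_sorted.simps by blast
  have l: "list_all2 (\<lambda>t s. eval M (\<sigma> \<circ> e) (map_trm (\<lambda>x. x) \<sigma> t) = \<sigma> (eval M e t) \<and> sort_of M (eval M e t) = s)
      ts (rel_sorts M r)"
    using l0 by (rule list.rel_mono_strong) (use eval_aut[OF assms(1,2)] in auto)
  have m: "map (sort_of M) (map (eval M e) ts) = rel_sorts M r"
    using l unfolding list_all2_conv_all_nth by (intro nth_equalityI) simp_all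
  have "map (eval M (\<sigma> \<circ> e)) (map (map_trm (\<lambda>x. x) \<sigma>) ts) = map \<sigma> (map (eval M e) ts)"
    using l unfolding list_all2_conv_all_nth by (intro nth_equalityI) simp_all
  moreover have "map (eval M e) ts \<in> rel_int M r \<longleftrightarrow> map \<sigma> (map (eval M e) ts) \<in> rel_int M r"
    by (rule Auts_rel[OF assms(2)]) (use m Rel.prems in auto)
  ultimately show ?case by (simp only: fm.map sat.simps)
next
  case (Ex n s \<phi>)
  have "sat M (\<sigma> ` D) ((\<sigma> \<circ> e)(n := \<sigma> x)) (map_fm (\<lambda>x. x) (\<lambda>x. x) (\<lambda>x. x) \<sigma> \<phi>) \<longleftrightarrow> sat M D (e(n := x)) \<phi>"
    if "sort_of M x = s" for x
  proof -
    have "sort_of M \<circ> e(n := x) = (sort_of M \<circ> e)(n := s)" using that by auto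
    then have "well_sorted M (sort_of M \<circ> e(n := x)) \<phi>"
      using Ex.prems unfolding well_sorted.simps by (simp only:)
    moreover have "(\<sigma> \<circ> e)(n := \<sigma> x) = \<sigma> \<circ> e(n := x)" by auto
    ultimately show ?thesis using Ex.IH[of "e(n := x)"] by (simp only:)
  qed
  then show ?case
    unfolding fm.map sat.simps Set.bex_simps(7) AutsD(5)[OF assms(2)] by blast
qed auto

lemma sat_aut_over:
  assumes "is_structure M" "\<sigma> \<in> Auts M C" "formula M C (sort_of M \<circ> e) \<phi>"
  shows "sat M UNIV (\<sigma> \<circ> e) \<phi> \<longleftrightarrow> sat M UNIV e \<phi>"
proof -
  have "map_fm (\<lambda>x. x) (\<lambda>x. x) (\<lambda>x. x) \<sigma> \<phi> = \<phi>"
    by (rule map_fm_id) (use assms(3) AutsD(4)[OF assms(2)] in \<open>auto simp: formula_def\<close>)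
  then show ?thesis
    using sat_aut[OF assms(1) Auts_mono[OF assms(2)], of e \<phi> UNIV] assms(3) AutsD(3)[OF assms(2)]
    by (simp add: formula_def)
qed

lemma tp_aut:
  assumes "is_structure M" "\<sigma> \<in> Auts M C" shows "tp M C (\<sigma> \<circ> a) = tp M C a"
proof -
  have "sort_of M \<circ> (\<sigma> \<circ> a) \<circ> \<eta> = sort_of M \<circ> a \<circ> \<eta>" for \<eta> :: "nat \<Rightarrow> 'e" using AutsD(5)[OF assms(2)] by auto
  then show ?thesis
    using sat_aut_over[OF assms] by (auto simp: tp_def comp_assoc)
qed

lemma elem_map_aut:
  assumes "is_structure M" "\<sigma> \<in> Auts M C" and "\<And>x. x \<in> A \<Longrightarrow> h x = \<sigma> x"
  shows "elem_map_on M C A h"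
proof -
  have "h \<circ> e = \<sigma> \<circ> e" if "range e \<subseteq> A" for e :: "nat \<Rightarrow> 'd" using assms(3) that by (auto simp: fun_eq_iff)
  then show ?thesis unfolding elem_map_on_def
    using assms(3) AutsD(5)[OF assms(2)] sat_aut_over[OF assms(1,2)] by (metis (no_types, lifting))
qed

section \<open>Back and forth\<close>

lemma finite_max_underS:
  assumes "Well_order r" "Field r = UNIV" "finite J" "J \<noteq> {}"
  shows "\<exists>j\<in>J. J \<subseteq> insert j (underS r j)"
  using assms(3,4)
proof (induction J rule: finite_ne_induct)
  case (insert x J)
  then obtain j where j: "j \<in> J" "J \<subseteq> insert j (underS r j)" by auto
  have tot: "(x, j) \<in> r \<or> (j, x) \<in> r \<or> x = j"
    using assms(1,2) by (auto simp: well_order_on_def linear_order_on_def total_on_def)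
  have tr: "trans r" and an: "antisym r"
    using assms(1) by (auto simp: well_order_on_def linear_order_on_def partial_order_on_def preorder_on_def)
  show ?case
  proof (cases "(x, j) \<in> r \<or> x = j")
    case True
    then have "insert x J \<subseteq> insert j (underS r j)" using j by (auto simp: underS_def)
    then show ?thesis using j by auto
  next
    case False
    then have jx: "(j, x) \<in> r" "j \<noteq> x" using tot by auto
    have "y \<in> insert x (underS r x)" if "y \<in> J" for y
    proof (cases "y = j")
      case False
      then have "(y, j) \<in> r" "y \<noteq> j" using j(2) that by (auto simp: underS_def)
      then show ?thesis using jx tr an by (auto simp: underS_def dest: transD antisymD)
    qed (use jx in \<open>auto simp: underS_def\<close>)
    then show ?thesis by auto
  qed
qed auto

text \<open>
  Transfinite construction of a function whose initial segments satisfy a condition of finite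
  character.
\<close>

lemma transfinite_choice:
  fixes Q :: "'k set \<Rightarrow> ('k \<Rightarrow> 'v) \<Rightarrow> bool"
  assumes r: "Well_order r" "Field r = UNIV"
    and cong: "\<And>J f g. (\<And>k. k \<in> J \<Longrightarrow> f k = g k) \<Longrightarrow> Q J f \<Longrightarrow> Q J g"
    and fin: "\<And>J f. (\<And>J0. finite J0 \<Longrightarrow> J0 \<subseteq> J \<Longrightarrow> Q J0 f) \<Longrightarrow> Q J f"
    and mono: "\<And>J J0 f. Q J f \<Longrightarrow> J0 \<subseteq> J \<Longrightarrow> Q J0 f"
    and empty: "\<And>f. Q {} f"
    and step: "\<And>k f. Q (underS r k) f \<Longrightarrow> \<exists>v. Q (insert k (underS r k)) (f(k := v))"
  shows "\<exists>f. Q UNIV f"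
proof -
  have wf: "wf (r - Id)" using r by (simp add: well_order_on_def)
  define H where "H f k = (SOME v. Q (insert k (underS r k)) (f(k := v)))" for f :: "'k \<Rightarrow> 'v" and k
  define F where "F = wfrec (r - Id) H"
  have F: "F k = H (cut F (r - Id) k) k" for k
    unfolding F_def by (rule wfrec[OF wf])
  have limit: "Q J F" if J: "\<And>J0. finite J0 \<Longrightarrow> J0 \<subseteq> J \<Longrightarrow> J0 \<noteq> {} \<Longrightarrow> \<exists>j\<in>J. J0 \<subseteq> insert j (underS r j)"
    and Q: "\<And>j. j \<in> J \<Longrightarrow> Q (insert j (underS r j)) F" for J
  proof (rule fin)
    fix J0 assume "finite J0" "J0 \<subseteq> J"
    then show "Q J0 F"
      using J[of J0] Q mono empty by (cases "J0 = {}") blast+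
  qed
  have main: "Q (insert k (underS r k)) F" for k
  proof (induction k rule: wf_induct_rule[OF wf])
    case (1 k)
    have "Q (underS r k) F"
    proof (rule limit)
      fix J0 assume J0: "finite J0" "J0 \<subseteq> underS r k" "J0 \<noteq> {}"
      then show "\<exists>j\<in>underS r k. J0 \<subseteq> insert j (underS r j)"
        using finite_max_underS[OF r, of J0] by blast
    qed (use 1 in \<open>auto simp: underS_def\<close>)
    then have "Q (underS r k) (cut F (r - Id) k)"
      by (rule cong[rotated]) (auto simp: cut_def underS_def)
    from someI_ex[OF step[OF this]] have "Q (insert k (underS r k)) ((cut F (r - Id) k)(k := F k))"
      using F[of k] by (simp only: H_def)
    then show ?case by (rule cong[rotated]) (auto simp: cut_def underS_def)
  qed
  have "Q UNIV F"
  proof (rule limit)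
    fix J0 :: "'k set" assume "finite J0" "J0 \<noteq> {}"
    then show "\<exists>j\<in>UNIV. J0 \<subseteq> insert j (underS r j)"
      using finite_max_underS[OF r] by blast
  qed (rule main)
  then show ?thesis by blast
qed

text \<open>
  The step of the back-and-forth argument: a type-preserving partial map extends to one more point \<open>x\<close>.
\<close>

lemma eqtp_extend:
  assumes "saturated M" "eqtp M K c c'" "k \<notin> K" "small M (c' ` K)"
  shows "\<exists>y. eqtp M (insert k K) (c(k := x)) (c'(k := y))"
proof -
  define \<sigma> where "\<sigma> = sort_of M \<circ> c(k := x)"
  have \<sigma>: "\<sigma> k = sort_of M x" "\<And>j. j \<in> K \<Longrightarrow> \<sigma> j = sort_of M (c j)" "\<And>j. j \<in> K \<Longrightarrow> \<sigma> j = sort_of M (c' j)"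
    using assms(3) eqtp_sort[OF assms(2)] by (auto simp: \<sigma>_def)
  define \<P> where "\<P> = {P. dfn M \<sigma> (insert k K) P \<and> P (c(k := x))}"
  have "\<exists>y. sort_of M y = \<sigma> k \<and> (\<forall>P\<in>\<P>. P (c'(k := y)))"
  proof (rule saturated_dfn[OF assms(1), of c' "insert k K"])
    show "small M (c' ` (insert k K - {k}))" using assms(3,4) by simp
    show "sort_of M (c' j) = \<sigma> j" if "j \<in> insert k K - {k}" for j using that \<sigma> by auto
    have "(\<lambda>c. c k = c k) \<in> \<P>" unfolding \<P>_def using dfn_eq[of \<sigma> k k "insert k K" M] by blast
    then show "\<P> \<noteq> {}" by blast
    fix P assume P: "P \<in> \<P>"
    then show "dfn M \<sigma> (insert k K) P" by (simp add: \<P>_def)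
    then have "dfn M \<sigma> (insert k K - {k}) (\<lambda>c. \<exists>x. sort_of M x = \<sigma> k \<and> P (c(k := x)))" by (rule dfn_ex)
    then have "dfn M (sort_of M \<circ> c) K (\<lambda>c. \<exists>x. sort_of M x = \<sigma> k \<and> P (c(k := x)))"
      using dfn_cong[of M \<sigma> K _ "sort_of M \<circ> c"] assms(3) \<sigma>(2) by simp
    moreover have "\<exists>x. sort_of M x = \<sigma> k \<and> P (c(k := x))" using P \<sigma>(1) by (auto simp: \<P>_def)
    ultimately show "\<exists>y. sort_of M y = \<sigma> k \<and> P (c'(k := y))" using eqtpD[OF assms(2)] by blast
  qed (auto simp: \<P>_def intro: dfn_conj)
  then obtain y where y: "sort_of M y = \<sigma> k" "\<And>P. P \<in> \<P> \<Longrightarrow> P (c'(k := y))" by blast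
  have "eqtp M (insert k K) (c(k := x)) (c'(k := y))"
    unfolding eqtp_def
  proof (intro conjI ballI allI impI)
    fix j assume "j \<in> insert k K"
    then show "sort_of M ((c(k := x)) j) = sort_of M ((c'(k := y)) j)"
      using y(1) \<sigma> eqtp_sort[OF assms(2)] by auto
  next
    fix P assume "dfn M (sort_of M \<circ> c(k := x)) (insert k K) P"
    then have P: "dfn M \<sigma> (insert k K) P" by (simp add: \<sigma>_def)
    then show "P (c(k := x)) \<longleftrightarrow> P (c'(k := y))"
      using y(2)[of P] y(2)[of "\<lambda>c. \<not> P c"] dfn_not[OF P] by (auto simp: \<P>_def)
  qed
  then show ?thesis by blast
qed

lemma eqtp_eq_iff:
  assumes "eqtp M K c c'" "k \<in> K" "l \<in> K" shows "c k = c l \<longleftrightarrow> c' k = c' l"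
proof (cases "sort_of M (c k) = sort_of M (c l)")
  case True
  then show ?thesis using eqtpD[OF assms(1) dfn_eq[OF _ assms(2,3)]] by auto
next
  case False
  then show ?thesis using eqtp_sort[OF assms(1)] assms(2,3) by metis
qed

lemma eqtp_sat:
  assumes "eqtp M K c c'" "formula M {} (sort_of M \<circ> c \<circ> \<eta>) \<phi>" "\<eta> ` fvars \<phi> \<subseteq> K"
  shows "sat M UNIV (c \<circ> \<eta>) \<phi> \<longleftrightarrow> sat M UNIV (c' \<circ> \<eta>) \<phi>"
  using eqtpD[OF assms(1) dfnI[OF assms(2,3)]] .

text \<open>A type-preserving total map which is onto is an automorphism.\<close>

lemma Auts_total:
  assumes "is_structure M" "eqtp M UNIV id \<sigma>" "surj \<sigma>"
  shows "\<sigma> \<in> Auts M {}"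
proof -
  have srt: "sort_of M (\<sigma> x) = sort_of M x" for x using eqtp_sort[OF assms(2)] by simp
  have "inj \<sigma>" using eqtp_eq_iff[OF assms(2)] by (auto simp: inj_def)
  then have b: "bij \<sigma>" using assms(3) by (simp add: bij_def)
  have F: "\<sigma> (fun_int M f xs) = fun_int M f (map \<sigma> xs)"
    if f: "f \<in> funs M" and xs: "map (sort_of M) xs = fst (fun_sorts M f)" for f xs
  proof -
    define n where "n = length xs"
    define e where "e = (\<lambda>k. if k < n then xs ! k else fun_int M f xs)"
    let ?t = "App f (map Var [0..<n])"
    let ?\<phi> = "Eq ?t (Var n)"
    have m: "map (h \<circ> e) [0..<n] = map h xs" for h :: "'d \<Rightarrow> 'x"
      by (rule nth_equalityI) (auto simp: e_def n_def)
    have "list_all2 (has_sort M (sort_of M \<circ> e)) (map Var [0..<n]) (map (sort_of M) xs)"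
      unfolding m[of "sort_of M", symmetric] using has_sort.intros(1)[of M "sort_of M \<circ> e"]
      by (auto simp: list_all2_conv_all_nth)
    then have "has_sort M (sort_of M \<circ> e) ?t (snd (fun_sorts M f))"
      using has_sort.intros(3)[OF f] xs by simp
    moreover have "has_sort M (sort_of M \<circ> e) (Var n) (snd (fun_sorts M f))"
      using has_sort.intros(1)[of M "sort_of M \<circ> e" n] assms(1) f xs by (simp add: is_structure_def e_def)
    ultimately have "formula M {} (sort_of M \<circ> id \<circ> e) ?\<phi>" by (auto simp: formula_def)
    then have *: "sat M UNIV (id \<circ> e) ?\<phi> \<longleftrightarrow> sat M UNIV (\<sigma> \<circ> e) ?\<phi>" by (rule eqtp_sat[OF assms(2)]) simp
    have ev: "eval M (h \<circ> e) ?t = fun_int M f (map h xs)" for h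
      using m[of h] by (simp add: comp_def)
    show ?thesis using * ev[of id] ev[of \<sigma>] by (simp add: e_def)
  qed
  have R: "xs \<in> rel_int M r \<longleftrightarrow> map \<sigma> xs \<in> rel_int M r"
    if r: "r \<in> rels M" and xs: "map (sort_of M) xs = rel_sorts M r" for r xs
  proof -
    define n where "n = length xs"
    define e where "e = (\<lambda>k. xs ! k)"
    let ?\<phi> = "Rel r (map Var [0..<n])"
    have m: "map (h \<circ> e) [0..<n] = map h xs" for h :: "'d \<Rightarrow> 'x"
      by (rule nth_equalityI) (auto simp: e_def n_def)
    have "list_all2 (has_sort M (sort_of M \<circ> e)) (map Var [0..<n]) (map (sort_of M) xs)"
      unfolding m[of "sort_of M", symmetric] using has_sort.intros(1)[of M "sort_of M \<circ> e"]
      by (auto simp: list_all2_conv_all_nth)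
    then have "formula M {} (sort_of M \<circ> id \<circ> e) ?\<phi>" using r xs by (auto simp: formula_def)
    then have *: "sat M UNIV (id \<circ> e) ?\<phi> \<longleftrightarrow> sat M UNIV (\<sigma> \<circ> e) ?\<phi>" by (rule eqtp_sat[OF assms(2)]) simp
    have ev: "map (eval M (h \<circ> e)) (map Var [0..<n]) = map h xs" for h
      using m[of h] by (simp add: comp_def)
    show ?thesis using * ev[of id] ev[of \<sigma>] by simp
  qed
  show ?thesis using b srt F R by (simp add: Auts_def)
qed

text \<open>
  Strong homogeneity: tuples of the same type with small range are conjugate. The automorphism is
  built along a well-order of \<open>M\<close> in the order type of its cardinality, so that initial segments are small.
\<close>

theorem homogeneity:
  fixes M :: "('f, 'r, 's, 'a) struct" and c c' :: "'k \<Rightarrow> 'a"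
  assumes M: "monster M" and "eqtp M K c c'" "small M (c ` K)" "small M (c' ` K)"
  shows "\<exists>\<sigma>\<in>Auts M {}. \<forall>k\<in>K. \<sigma> (c k) = c' k"
proof -
  \<comment> \<open>Index \<open>(x, True)\<close> stands for \<open>x\<close> as an argument, with value \<open>snd (f x)\<close>; index \<open>(x, False)\<close>
    stands for \<open>x\<close> as a value, attained at \<open>fst (f x)\<close>.\<close>
  define C where "C f = case_sum c (\<lambda>(x, b). if b then x else fst (f x))" for f :: "'a \<Rightarrow> 'a \<times> 'a"
  define C' where "C' f = case_sum c' (\<lambda>(x, b). if b then snd (f x) else x)" for f :: "'a \<Rightarrow> 'a \<times> 'a"
  define I where "I J = Inl ` K \<union> Inr ` (J \<times> (UNIV :: bool set))" for J :: "'a set"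
  define Q where "Q J f \<longleftrightarrow> eqtp M (I J) (C f) (C' f)" for J f
  let ?r = "|UNIV :: 'a set|"
  have "\<exists>f. Q UNIV f"
  proof (rule transfinite_choice[of ?r])
    show "Well_order ?r" by (rule card_of_Well_order)
    show "Field ?r = UNIV" by (rule Field_card_of)
  next
    fix J and f g :: "'a \<Rightarrow> 'a \<times> 'a" assume "\<And>k. k \<in> J \<Longrightarrow> f k = g k" "Q J f"
    then show "Q J g" unfolding Q_def
      by (elim eqtp_agree) (auto simp: I_def C_def C'_def)
  next
    fix J f assume *: "\<And>J0. finite J0 \<Longrightarrow> J0 \<subseteq> J \<Longrightarrow> Q J0 f"
    show "Q J f" unfolding Q_def
    proof (rule eqtp_finite)
      fix K0 assume K0: "finite K0" "K0 \<subseteq> I J"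
      define J0 where "J0 = {x\<in>J. \<exists>b. Inr (x, b) \<in> K0}"
      have "J0 \<subseteq> (\<lambda>k. fst (projr k)) ` K0" by (force simp: J0_def image_iff)
      then have "finite J0" using K0 finite_subset by blast
      moreover have "J0 \<subseteq> J" by (auto simp: J0_def)
      ultimately have "eqtp M (I J0) (C f) (C' f)" using * by (simp add: Q_def)
      moreover have "K0 \<subseteq> I J0" using K0(2) by (auto simp: I_def J0_def)
      ultimately show "eqtp M K0 (C f) (C' f)" by (rule eqtp_mono)
    qed
  next
    fix J J0 f assume "Q J f" "J0 \<subseteq> J"
    then show "Q J0 f" unfolding Q_def by (elim eqtp_mono) (auto simp: I_def)
  next
    fix f
    have "eqtp M (Inl ` K) (C f) (C' f)" unfolding eqtp_def
    proof (intro conjI ballI allI impI)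
      fix k assume "k \<in> (Inl ` K :: ('k + 'a \<times> bool) set)"
      then show "sort_of M (C f k) = sort_of M (C' f k)"
        using eqtp_sort[OF assms(2)] by (auto simp: C_def C'_def)
    next
      fix P assume P: "dfn M (sort_of M \<circ> C f) (Inl ` K) P"
      then obtain \<phi> \<eta> where *: "formula M {} (sort_of M \<circ> C f \<circ> \<eta>) \<phi>" "\<eta> ` fvars \<phi> \<subseteq> Inl ` K"
        "P = (\<lambda>c. sat M UNIV (c \<circ> \<eta>) \<phi>)" by (rule dfnE)
      define \<zeta> where "\<zeta> n = projl (\<eta> n)" for n
      have \<zeta>: "\<eta> n = Inl (\<zeta> n)" "\<zeta> n \<in> K" if "n \<in> fvars \<phi>" for n
        using *(2) that by (auto simp: \<zeta>_def)
      have "formula M {} (sort_of M \<circ> c \<circ> \<zeta>) \<phi>"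
        by (rule formula_cong[OF _ *(1)]) (use \<zeta> in \<open>auto simp: C_def\<close>)
      then have "sat M UNIV (c \<circ> \<zeta>) \<phi> \<longleftrightarrow> sat M UNIV (c' \<circ> \<zeta>) \<phi>"
        by (rule eqtp_sat[OF assms(2)]) (use \<zeta> in auto)
      moreover have "sat M UNIV (c \<circ> \<zeta>) \<phi> \<longleftrightarrow> P (C f)" "sat M UNIV (c' \<circ> \<zeta>) \<phi> \<longleftrightarrow> P (C' f)"
        unfolding *(3) by (rule sat_cong; use \<zeta> in \<open>auto simp: C_def C'_def\<close>)+
      ultimately show "P (C f) \<longleftrightarrow> P (C' f)" by simp
    qed
    then show "Q {} f" by (simp add: Q_def I_def)
  next
    fix k f assume Q: "Q (underS ?r k) f"
    let ?J = "underS ?r k"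
    have kJ: "k \<notin> ?J" by (simp add: underS_def)
    have smJ: "small M ?J" unfolding small_def
      using card_of_underS[OF card_of_Card_order, of k UNIV] by (simp add: Field_card_of)
    have "C' f ` I ?J \<subseteq> c' ` K \<union> ((snd \<circ> f) ` ?J \<union> ?J)"
      by (auto simp: I_def C'_def split: if_splits)
    then have "small M (C' f ` I ?J)"
      by (rule small_subset[rotated]) (intro small_Un[OF M] small_image[OF smJ] smJ assms(4))
    moreover have "Inr (k, True) \<notin> I ?J" using kJ by (auto simp: I_def)
    ultimately obtain y1 where y1: "eqtp M (insert (Inr (k, True)) (I ?J)) ((C f)(Inr (k, True) := k)) ((C' f)(Inr (k, True) := y1))"
      using eqtp_extend[OF monsterD(2)[OF M], of "I ?J" "C f" "C' f"] Q unfolding Q_def by blast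
    have "((C f)(Inr (k, True) := k)) ` insert (Inr (k, True)) (I ?J) \<subseteq> {k} \<union> (c ` K \<union> ((fst \<circ> f) ` ?J \<union> ?J))"
      by (auto simp: I_def C_def split: if_splits)
    then have "small M (((C f)(Inr (k, True) := k)) ` insert (Inr (k, True)) (I ?J))"
      by (rule small_subset[rotated])
        (intro small_Un[OF M] small_image[OF smJ] smJ assms(3) small_finite[OF M] finite.intros)
    moreover have "Inr (k, False) \<notin> insert (Inr (k, True)) (I ?J)" using kJ by (auto simp: I_def)
    ultimately obtain y2 where y2: "eqtp M (insert (Inr (k, False)) (insert (Inr (k, True)) (I ?J)))
        ((C' f)(Inr (k, True) := y1, Inr (k, False) := k)) ((C f)(Inr (k, True) := k, Inr (k, False) := y2))"
      using eqtp_extend[OF monsterD(2)[OF M] eqtp_sym[OF y1]] by blast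
    have "Q (insert k ?J) (f(k := (y2, y1)))" unfolding Q_def
      by (rule eqtp_agree[OF eqtp_mono[OF eqtp_sym[OF y2]]]) (auto simp: I_def C_def C'_def split: if_splits)
    then show "\<exists>v. Q (insert k ?J) (f(k := v))" by blast
  qed
  then obtain f where f: "eqtp M (I UNIV) (C f) (C' f)" by (auto simp: Q_def)
  define \<sigma> where "\<sigma> x = snd (f x)" for x
  have T: "Inr (x, b) \<in> I UNIV" for x b by (auto simp: I_def)
  have "\<sigma> (fst (f y)) = y" for y
    using eqtp_eq_iff[OF f T[of "fst (f y)" True] T[of y False]] by (simp add: C_def C'_def \<sigma>_def)
  then have surj: "surj \<sigma>" by (rule surjI)
  have "eqtp M UNIV id \<sigma>" unfolding eqtp_def
  proof (intro conjI ballI allI impI)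
    fix x show "sort_of M (id x) = sort_of M (\<sigma> x)"
      using eqtp_sort[OF f T[of x True]] by (simp add: C_def C'_def \<sigma>_def)
  next
    fix P assume P: "dfn M (sort_of M \<circ> id) UNIV P"
    have "dfn M (sort_of M \<circ> C f) (range (\<lambda>x. Inr (x, True))) (\<lambda>d. P (d \<circ> (\<lambda>x. Inr (x, True))))"
      by (rule dfn_reindex[OF P]) (simp add: C_def)
    then have "dfn M (sort_of M \<circ> C f) (I UNIV) (\<lambda>d. P (d \<circ> (\<lambda>x. Inr (x, True))))"
      by (rule dfn_mono) (use T in auto)
    moreover have "C f \<circ> (\<lambda>x. Inr (x, True)) = id" "C' f \<circ> (\<lambda>x. Inr (x, True)) = \<sigma>"
      by (auto simp: C_def C'_def \<sigma>_def)
    ultimately show "P id \<longleftrightarrow> P \<sigma>" using eqtpD[OF f] by metis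
  qed
  then have "\<sigma> \<in> Auts M {}" by (rule Auts_total[OF monsterD(1)[OF M] _ surj])
  moreover have "\<sigma> (c k) = c' k" if "k \<in> K" for k
  proof -
    have "Inl k \<in> I UNIV" using that by (auto simp: I_def)
    then show ?thesis
      using eqtp_eq_iff[OF f T[of "c k" True], of "Inl k"] by (simp add: C_def C'_def \<sigma>_def)
  qed
  ultimately show ?thesis by blast
qed

text \<open>
  Equality of types over a set \<open>C\<close> becomes equality of types over \<open>\<emptyset>\<close> of tuples extended by the
  elements of \<open>C\<close>, each indexed by itself.
\<close>

lemma eqtp_params:
  fixes M :: "('f, 'r, 's, 'a) struct" and c c' :: "'k \<Rightarrow> 'a"
  assumes "\<And>k. k \<in> K \<Longrightarrow> sort_of M (c k) = sort_of M (c' k)"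
    and "\<And>\<phi> \<eta>. formula M C (sort_of M \<circ> c \<circ> \<eta>) \<phi> \<Longrightarrow> \<eta> ` fvars \<phi> \<subseteq> K \<Longrightarrow>
      sat M UNIV (c \<circ> \<eta>) \<phi> \<Longrightarrow> sat M UNIV (c' \<circ> \<eta>) \<phi>"
  shows "eqtp M (Inl ` K \<union> Inr ` C) (case_sum c id) (case_sum c' id)"
  unfolding eqtp_def
proof (intro conjI ballI allI impI)
  fix k assume "k \<in> Inl ` K \<union> Inr ` C"
  then show "sort_of M (case_sum c id k) = sort_of M (case_sum c' id k)" using assms(1) by auto
next
  have imp: "P (case_sum c' id)" if P: "dfn M (sort_of M \<circ> case_sum c id) (Inl ` K \<union> Inr ` C) P"
    "P (case_sum c id)" for P
  proof -
    obtain \<phi> \<eta> where *: "formula M {} (sort_of M \<circ> case_sum c id \<circ> \<eta>) \<phi>" "\<eta> ` fvars \<phi> \<subseteq> Inl ` K \<union> Inr ` C"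
      "P = (\<lambda>c. sat M UNIV (c \<circ> \<eta>) \<phi>)" using P(1) by (rule dfnE)
    define \<theta> :: "nat \<Rightarrow> ('f, 'a) trm" where "\<theta> n = (case \<eta> n of Inl k \<Rightarrow> Var (Suc n) | Inr d \<Rightarrow> Par d)" for n
    define \<zeta> where "\<zeta> = (\<lambda>n. projl (\<eta> (n - 1)))"
    define \<psi> where "\<psi> = sub Suc \<theta> Par \<phi>"
    have cf: "capture_free Suc \<theta> Par" by (auto simp: capture_free_def \<theta>_def split: sum.splits)
    have ev: "eval M (d \<circ> \<zeta>) (\<theta> n) = (case_sum d id \<circ> \<eta>) n" for d n
      by (auto simp: \<theta>_def \<zeta>_def split: sum.splits)
    have sat: "sat M UNIV (d \<circ> \<zeta>) \<psi> \<longleftrightarrow> sat M UNIV (case_sum d id \<circ> \<eta>) \<phi>" for d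
      unfolding \<psi>_def by (subst sat_sub[OF cf]) (simp, simp only: ev)
    have hs: "has_sort M (sort_of M \<circ> c \<circ> \<zeta>) (\<theta> n) ((sort_of M \<circ> case_sum c id \<circ> \<eta>) n)" for n
      using has_sort.intros(1)[of M "sort_of M \<circ> c \<circ> \<zeta>" "Suc n"] has_sort.intros(2)[of M "sort_of M \<circ> c \<circ> \<zeta>"]
      by (auto simp: \<theta>_def \<zeta>_def split: sum.splits)
    have "well_sorted M (sort_of M \<circ> c \<circ> \<zeta>) \<psi>" unfolding \<psi>_def
      by (rule well_sorted_sub[OF _ cf, of M "sort_of M \<circ> case_sum c id \<circ> \<eta>"])
        (use * hs in \<open>auto simp: formula_def intro: has_sort.intros(2)\<close>)
    moreover have "pars \<psi> \<subseteq> C"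
    proof -
      have "pars \<psi> \<subseteq> (\<Union>n\<in>fvars \<phi>. tpars (\<theta> n))"
        using pars_sub[of Suc \<theta> Par \<phi>] *(1) by (simp add: \<psi>_def formula_def)
      also have "\<dots> \<subseteq> C" using *(2) by (fastforce simp: \<theta>_def split: sum.splits)
      finally show ?thesis .
    qed
    moreover have "\<zeta> ` fvars \<psi> \<subseteq> K"
    proof -
      have "\<exists>m k. n = Suc m \<and> m \<in> fvars \<phi> \<and> \<eta> m = Inl k" if "n \<in> fvars \<psi>" for n
        using that fvars_sub[OF cf, of \<phi>] by (auto simp: \<psi>_def \<theta>_def split: sum.splits)
      then show ?thesis using *(2) by (fastforce simp: \<zeta>_def)
    qed
    ultimately show ?thesis using assms(2)[of \<zeta> \<psi>] P(2) by (simp add: formula_def sat *(3))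
  qed
  fix P assume P: "dfn M (sort_of M \<circ> case_sum c id) (Inl ` K \<union> Inr ` C) P"
  show "P (case_sum c id) \<longleftrightarrow> P (case_sum c' id)"
    using imp[OF P] imp[OF dfn_not[OF P]] by blast
qed

lemma homogeneity_over_eqtp:
  assumes M: "monster M" and "small M (c ` K)" "small M (c' ` K)" "small M C"
    and "eqtp M (Inl ` K \<union> Inr ` C) (case_sum c id) (case_sum c' id)"
  shows "\<exists>\<sigma>\<in>Auts M C. \<forall>k\<in>K. \<sigma> (c k) = c' k"
proof -
  let ?K = "Inl ` K \<union> Inr ` C"
  have "case_sum c id ` ?K \<subseteq> c ` K \<union> C" "case_sum c' id ` ?K \<subseteq> c' ` K \<union> C" by auto
  then have "small M (case_sum c id ` ?K)" "small M (case_sum c' id ` ?K)"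
    by (elim small_subset[rotated], intro small_Un[OF M] assms)+
  from homogeneity[OF M assms(5) this] obtain \<sigma> where
    \<sigma>: "\<sigma> \<in> Auts M {}" "\<And>k. k \<in> ?K \<Longrightarrow> \<sigma> (case_sum c id k) = case_sum c' id k" by blast
  have "\<sigma> x = x" if "x \<in> C" for x using \<sigma>(2)[of "Inr x"] that by simp
  then have "\<sigma> \<in> Auts M C" using \<sigma>(1) by (simp add: Auts_def)
  moreover have "\<sigma> (c k) = c' k" if "k \<in> K" for k using \<sigma>(2)[of "Inl k"] that by simp
  ultimately show ?thesis by blast
qed

text \<open>
  The sort \<open>s\<close> of a component is recognized by the formula \<open>\<exists>y (x = y)\<close> with \<open>y\<close> of sort \<open>s\<close>, which is
  well sorted for no other sort of \<open>x\<close>.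
\<close>

lemma tp_sort:
  assumes "tp M C a = tp M C b" shows "sort_of M (a i) = sort_of M (b i)"
proof -
  let ?\<phi> = "Ex 1 (sort_of M (a i)) (Eq (Var 0) (Var 1))"
  have "has_sort M \<Gamma> (Var n) s \<longleftrightarrow> s = \<Gamma> n" for \<Gamma> n s
    by (auto intro: has_sort.intros elim: has_sort.cases)
  then have "(?\<phi>, \<lambda>_. i) \<in> tp M C a" "(?\<phi>, \<lambda>_. i) \<in> tp M C b \<longleftrightarrow> sort_of M (a i) = sort_of M (b i)"
    by (auto simp: tp_def formula_def)
  then show ?thesis using assms by blast
qed

lemma tp_eqtp:
  assumes "tp M C a = tp M C b"
  shows "eqtp M (Inl ` UNIV \<union> Inr ` C) (case_sum a id) (case_sum b id)"
proof (rule eqtp_params)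
  fix \<phi> \<eta> assume "formula M C (sort_of M \<circ> a \<circ> \<eta>) \<phi>" "sat M UNIV (a \<circ> \<eta>) \<phi>"
  then have "(\<phi>, \<eta>) \<in> tp M C a" by (simp add: tp_def)
  then show "sat M UNIV (b \<circ> \<eta>) \<phi>" unfolding assms by (simp add: tp_def)
qed (rule tp_sort[OF assms])

lemma homogeneity_tp:
  assumes "monster M" and "small M C" and "small M (range a)" "small M (range b)" and "tp M C a = tp M C b"
  shows "\<exists>\<sigma>\<in>Auts M C. b = \<sigma> \<circ> a"
proof -
  obtain \<sigma> where "\<sigma> \<in> Auts M C" "\<forall>k\<in>UNIV. \<sigma> (a k) = b k"
    using homogeneity_over_eqtp[OF assms(1,3,4,2) tp_eqtp[OF assms(5)]] by blast
  then show ?thesis by (intro bexI[of _ \<sigma>]) (auto simp: fun_eq_iff)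
qed

lemma homogeneity_elem_map:
  assumes M: "monster M" and "small M C" "small M A" and h: "elem_map_on M C A h"
  shows "\<exists>\<sigma>\<in>Auts M C. \<forall>x\<in>A. \<sigma> x = h x"
proof (cases "A = {}")
  case True
  then show ?thesis using id_Auts by blast
next
  case False
  then obtain a0 where a0: "a0 \<in> A" by auto
  have "eqtp M (Inl ` A \<union> Inr ` C) (case_sum id id) (case_sum h id)"
  proof (rule eqtp_params)
    fix \<phi> \<eta> assume f: "formula M C (sort_of M \<circ> id \<circ> \<eta>) \<phi>" and A: "\<eta> ` fvars \<phi> \<subseteq> A" and s: "sat M UNIV (id \<circ> \<eta>) \<phi>"
    \<comment> \<open>an elementary map is tested on assignments all of whose values lie in its domain\<close>
    define e where "e n = (if n \<in> fvars \<phi> then \<eta> n else a0)" for n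
    have "formula M C (sort_of M \<circ> e) \<phi>" by (rule formula_cong[OF _ f]) (simp add: e_def)
    moreover have "range e \<subseteq> A" using A a0 by (auto simp: e_def)
    moreover have "sat M UNIV e \<phi> \<longleftrightarrow> sat M UNIV (id \<circ> \<eta>) \<phi>" by (rule sat_cong) (simp add: e_def)
    ultimately have "sat M UNIV (h \<circ> e) \<phi>" using h s by (simp add: elem_map_on_def)
    moreover have "sat M UNIV (h \<circ> e) \<phi> \<longleftrightarrow> sat M UNIV (h \<circ> \<eta>) \<phi>" by (rule sat_cong) (simp add: e_def)
    ultimately show "sat M UNIV (h \<circ> \<eta>) \<phi>" by simp
  qed (use h in \<open>auto simp: elem_map_on_def\<close>)
  from homogeneity_over_eqtp[OF M _ _ assms(2) this] show ?thesis
    using small_image[OF assms(3), of id] small_image[OF assms(3), of h] by (simp only: id_apply)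
qed

section \<open>Coheirs over a submodel\<close>

lemma dfn_aut:
  assumes "is_structure M" "\<sigma> \<in> Auts M {}" "dfn M (sort_of M \<circ> c) K P"
  shows "P (\<sigma> \<circ> c) \<longleftrightarrow> P c"
proof -
  obtain \<phi> \<eta> where *: "formula M {} (sort_of M \<circ> c \<circ> \<eta>) \<phi>" "\<eta> ` fvars \<phi> \<subseteq> K" "P = (\<lambda>c. sat M UNIV (c \<circ> \<eta>) \<phi>)"
    using assms(3) by (rule dfnE)
  show ?thesis using sat_aut_over[OF assms(1,2), of "c \<circ> \<eta>" \<phi>] *(1) unfolding *(3) by (simp only: comp_assoc)
qed

lemma elem_submodel_sort:
  assumes "is_structure M" "elem_submodel M N"
  shows "\<exists>x\<in>N. sort_of M x = s"
proof -
  have "dfn M (\<lambda>_. s) {()} (\<lambda>c. c () = c ())" by (rule dfn_eq) auto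
  moreover have "\<exists>x. sort_of M x = s" using assms(1) unfolding is_structure_def by (metis surjD)
  ultimately show ?thesis
    using elem_submodel_witness[OF assms(2), of "\<lambda>_. s" "{()}" "\<lambda>c. c () = c ()" "()"] by auto
qed

text \<open>
  Every tuple \<open>a\<close> has a coheir \<open>c\<close> over a small submodel \<open>N\<close>: \<open>c\<close> realizes the type of \<open>a\<close> over \<open>N\<close>
  and its type over the larger set \<open>C\<close> is finitely satisfiable in \<open>N\<close>. The components of \<open>c\<close> are
  chosen one after the other.
\<close>

lemma coheir:
  fixes M :: "('f, 'r, 's, 'a) struct" and a :: "'i \<Rightarrow> 'a"
  assumes M: "monster M" and N: "elem_submodel M N" and NC: "N \<subseteq> C" and C: "small M C"
    and I: "small M (UNIV :: 'i set)"
  shows "\<exists>c. eqtp M (Inl ` UNIV \<union> Inr ` N) (case_sum a id) (case_sum c id) \<and>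
    (\<forall>P. dfn M (sort_of M \<circ> case_sum a id) (Inl ` UNIV \<union> Inr ` C) P \<longrightarrow> P (case_sum c id) \<longrightarrow>
      (\<exists>n. (\<forall>i. n i \<in> N \<and> sort_of M (n i) = sort_of M (a i)) \<and> P (case_sum n id)))"
proof -
  define T :: "('i \<Rightarrow> 'a) \<Rightarrow> 'i + 'a \<Rightarrow> 'a" where "T f = case_sum f id" for f
  define \<sigma> where "\<sigma> = sort_of M \<circ> T a"
  define IN where "IN J n \<longleftrightarrow> (\<forall>i\<in>J. n i \<in> N \<and> sort_of M (n i) = sort_of M (a i))" for J :: "'i set" and n
  define K where "K J D = Inl ` J \<union> Inr ` D" for J :: "'i set" and D :: "'a set"
  define Q where "Q J f \<longleftrightarrow> eqtp M (K J N) (T a) (T f) \<and>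
    (\<forall>P. dfn M \<sigma> (K J C) P \<longrightarrow> P (T f) \<longrightarrow> (\<exists>n. IN J n \<and> P (T n)))" for J f
  note st = monsterD(1)[OF M]
  have Kmono: "K J D \<subseteq> K J' D'" if "J \<subseteq> J'" "D \<subseteq> D'" for J J' D D' using that by (auto simp: K_def)
  have Tagree: "T f k = T g k" if "\<And>i. i \<in> J \<Longrightarrow> f i = g i" "k \<in> K J D" for f g k J D
    using that by (auto simp: T_def K_def)
  let ?r = "|UNIV :: 'i set|"
  have "\<exists>f. Q UNIV f"
  proof (rule transfinite_choice[of ?r])
    show "Well_order ?r" by (rule card_of_Well_order)
    show "Field ?r = UNIV" by (rule Field_card_of)
  next
    fix J and f g :: "'i \<Rightarrow> 'a" assume fg: "\<And>k. k \<in> J \<Longrightarrow> f k = g k" and Q: "Q J f"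
    have "eqtp M (K J N) (T a) (T g)"
      by (rule eqtp_agree[of M "K J N" "T a" "T f"]) (use Q Tagree[OF fg] in \<open>auto simp: Q_def\<close>)
    moreover have "P (T f) \<longleftrightarrow> P (T g)" if "dfn M \<sigma> (K J C) P" for P
      by (rule dfn_agree[OF that]) (rule Tagree[OF fg])
    ultimately show "Q J g" using Q by (auto simp: Q_def)
  next
    fix J f assume *: "\<And>J0. finite J0 \<Longrightarrow> J0 \<subseteq> J \<Longrightarrow> Q J0 f"
    have sub: "\<exists>J0. finite J0 \<and> J0 \<subseteq> J \<and> K0 \<subseteq> K J0 D" if K0: "finite K0" "K0 \<subseteq> K J D" for K0 D
    proof (intro exI conjI)
      let ?J0 = "projl ` (K0 \<inter> Inl ` J)"
      show "finite ?J0" using K0 by auto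
      show "?J0 \<subseteq> J" by auto
      show "K0 \<subseteq> K ?J0 D"
      proof
        fix k assume k: "k \<in> K0"
        show "k \<in> K ?J0 D"
        proof (cases k)
          case (Inl i)
          then have "i \<in> J" using k K0(2) by (auto simp: K_def)
          then have "i \<in> ?J0" using k Inl by (intro image_eqI[of _ _ k]) auto
          then show ?thesis using Inl by (simp add: K_def)
        next
          case (Inr x)
          then show ?thesis using k K0(2) by (auto simp: K_def)
        qed
      qed
    qed
    have "eqtp M (K J N) (T a) (T f)"
    proof (rule eqtp_finite)
      fix K0 assume K0: "finite K0" "K0 \<subseteq> K J N"
      obtain J0 where "finite J0" "J0 \<subseteq> J" "K0 \<subseteq> K J0 N" using sub[OF K0] by (elim exE conjE)
      then show "eqtp M K0 (T a) (T f)"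
        using *[of J0] eqtp_mono[of M "K J0 N" "T a" "T f" K0] unfolding Q_def by blast
    qed
    moreover have "\<exists>n. IN J n \<and> P (T n)" if P: "dfn M \<sigma> (K J C) P" "P (T f)" for P
    proof -
      obtain K0 where K0: "finite K0" "K0 \<subseteq> K J C" "dfn M \<sigma> K0 P" using P(1) by (rule dfn_finite)
      obtain J0 where J0: "finite J0" "J0 \<subseteq> J" "K0 \<subseteq> K J0 C" using sub[OF K0(1,2)] by (elim exE conjE)
      then have dP: "dfn M \<sigma> (K J0 C) P" using K0(3) dfn_mono by blast
      then obtain n where n: "IN J0 n" "P (T n)" using *[OF J0(1,2)] P(2) unfolding Q_def by blast
      define n' where "n' i = (if i \<in> J0 then n i else SOME x. x \<in> N \<and> sort_of M x = sort_of M (a i))" for i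
      have "n' i \<in> N \<and> sort_of M (n' i) = sort_of M (a i)" for i
        using n(1) someI_ex[of "\<lambda>x. x \<in> N \<and> sort_of M x = sort_of M (a i)"] elem_submodel_sort[OF st N, of "sort_of M (a i)"]
        by (auto simp: n'_def IN_def)
      moreover have "P (T n') \<longleftrightarrow> P (T n)"
        by (rule dfn_agree[OF dP], rule Tagree[of J0]) (auto simp: n'_def)
      ultimately show ?thesis using n(2) by (auto simp: IN_def)
    qed
    ultimately show "Q J f" by (simp add: Q_def)
  next
    fix J J0 f assume Q: "Q J f" "J0 \<subseteq> J"
    have "eqtp M (K J0 N) (T a) (T f)"
      by (rule eqtp_mono[of M "K J N"]) (use Q Kmono in \<open>auto simp: Q_def\<close>)
    moreover have "\<exists>n. IN J0 n \<and> P (T n)" if P: "dfn M \<sigma> (K J0 C) P" "P (T f)" for P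
    proof -
      have "dfn M \<sigma> (K J C) P" using P(1) by (rule dfn_mono) (rule Kmono[OF Q(2) order_refl])
      then obtain n where "IN J n" "P (T n)" using Q(1) P(2) by (auto simp: Q_def)
      then show ?thesis using Q(2) by (auto simp: IN_def)
    qed
    ultimately show "Q J0 f" by (simp add: Q_def)
  next
    fix f
    have "eqtp M (K {} N) (T a) (T a)" by (simp add: eqtp_def)
    then have "eqtp M (K {} N) (T a) (T f)" by (rule eqtp_agree) (auto simp: K_def T_def)
    then show "Q {} f" by (auto simp: Q_def IN_def)
  next
    fix k f assume Q: "Q (underS ?r k) f"
    let ?J = "underS ?r k" and ?J' = "insert k (underS ?r k)"
    have kJ: "k \<notin> ?J" by (simp add: underS_def)
    have K': "K ?J' D - {Inl k} = K ?J D" for D using kJ by (auto simp: K_def)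
    have Tupd: "(T g)(Inl k := x) = T (g(k := x))" for g x
      by (auto simp: T_def fun_eq_iff split: sum.splits)
    have \<sigma>k: "\<sigma> (Inl k) = sort_of M (a k)" by (simp add: \<sigma>_def T_def)
    \<comment> \<open>The new component has to satisfy the type of \<open>a\<close> over \<open>N\<close> and to avoid everything not
      satisfiable in \<open>N\<close>.\<close>
    define PP where "PP = {\<pi>. dfn M \<sigma> (K ?J' N) \<pi> \<and> \<pi> (T a)}"
    define NN where "NN = {\<phi>. dfn M \<sigma> (K ?J' C) \<phi> \<and> (\<forall>n. IN ?J' n \<longrightarrow> \<not> \<phi> (T n))}"
    define \<P> where "\<P> = {\<lambda>c. \<pi> c \<and> \<not> \<phi> c | \<pi> \<phi>. \<pi> \<in> PP \<and> \<phi> \<in> NN}"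
    have mem\<P>: "(\<lambda>c. \<pi> c \<and> \<not> \<phi> c) \<in> \<P>" if "\<pi> \<in> PP" "\<phi> \<in> NN" for \<pi> \<phi>
      unfolding \<P>_def by (rule CollectI, rule exI[of _ \<pi>], rule exI[of _ \<phi>]) (simp add: that)
    have triv: "dfn M \<sigma> (K ?J' D) (\<lambda>c. c (Inl k) = c (Inl k))" for D by (rule dfn_eq) (auto simp: K_def)
    have true: "(\<lambda>c. True) \<in> PP" using triv by (simp add: PP_def)
    have false: "(\<lambda>c. False) \<in> NN" using dfn_not[OF triv] by (simp add: NN_def)
    have PPC: "dfn M \<sigma> (K ?J' C) \<pi>" if "\<pi> \<in> PP" for \<pi>
      using that dfn_mono[OF _ Kmono[OF order_refl NC]] by (auto simp: PP_def)
    have "\<exists>x. sort_of M x = \<sigma> (Inl k) \<and> (\<forall>P\<in>\<P>. P ((T f)(Inl k := x)))"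
    proof (rule saturated_dfn[OF monsterD(2)[OF M], of "T f" "K ?J' C"])
      have "T f ` (K ?J C) \<subseteq> f ` UNIV \<union> C" by (auto simp: K_def T_def)
      then show "small M (T f ` (K ?J' C - {Inl k}))" unfolding K'
        by (rule small_subset[rotated]) (intro small_Un[OF M] small_image[OF I] C)
      show "sort_of M (T f j) = \<sigma> j" if "j \<in> K ?J' C - {Inl k}" for j
        using that Q eqtp_sort[of M "K ?J N" "T a" "T f" j] unfolding K' by (auto simp: Q_def \<sigma>_def K_def T_def)
      show "dfn M \<sigma> (K ?J' C) P" if mem: "P \<in> \<P>" for P
      proof -
        obtain \<pi> \<phi> where "P = (\<lambda>c. \<pi> c \<and> \<not> \<phi> c)" "\<pi> \<in> PP" "\<phi> \<in> NN" using mem by (auto simp: \<P>_def)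
        then show ?thesis using dfn_conj[OF PPC dfn_not] by (auto simp: NN_def)
      qed
      show "(\<lambda>c. P c \<and> P' c) \<in> \<P>" if mem: "P \<in> \<P>" "P' \<in> \<P>" for P P'
      proof -
        obtain \<pi> \<phi> \<pi>' \<phi>' where *: "P = (\<lambda>c. \<pi> c \<and> \<not> \<phi> c)" "\<pi> \<in> PP" "\<phi> \<in> NN" "P' = (\<lambda>c. \<pi>' c \<and> \<not> \<phi>' c)" "\<pi>' \<in> PP" "\<phi>' \<in> NN"
          using mem by (auto simp: \<P>_def)
        have "(\<lambda>c. \<pi> c \<and> \<pi>' c) \<in> PP" using *(2,5) dfn_conj by (auto simp: PP_def)
        moreover have "(\<lambda>c. \<phi> c \<or> \<phi>' c) \<in> NN" using *(3,6) dfn_disj by (auto simp: NN_def)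
        moreover have "(\<lambda>c. P c \<and> P' c) = (\<lambda>c. (\<pi> c \<and> \<pi>' c) \<and> \<not> (\<phi> c \<or> \<phi>' c))" unfolding *(1,4) by auto
        ultimately show ?thesis using mem\<P>[of "\<lambda>c. \<pi> c \<and> \<pi>' c" "\<lambda>c. \<phi> c \<or> \<phi>' c"] by (simp only:)
      qed
      show "\<P> \<noteq> {}" using mem\<P>[OF true false] by (rule ex_in_conv[THEN iffD1, OF exI])
      show "\<exists>x. sort_of M x = \<sigma> (Inl k) \<and> P ((T f)(Inl k := x))" if mem: "P \<in> \<P>" for P
      proof (rule ccontr)
        assume neg: "\<not> ?thesis"
        obtain \<pi> \<phi> where P: "P = (\<lambda>c. \<pi> c \<and> \<not> \<phi> c)" "\<pi> \<in> PP" "\<phi> \<in> NN" using mem by (auto simp: \<P>_def)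
        define E where "E c \<longleftrightarrow> (\<exists>x. sort_of M x = \<sigma> (Inl k) \<and> \<pi> (c(Inl k := x)))" for c
        define R where "R c \<longleftrightarrow> E c \<and> \<not> (\<exists>x. sort_of M x = \<sigma> (Inl k) \<and> (\<pi> (c(Inl k := x)) \<and> \<not> \<phi> (c(Inl k := x))))" for c
        have dE: "dfn M \<sigma> (K ?J N) E"
          using dfn_ex[of M \<sigma> "K ?J' N" \<pi> "Inl k"] P(2) unfolding E_def[abs_def] K' by (simp add: PP_def)
        then have EC: "dfn M \<sigma> (K ?J C) E" by (rule dfn_mono) (rule Kmono[OF order_refl NC])
        have "dfn M \<sigma> (K ?J' C) (\<lambda>c. \<pi> c \<and> \<not> \<phi> c)" using dfn_conj[OF PPC[OF P(2)] dfn_not] P(3) by (simp add: NN_def)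
        from dfn_conj[OF EC dfn_not[OF dfn_ex[OF this, of "Inl k", unfolded K']]]
        have dR: "dfn M \<sigma> (K ?J C) R" unfolding R_def[abs_def] .
        have "(T a)(Inl k := a k) = T a" by (simp add: Tupd)
        then have "E (T a)" unfolding E_def using P(2) \<sigma>k by (intro exI[of _ "a k"]) (simp add: PP_def)
        then have "E (T f)" using eqtpD[of M "K ?J N" "T a" "T f" E] dE Q by (simp add: Q_def \<sigma>_def)
        then have "R (T f)" using neg P(1) by (auto simp: R_def)
        then obtain n where n: "IN ?J n" "R (T n)" using Q dR by (auto simp: Q_def)
        have "\<exists>x\<in>N. sort_of M x = \<sigma> (Inl k) \<and> \<pi> ((T n)(Inl k := x))"
        proof (rule elem_submodel_witness[OF N])
          show "dfn M \<sigma> (K ?J' N) \<pi>" using P(2) by (simp add: PP_def)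
          show "T n j \<in> N \<and> sort_of M (T n j) = \<sigma> j" if "j \<in> K ?J' N - {Inl k}" for j
            using that n(1) unfolding K' by (auto simp: K_def T_def IN_def \<sigma>_def)
          show "\<exists>x. sort_of M x = \<sigma> (Inl k) \<and> \<pi> ((T n)(Inl k := x))" using n(2) by (auto simp: R_def E_def)
        qed
        then obtain x where x: "x \<in> N" "sort_of M x = \<sigma> (Inl k)" "\<pi> ((T n)(Inl k := x))" by blast
        then have "\<phi> (T (n(k := x)))" using n(2) unfolding R_def Tupd by blast
        moreover have "IN ?J' (n(k := x))" using n(1) x \<sigma>k by (auto simp: IN_def)
        ultimately show False using P(3) by (auto simp: NN_def)
      qed
    qed
    then obtain x where x: "sort_of M x = \<sigma> (Inl k)" "\<And>P. P \<in> \<P> \<Longrightarrow> P (T (f(k := x)))" unfolding Tupd by blast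
    let ?f = "f(k := x)"
    have pos: "\<pi> (T ?f)" if "\<pi> \<in> PP" for \<pi>
    proof -
      from x(2)[OF mem\<P>[OF that false]] show ?thesis by simp
    qed
    have neg: "\<not> \<phi> (T ?f)" if "\<phi> \<in> NN" for \<phi>
    proof -
      from x(2)[OF mem\<P>[OF true that]] show ?thesis by simp
    qed
    have "eqtp M (K ?J' N) (T a) (T ?f)" unfolding eqtp_def
    proof (intro conjI ballI allI impI)
      fix j assume "j \<in> K ?J' N"
      then show "sort_of M (T a j) = sort_of M (T ?f j)"
        using x(1) \<sigma>k Q eqtp_sort[of M "K ?J N" "T a" "T f" j] by (auto simp: Q_def K_def T_def)
    next
      fix P assume P: "dfn M (sort_of M \<circ> T a) (K ?J' N) P"
      show "P (T a) \<longleftrightarrow> P (T ?f)"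
        using pos[of P] pos[of "\<lambda>c. \<not> P c"] P dfn_not[OF P] by (auto simp: PP_def \<sigma>_def)
    qed
    moreover have "\<exists>n. IN ?J' n \<and> P (T n)" if "dfn M \<sigma> (K ?J' C) P" "P (T ?f)" for P
      using neg[of P] that by (auto simp: NN_def)
    ultimately have "Q ?J' ?f" by (simp add: Q_def)
    then show "\<exists>v. Q ?J' (f(k := v))" by blast
  qed
  then obtain c where "Q UNIV c" by blast
  then show ?thesis by (auto simp: Q_def IN_def K_def T_def \<sigma>_def)
qed

text \<open>
  If \<open>\<sigma>\<close> fixes a submodel \<open>N\<close> pointwise, then a coheir \<open>c\<close> of \<open>a\<close> over \<open>N a \<sigma>(a)\<close> does not distinguish
  \<open>a\<close> from \<open>\<sigma>(a)\<close>: hence \<open>a\<close> can be moved to \<open>\<sigma>(a)\<close> by an automorphism fixing a realization of its type.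
\<close>

lemma fixes_conjugate:
  fixes M :: "('f, 'r, 's, 'a) struct" and a :: "'i \<Rightarrow> 'a"
  assumes M: "monster M" and N: "elem_submodel M N" "small M N" and I: "small M (UNIV :: 'i set)"
    and \<sigma>: "\<sigma> \<in> Auts M N"
  shows "\<exists>\<rho>\<in>Auts M N. \<exists>\<tau>\<in>Auts M N. \<tau> \<circ> (\<rho> \<circ> a) = \<rho> \<circ> a \<and> \<tau> \<circ> a = \<sigma> \<circ> a"
proof -
  note st = monsterD(1)[OF M]
  define C where "C = N \<union> (range a \<union> range (\<sigma> \<circ> a))"
  have "N \<subseteq> C" by (auto simp: C_def)
  have "small M C" unfolding C_def by (intro small_Un[OF M] N small_image[OF I])
  from coheir[OF M N(1) \<open>N \<subseteq> C\<close> this I, of a] obtain c where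
    c: "eqtp M (Inl ` UNIV \<union> Inr ` N) (case_sum a id) (case_sum c id)"
    and fs: "\<And>P. dfn M (sort_of M \<circ> case_sum a id) (Inl ` UNIV \<union> Inr ` C) P \<Longrightarrow> P (case_sum c id) \<Longrightarrow>
      (\<exists>n. (\<forall>i. n i \<in> N \<and> sort_of M (n i) = sort_of M (a i)) \<and> P (case_sum n id))" by blast
  obtain \<rho> where \<rho>: "\<rho> \<in> Auts M N" "\<And>i. \<rho> (a i) = c i"
    using homogeneity_over_eqtp[OF M small_image[OF I] small_image[OF I] N(2) c] by auto
  have sc: "sort_of M (c i) = sort_of M (a i)" for i using \<rho> AutsD(5)[OF \<rho>(1)] by metis
  define x where "x b = case_sum (case_sum c b) id" for b :: "'i \<Rightarrow> 'a"
  define \<kappa> where "\<kappa> b = case_sum (case_sum Inl (\<lambda>i. Inr (b i))) (Inr :: 'a \<Rightarrow> 'i + 'a)" for b :: "'i \<Rightarrow> 'a"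
  let ?K = "Inl ` (UNIV :: ('i + 'i) set) \<union> Inr ` N"
  have x\<kappa>: "case_sum c id \<circ> \<kappa> b = x b" for b by (auto simp: x_def \<kappa>_def fun_eq_iff split: sum.splits)
  have imp: "P (x (\<sigma> \<circ> a))" if P: "dfn M (sort_of M \<circ> x a) ?K P" "P (x a)" for P
  proof (rule ccontr)
    assume neg: "\<not> P (x (\<sigma> \<circ> a))"
    have d: "dfn M (sort_of M \<circ> case_sum a id) (Inl ` UNIV \<union> Inr ` C) (\<lambda>d. P (d \<circ> \<kappa> b))"
      if b: "range b \<subseteq> C" "\<And>i. sort_of M (b i) = sort_of M (a i)" for b
    proof -
      have "dfn M (sort_of M \<circ> case_sum a id) (\<kappa> b ` ?K) (\<lambda>d. P (d \<circ> \<kappa> b))"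
        by (rule dfn_reindex[OF P(1)]) (use b sc in \<open>auto simp: x_def \<kappa>_def split: sum.splits\<close>)
      then show ?thesis by (rule dfn_mono) (use b(1) \<open>N \<subseteq> C\<close> in \<open>fastforce simp: \<kappa>_def image_iff split: sum.splits\<close>)
    qed
    have "dfn M (sort_of M \<circ> case_sum a id) (Inl ` UNIV \<union> Inr ` C) (\<lambda>d. P (d \<circ> \<kappa> a) \<and> \<not> P (d \<circ> \<kappa> (\<sigma> \<circ> a)))"
      by (intro dfn_conj dfn_not d) (auto simp: C_def AutsD(5)[OF \<sigma>])
    from fs[OF this] obtain n where n: "\<And>i. n i \<in> N" "\<And>i. sort_of M (n i) = sort_of M (a i)"
      "P (case_sum n id \<circ> \<kappa> a)" "\<not> P (case_sum n id \<circ> \<kappa> (\<sigma> \<circ> a))"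
      using P(2) neg by (auto simp: x\<kappa>)
    have "dfn M (sort_of M \<circ> (case_sum n id \<circ> \<kappa> a)) ?K P"
      by (rule dfn_cong[OF P(1)]) (use n(2) sc in \<open>auto simp: x_def \<kappa>_def split: sum.splits\<close>)
    then have "P (\<sigma> \<circ> (case_sum n id \<circ> \<kappa> a))" using dfn_aut[OF st Auts_mono[OF \<sigma>]] n(3) by blast
    moreover have "P (\<sigma> \<circ> (case_sum n id \<circ> \<kappa> a)) \<longleftrightarrow> P (case_sum n id \<circ> \<kappa> (\<sigma> \<circ> a))"
      by (rule dfn_agree[OF P(1)]) (use n(1) AutsD(4)[OF \<sigma>] in \<open>auto simp: \<kappa>_def split: sum.splits\<close>)
    ultimately show False using n(4) by simp
  qed
  have "eqtp M ?K (x a) (x (\<sigma> \<circ> a))" unfolding eqtp_def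
  proof (intro conjI ballI allI impI)
    fix k assume "k \<in> ?K"
    then show "sort_of M (x a k) = sort_of M (x (\<sigma> \<circ> a) k)"
      using AutsD(5)[OF \<sigma>] by (auto simp: x_def split: sum.splits)
  next
    fix P assume P: "dfn M (sort_of M \<circ> x a) ?K P"
    show "P (x a) \<longleftrightarrow> P (x (\<sigma> \<circ> a))" using imp[OF P] imp[OF dfn_not[OF P]] by blast
  qed
  then have e: "eqtp M ?K (case_sum (case_sum c a) id) (case_sum (case_sum c (\<sigma> \<circ> a)) id)" by (simp add: x_def)
  have sm: "small M (range (case_sum c b))" if "small M (range b)" for b :: "'i \<Rightarrow> 'a"
  proof -
    have "range (case_sum c b) \<subseteq> range c \<union> range b" by (auto split: sum.splits)
    then show ?thesis by (rule small_subset[rotated]) (intro small_Un[OF M] small_image[OF I] that)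
  qed
  obtain \<tau> where \<tau>: "\<tau> \<in> Auts M N" "\<And>k. \<tau> (case_sum c a k) = case_sum c (\<sigma> \<circ> a) k"
    using homogeneity_over_eqtp[OF M sm sm N(2) e] small_image[OF I] by blast
  have "\<tau> (c i) = c i" "\<tau> (a i) = \<sigma> (a i)" for i using \<tau>(2)[of "Inl i"] \<tau>(2)[of "Inr i"] by auto
  then show ?thesis using \<rho> \<tau>(1) by (intro bexI[of _ \<rho>] bexI[of _ \<tau>]) (auto simp: fun_eq_iff)
qed

section \<open>Algebraic closure\<close>

lemma acl_superset: "C \<subseteq> acl M C"
proof
  fix x assume "x \<in> C"
  have "formula M C (\<lambda>_. sort_of M x) (Eq (Var 0) (Par x))"
    using has_sort.intros(1)[of M "\<lambda>_. sort_of M x" 0] has_sort.intros(2)[of M "\<lambda>_. sort_of M x" x] \<open>x \<in> C\<close>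
    by (auto simp: formula_def)
  moreover have "{c. sort_of M c = sort_of M x \<and> sat M UNIV (\<lambda>_. c) (Eq (Var 0) (Par x))} = {x}" by auto
  then have "finite {c. sort_of M c = sort_of M x \<and> sat M UNIV (\<lambda>_. c) (Eq (Var 0) (Par x))}" by (simp only: finite.intros)
  ultimately show "x \<in> acl M C" unfolding acl_def
    by (intro CollectI exI[of _ "Eq (Var 0) (Par x)"]) auto
qed

lemma acl_mono: "C \<subseteq> D \<Longrightarrow> acl M C \<subseteq> acl M D"
  unfolding acl_def formula_def by blast

lemma tvars_map: "tvars (map_trm (\<lambda>x. x) \<sigma> t) = tvars t"
  by (induction t) auto

lemma fvars_map: "fvars (map_fm (\<lambda>x. x) (\<lambda>x. x) (\<lambda>x. x) \<sigma> \<phi>) = fvars \<phi>"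
  by (induction \<phi>) (auto simp: tvars_map)

lemma has_sort_map:
  assumes "\<And>x. sort_of M (\<sigma> x) = sort_of M x"
  shows "has_sort M \<Gamma> t s \<Longrightarrow> has_sort M \<Gamma> (map_trm (\<lambda>x. x) \<sigma> t) s"
proof (induction rule: has_sort.induct)
  case (1 n)
  show ?case unfolding trm.map by (rule has_sort.intros)
next
  case (2 x)
  show ?case unfolding trm.map assms[symmetric, of x] by (rule has_sort.intros)
next
  case (3 f ts)
  have "list_all2 (has_sort M \<Gamma>) (map (map_trm (\<lambda>x. x) \<sigma>) ts) (fst (fun_sorts M f))"
    unfolding list.rel_map using 3(2) by (rule list.rel_mono_strong) blast
  then show ?case unfolding trm.map using 3(1) by (rule has_sort.intros(3)[rotated])
qed

lemma well_sorted_map: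
  assumes s: "\<And>x. sort_of M (\<sigma> x) = sort_of M x"
  shows "well_sorted M \<Gamma> \<phi> \<Longrightarrow> well_sorted M \<Gamma> (map_fm (\<lambda>x. x) (\<lambda>x. x) (\<lambda>x. x) \<sigma> \<phi>)"
proof (induction \<phi> arbitrary: \<Gamma>)
  case (Eq t u)
  then show ?case using has_sort_map[of M \<sigma>, OF s] by auto
next
  case (Rel r ts)
  then have "list_all2 (has_sort M \<Gamma>) ts (rel_sorts M r)" by simp
  then have "list_all2 (has_sort M \<Gamma>) (map (map_trm (\<lambda>x. x) \<sigma>) ts) (rel_sorts M r)"
    unfolding list.rel_map by (rule list.rel_mono_strong) (rule has_sort_map[of M \<sigma>, OF s])
  then show ?case using Rel by simp
qed auto

lemma acl_aut_subset:
  assumes "is_structure M" "\<sigma> \<in> Auts M {}"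
  shows "\<sigma> ` acl M C \<subseteq> acl M (\<sigma> ` C)"
proof
  fix y assume "y \<in> \<sigma> ` acl M C"
  then obtain b \<phi> where y: "y = \<sigma> b" and \<phi>: "formula M C (\<lambda>_. sort_of M b) \<phi>" "fvars \<phi> \<subseteq> {0}"
    "sat M UNIV (\<lambda>_. b) \<phi>" "finite {c. sort_of M c = sort_of M b \<and> sat M UNIV (\<lambda>_. c) \<phi>}"
    unfolding acl_def by blast
  note s = AutsD(5)[OF assms(2)]
  let ?\<psi> = "map_fm (\<lambda>x. x) (\<lambda>x. x) (\<lambda>x. x) \<sigma> \<phi>"
  have sat: "sat M UNIV (\<lambda>_. \<sigma> c) ?\<psi> \<longleftrightarrow> sat M UNIV (\<lambda>_. c) \<phi>" if "sort_of M c = sort_of M b" for c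
    using sat_aut[OF assms, of "\<lambda>_. c" \<phi> UNIV] \<phi>(1) that AutsD(3)[OF assms(2)]
    by (simp add: formula_def comp_def)
  have "{c. sort_of M c = sort_of M y \<and> sat M UNIV (\<lambda>_. c) ?\<psi>}
      \<subseteq> \<sigma> ` {c. sort_of M c = sort_of M b \<and> sat M UNIV (\<lambda>_. c) \<phi>}"
  proof
    fix c assume c: "c \<in> {c. sort_of M c = sort_of M y \<and> sat M UNIV (\<lambda>_. c) ?\<psi>}"
    obtain d where d: "c = \<sigma> d" using AutsD(3)[OF assms(2)] by (metis surjD)
    then show "c \<in> \<sigma> ` {c. sort_of M c = sort_of M b \<and> sat M UNIV (\<lambda>_. c) \<phi>}"
      using c sat[of d] s y by auto
  qed
  then have "finite {c. sort_of M c = sort_of M y \<and> sat M UNIV (\<lambda>_. c) ?\<psi>}"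
    using \<phi>(4) finite_surj by blast
  moreover have "formula M (\<sigma> ` C) (\<lambda>_. sort_of M y) ?\<psi>"
    using \<phi>(1) well_sorted_map[of M \<sigma>, OF s] by (auto simp: formula_def y s fm.set_map)
  ultimately show "y \<in> acl M (\<sigma> ` C)"
    unfolding acl_def using \<phi> sat[of b] y by (intro CollectI exI[of _ ?\<psi>]) (auto simp: fvars_map)
qed

lemma finv_simps:
  assumes "\<sigma> \<in> Auts M B"
  shows "\<sigma> (finv \<sigma> x) = x" "finv \<sigma> (\<sigma> x) = x" "\<sigma> \<circ> finv \<sigma> = id" "finv \<sigma> \<circ> \<sigma> = id"
    "\<sigma> ` finv \<sigma> ` A = A" "finv \<sigma> ` \<sigma> ` A = A"
proof -
  have 1: "\<sigma> (finv \<sigma> x) = x" for x by (rule surj_f_inv_f[OF AutsD(3)[OF assms]])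
  have 2: "finv \<sigma> (\<sigma> x) = x" for x by (rule inv_f_f[OF AutsD(2)[OF assms]])
  show "\<sigma> (finv \<sigma> x) = x" "finv \<sigma> (\<sigma> x) = x" by (rule 1 2)+
  show "\<sigma> \<circ> finv \<sigma> = id" "finv \<sigma> \<circ> \<sigma> = id" by (rule ext, simp only: comp_apply id_apply 1 2)+
  show "\<sigma> ` finv \<sigma> ` A = A" "finv \<sigma> ` \<sigma> ` A = A" by (simp_all only: image_image 1 2 image_ident)
qed

lemma acl_aut:
  assumes "is_structure M" "\<sigma> \<in> Auts M {}"
  shows "\<sigma> ` acl M C = acl M (\<sigma> ` C)"
proof
  have "finv \<sigma> ` acl M (\<sigma> ` C) \<subseteq> acl M (finv \<sigma> ` \<sigma> ` C)"
    by (rule acl_aut_subset[OF assms(1) inv_Auts[OF assms]])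
  then have "\<sigma> ` finv \<sigma> ` acl M (\<sigma> ` C) \<subseteq> \<sigma> ` acl M C"
    unfolding finv_simps(6)[OF assms(2)] by (rule image_mono)
  then show "acl M (\<sigma> ` C) \<subseteq> \<sigma> ` acl M C" unfolding finv_simps(5)[OF assms(2)] .
qed (rule acl_aut_subset[OF assms])

text \<open>The parameters of a formula in the variable \<open>0\<close> are replaced by the variables \<open>2, 4, \<dots>\<close>.\<close>

lemma abstract_pars:
  fixes \<phi> :: "('f, 'r, 's, 'a) fm"
  assumes "formula M C (\<lambda>_. s) \<phi>" "fvars \<phi> \<subseteq> {0}"
  obtains \<Gamma> \<psi> cs where "formula M {} \<Gamma> \<psi>" "\<Gamma> 0 = s" "set cs \<subseteq> C"
    "\<And>x. sat M UNIV (\<lambda>_. x) \<phi> \<longleftrightarrow> sat M UNIV (\<lambda>n. if n = 0 then x else cs ! (n div 2 - 1)) \<psi>"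
proof -
  obtain cs where cs: "set cs = pars \<phi>" using finite_list[OF finite_pars[of \<phi>]] by auto
  define g where "g c = (SOME k. k < length cs \<and> cs ! k = c)" for c
  have g: "cs ! g c = c" if "c \<in> pars \<phi>" for c
    using someI_ex[of "\<lambda>k. k < length cs \<and> cs ! k = c"] that unfolding cs[symmetric] in_set_conv_nth g_def by blast
  define \<beta> where "\<beta> n = 2 * n + 1" for n :: nat
  define \<theta> :: "nat \<Rightarrow> ('f, 'a) trm" where "\<theta> n = Var 0" for n
  define \<pi> :: "'a \<Rightarrow> ('f, 'a) trm" where "\<pi> c = Var (2 * g c + 2)" for c
  define \<psi> where "\<psi> = sub \<beta> \<theta> \<pi> \<phi>"
  define \<Gamma> where "\<Gamma> n = (if n = 0 then s else sort_of M (cs ! (n div 2 - 1)))" for n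
  have cf: "capture_free \<beta> \<theta> \<pi>"
    by (auto simp: capture_free_def inj_def \<beta>_def \<theta>_def \<pi>_def) presburger
  have ev: "eval M (\<lambda>n. if n = 0 then x else cs ! (n div 2 - 1)) (\<pi> c) = c" if "c \<in> pars \<phi>" for x c
    using g[OF that] by (simp add: \<pi>_def)
  have "sat M UNIV (\<lambda>n. if n = 0 then x else cs ! (n div 2 - 1)) \<psi> \<longleftrightarrow> sat M UNIV (\<lambda>_. x) \<phi>" for x
    unfolding \<psi>_def by (subst sat_sub[OF cf ev]) (auto simp: \<theta>_def)
  moreover have "has_sort M \<Gamma> (\<pi> c) (sort_of M c)" if "c \<in> pars \<phi>" for c
    using has_sort.intros(1)[of M \<Gamma> "2 * g c + 2"] g[OF that] by (simp add: \<Gamma>_def \<pi>_def)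
  then have "well_sorted M \<Gamma> \<psi>" unfolding \<psi>_def
    using assms(1) has_sort.intros(1)[of M \<Gamma> 0] cf
    by (intro well_sorted_sub[of M "\<lambda>_. s"]) (auto simp: formula_def \<Gamma>_def \<theta>_def)
  moreover have "pars \<psi> = {}"
    using pars_sub[of \<beta> \<theta> \<pi> \<phi>] by (auto simp: \<psi>_def \<theta>_def \<pi>_def)
  moreover have "\<Gamma> 0 = s" by (simp add: \<Gamma>_def)
  moreover have "set cs \<subseteq> C" using assms(1) cs by (simp add: formula_def)
  ultimately show thesis using that[of \<Gamma> \<psi> cs] by (simp add: formula_def)
qed

text \<open>
  There are no more algebraic elements over \<open>C\<close> than finite lists of formulas and elements of \<open>C\<close>.
\<close>

lemma small_acl:
  fixes M :: "('f, 'r, 's, 'a) struct"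
  assumes M: "monster M" and C: "small M C"
  shows "small M (acl M C)"
proof -
  define Form where "Form = {\<chi> :: ('f, 'r, 's, 'a) fm. \<exists>\<Gamma>. formula M {} \<Gamma> \<chi>}"
  \<comment> \<open>A pair of \<open>\<exists>x\<^sub>0 \<psi>\<close> and a list of parameters codes the set that \<open>\<psi>\<close> defines, if this is finite.\<close>
  define sols where "sols s \<psi> cs = {x. sort_of M x = s \<and> sat M UNIV (\<lambda>n. if n = 0 then x else cs ! (n div 2 - 1)) \<psi>}"
    for s and \<psi> :: "('f, 'r, 's, 'a) fm" and cs
  define Fin where "Fin \<equiv> \<lambda>(\<chi> :: ('f, 'r, 's, 'a) fm, cs). case \<chi> of Ex m s \<psi> \<Rightarrow>
      (if finite (sols s \<psi> cs) then sols s \<psi> cs else {}) | _ \<Rightarrow> {}"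
  have Fin: "finite (Fin i)" for i by (auto simp: Fin_def split: prod.splits fm.splits)
  have "acl M C \<subseteq> (\<Union>i\<in>Form \<times> lists C. Fin i)"
  proof
    fix b assume "b \<in> acl M C"
    then obtain \<phi> where \<phi>: "formula M C (\<lambda>_. sort_of M b) \<phi>" "fvars \<phi> \<subseteq> {0}"
      "sat M UNIV (\<lambda>_. b) \<phi>" "finite {c. sort_of M c = sort_of M b \<and> sat M UNIV (\<lambda>_. c) \<phi>}"
      unfolding acl_def by blast
    obtain \<Gamma> \<psi> cs where *: "formula M {} \<Gamma> \<psi>" "\<Gamma> 0 = sort_of M b" "set cs \<subseteq> C"
      "\<And>x. sat M UNIV (\<lambda>_. x) \<phi> \<longleftrightarrow> sat M UNIV (\<lambda>n. if n = 0 then x else cs ! (n div 2 - 1)) \<psi>"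
      by (rule abstract_pars[OF \<phi>(1,2)]) (rule that)
    have "\<Gamma>(0 := sort_of M b) = \<Gamma>" using *(2) by auto
    then have "Ex 0 (sort_of M b) \<psi> \<in> Form"
      unfolding Form_def formula_def using *(1) by (intro CollectI exI[of _ \<Gamma>]) (simp add: formula_def)
    moreover have "sols (sort_of M b) \<psi> cs = {c. sort_of M c = sort_of M b \<and> sat M UNIV (\<lambda>_. c) \<phi>}"
      by (simp add: sols_def *(4))
    then have "b \<in> Fin (Ex 0 (sort_of M b) \<psi>, cs)" using \<phi>(3,4) by (simp add: Fin_def)
    ultimately show "b \<in> (\<Union>i\<in>Form \<times> lists C. Fin i)" using *(3) by blast
  qed
  then have 1: "|acl M C| \<le>o |\<Union>i\<in>Form \<times> lists C. Fin i|" by (rule card_of_mono1)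
  let ?D = "Form <+> C"
  have inf: "infinite Form" unfolding Form_def by (rule infinite_formulas)
  then have infD: "infinite ?D" by simp
  have "inj_on (\<lambda>(\<chi>, cs). Inl \<chi> # map Inr cs) (Form \<times> lists C)"
    by (auto simp: inj_on_def inj_map_eq_map)
  moreover have "(\<lambda>(\<chi>, cs). Inl \<chi> # map Inr cs) ` (Form \<times> lists C) \<subseteq> lists ?D"
    by (auto simp: in_lists_conv_set)
  ultimately have "|Form \<times> lists C| \<le>o |lists ?D|" unfolding card_of_ordLeq[symmetric] by blast
  then have I: "|Form \<times> lists C| \<le>o |?D|"
    using card_of_lists_infinite[OF infD] ordLeq_ordIso_trans by blast
  have "|\<Union>i\<in>Form \<times> lists C. Fin i| \<le>o |?D|"
    by (rule card_of_UNION_ordLeq_infinite[OF infD I])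
      (use ordLess_imp_ordLeq[OF finite_ordLess_infinite2[OF Fin infD]] in blast)
  with 1 have "|acl M C| \<le>o |?D|" by (rule ordLeq_transitive)
  moreover have "|?D| <o |UNIV :: 'a set|"
    by (rule card_of_Plus_ordLess_infinite[OF monster_infinite[OF M]])
      (use M C in \<open>auto simp: monster_def small_def Form_def\<close>)
  ultimately show ?thesis unfolding small_def by (rule ordLeq_ordLess_trans)
qed

section \<open>Lascar equivalence and the groups\<close>

lemma finv_comp_simps:
  assumes "\<sigma> \<in> Auts M B"
  shows "\<sigma> \<circ> (finv \<sigma> \<circ> g) = g" "finv \<sigma> \<circ> (\<sigma> \<circ> g) = g"
  by (simp_all only: comp_assoc[symmetric] finv_simps(3,4)[OF assms] id_comp)

lemma Bij_UNIV: "Bij UNIV = {f. bij f}"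
  by (auto simp: Bij_def extensional_def)

lemma carrier_Aut_group [simp]: "carrier (Aut_group M B) = Auts M B"
  by (simp add: Aut_group_def)

lemma mult_Aut_group:
  assumes "\<sigma> \<in> Auts M B" "\<tau> \<in> Auts M B" shows "\<sigma> \<otimes>\<^bsub>Aut_group M B\<^esub> \<tau> = \<sigma> \<circ> \<tau>"
  using AutsD(1)[OF assms(1)] AutsD(1)[OF assms(2)]
  by (simp add: Aut_group_def BijGroup_def Bij_UNIV compose_def fun_eq_iff)

lemma one_Aut_group: "\<one>\<^bsub>Aut_group M B\<^esub> = id"
  by (auto simp: Aut_group_def BijGroup_def)

lemma group_Aut_group:
  assumes "is_structure M" shows "group (Aut_group M B)"
proof (rule groupI)
  show "x \<otimes>\<^bsub>Aut_group M B\<^esub> y \<in> carrier (Aut_group M B)"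
    if "x \<in> carrier (Aut_group M B)" "y \<in> carrier (Aut_group M B)" for x y
    using that by (simp add: mult_Aut_group comp_Auts)
  show "\<one>\<^bsub>Aut_group M B\<^esub> \<in> carrier (Aut_group M B)" by (simp add: one_Aut_group id_Auts)
  show "x \<otimes>\<^bsub>Aut_group M B\<^esub> y \<otimes>\<^bsub>Aut_group M B\<^esub> z = x \<otimes>\<^bsub>Aut_group M B\<^esub> (y \<otimes>\<^bsub>Aut_group M B\<^esub> z)"
    if "x \<in> carrier (Aut_group M B)" "y \<in> carrier (Aut_group M B)" "z \<in> carrier (Aut_group M B)" for x y z
    using that by (simp add: mult_Aut_group comp_Auts comp_assoc)
  show "\<one>\<^bsub>Aut_group M B\<^esub> \<otimes>\<^bsub>Aut_group M B\<^esub> x = x" if "x \<in> carrier (Aut_group M B)" for x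
    using that by (simp add: one_Aut_group mult_Aut_group id_Auts)
  show "\<exists>y\<in>carrier (Aut_group M B). y \<otimes>\<^bsub>Aut_group M B\<^esub> x = \<one>\<^bsub>Aut_group M B\<^esub>"
    if "x \<in> carrier (Aut_group M B)" for x
    using that inv_Auts[OF assms, of x B] finv_simps(4)[of x M B]
    by (intro bexI[of _ "finv x"]) (simp_all add: one_Aut_group mult_Aut_group)
qed

lemma inv_Aut_group:
  assumes "is_structure M" "\<sigma> \<in> Auts M B" shows "inv\<^bsub>Aut_group M B\<^esub> \<sigma> = finv \<sigma>"
  using assms inv_Auts[OF assms] finv_simps(4)[OF assms(2)]
  by (intro group.inv_equality[OF group_Aut_group]) (simp_all add: mult_Aut_group one_Aut_group)

lemma elem_submodel_aut:
  assumes st: "is_structure M" and \<sigma>: "\<sigma> \<in> Auts M {}" and N: "elem_submodel M N"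
  shows "elem_submodel M (\<sigma> ` N)"
  unfolding elem_submodel_def
proof (intro conjI ballI allI impI)
  show "\<sigma> ` N \<noteq> {}" using N by (simp add: elem_submodel_def)
next
  fix f xs assume f: "f \<in> funs M" and xs: "set xs \<subseteq> \<sigma> ` N \<and> map (sort_of M) xs = fst (fun_sorts M f)"
  let ?ys = "map (finv \<sigma>) xs"
  have "set ?ys \<subseteq> N" using xs finv_simps(2)[OF \<sigma>] by auto
  moreover have s: "map (sort_of M) ?ys = fst (fun_sorts M f)"
    using xs AutsD(5)[OF inv_Auts[OF st \<sigma>]] by (simp add: comp_def)
  ultimately have "fun_int M f ?ys \<in> N" using N f unfolding elem_submodel_def by blast
  moreover have "\<sigma> (fun_int M f ?ys) = fun_int M f xs"
    using Auts_fun[OF \<sigma> f s] finv_simps(3)[OF \<sigma>] by simp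
  ultimately show "fun_int M f xs \<in> \<sigma> ` N" by (metis imageI)
next
  fix \<phi> and e :: "nat \<Rightarrow> 'd" assume e: "range e \<subseteq> \<sigma> ` N \<and> formula M {} (sort_of M \<circ> e) \<phi>"
  define d where "d = finv \<sigma> \<circ> e"
  have ed: "e = \<sigma> \<circ> d" unfolding d_def finv_comp_simps[OF \<sigma>] ..
  have "sort_of M \<circ> d = sort_of M \<circ> e" by (simp add: ed fun_eq_iff AutsD(5)[OF \<sigma>])
  then have f: "formula M {} (sort_of M \<circ> d) \<phi>" using e by (simp only:)
  have "range d \<subseteq> N" using e finv_simps(2)[OF \<sigma>] by (auto simp: d_def)
  then have "sat M N d \<phi> \<longleftrightarrow> sat M UNIV d \<phi>" using N f unfolding elem_submodel_def by blast
  moreover have "map_fm (\<lambda>x. x) (\<lambda>x. x) (\<lambda>x. x) \<sigma> \<phi> = \<phi>"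
    by (rule map_fm_id) (use f in \<open>auto simp: formula_def\<close>)
  then have "sat M (\<sigma> ` N) (\<sigma> \<circ> d) \<phi> \<longleftrightarrow> sat M N d \<phi>"
    using sat_aut[OF st \<sigma>, of d \<phi> N] f by (simp only: formula_def)
  moreover have "sat M UNIV (\<sigma> \<circ> d) \<phi> \<longleftrightarrow> sat M UNIV d \<phi>" by (rule sat_aut_over[OF st \<sigma> f])
  ultimately show "sat M (\<sigma> ` N) e \<phi> \<longleftrightarrow> sat M UNIV e \<phi>" unfolding ed by blast
qed

text \<open>
  The generators are closed under conjugation, since images of small submodels are small submodels.
\<close>

lemma normal_Autf:
  assumes st: "is_structure M" shows "Autf M B \<lhd> Aut_group M B"
  unfolding Autf_def
proof (rule group.normal_generateI[OF group_Aut_group[OF st]])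
  let ?S = "{\<sigma> \<in> Auts M B. \<exists>N. elem_submodel M N \<and> B \<subseteq> N \<and> small M N \<and> (\<forall>x\<in>N. \<sigma> x = x)}"
  show "?S \<subseteq> carrier (Aut_group M B)" by auto
  fix h g assume "h \<in> ?S" and "g \<in> carrier (Aut_group M B)"
  then obtain N where h: "h \<in> Auts M B" and N: "elem_submodel M N" "B \<subseteq> N" "small M N" "\<forall>x\<in>N. h x = x"
    and g: "g \<in> Auts M B" by auto
  have eq: "g \<otimes>\<^bsub>Aut_group M B\<^esub> h \<otimes>\<^bsub>Aut_group M B\<^esub> inv\<^bsub>Aut_group M B\<^esub> g = g \<circ> h \<circ> finv g"
    using h g inv_Auts[OF st g] by (simp add: inv_Aut_group[OF st] mult_Aut_group comp_Auts)
  have "elem_submodel M (g ` N)" by (rule elem_submodel_aut[OF st Auts_mono[OF g] N(1)]) simp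
  moreover have "B \<subseteq> g ` N" using N(2) Auts_image[OF g] by (metis image_mono)
  moreover have "small M (g ` N)" using N(3) by (rule small_image)
  moreover have "\<forall>x\<in>g ` N. (g \<circ> h \<circ> finv g) x = x" using N(4) finv_simps(2)[OF g] by auto
  moreover have "g \<circ> h \<circ> finv g \<in> Auts M B" using g h inv_Auts[OF st g] by (intro comp_Auts)
  ultimately show "g \<otimes>\<^bsub>Aut_group M B\<^esub> h \<otimes>\<^bsub>Aut_group M B\<^esub> inv\<^bsub>Aut_group M B\<^esub> g \<in> ?S" unfolding eq by blast
qed

lemma Autf_props:
  assumes st: "is_structure M"
  shows "Autf M B \<subseteq> Auts M B" "id \<in> Autf M B"
    "\<sigma> \<in> Autf M B \<Longrightarrow> \<tau> \<in> Autf M B \<Longrightarrow> \<sigma> \<circ> \<tau> \<in> Autf M B"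
    "\<sigma> \<in> Autf M B \<Longrightarrow> finv \<sigma> \<in> Autf M B"
    "\<sigma> \<in> Autf M B \<Longrightarrow> \<tau> \<in> Auts M B \<Longrightarrow> \<tau> \<circ> \<sigma> \<circ> finv \<tau> \<in> Autf M B"
proof -
  have n: "Autf M B \<lhd> Aut_group M B" by (rule normal_Autf[OF st])
  then have sub: "subgroup (Autf M B) (Aut_group M B)" by (rule normal_imp_subgroup)
  show A: "Autf M B \<subseteq> Auts M B" using subgroup.subset[OF sub] by simp
  show "id \<in> Autf M B" using subgroup.one_closed[OF sub] by (simp add: one_Aut_group)
  show "\<sigma> \<circ> \<tau> \<in> Autf M B" if "\<sigma> \<in> Autf M B" "\<tau> \<in> Autf M B"
    using subgroup.m_closed[OF sub that] A that by (subst mult_Aut_group[symmetric]) auto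
  show "finv \<sigma> \<in> Autf M B" if "\<sigma> \<in> Autf M B"
    using subgroup.m_inv_closed[OF sub that] A that by (subst inv_Aut_group[symmetric, OF st]) auto
  show "\<tau> \<circ> \<sigma> \<circ> finv \<tau> \<in> Autf M B" if s: "\<sigma> \<in> Autf M B" and t: "\<tau> \<in> Auts M B"
  proof -
    have "\<tau> \<otimes>\<^bsub>Aut_group M B\<^esub> \<sigma> \<otimes>\<^bsub>Aut_group M B\<^esub> inv\<^bsub>Aut_group M B\<^esub> \<tau> \<in> Autf M B"
      by (rule normal.inv_op_closed2[OF n]) (use s t in auto)
    moreover have "\<sigma> \<in> Auts M B" using s A by blast
    ultimately show ?thesis using t inv_Auts[OF st t] by (simp add: inv_Aut_group[OF st] mult_Aut_group comp_Auts)
  qed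
qed

lemma lascar_equiv_refl: "is_structure M \<Longrightarrow> lascar_equiv M B a a"
  unfolding lascar_equiv_def using Autf_props(2)[of M B] by (intro bexI[of _ id]) auto

lemma lascar_equiv_sym:
  assumes st: "is_structure M" and "lascar_equiv M B a b" shows "lascar_equiv M B b a"
proof -
  obtain \<sigma> where \<sigma>: "\<sigma> \<in> Autf M B" "b = \<sigma> \<circ> a" using assms(2) by (auto simp: lascar_equiv_def)
  then have "a = finv \<sigma> \<circ> b" using finv_comp_simps(2)[of \<sigma> M B a] Autf_props(1)[OF st, of B] by auto
  then show ?thesis using Autf_props(4)[OF st \<sigma>(1)] unfolding lascar_equiv_def by blast
qed

lemma lascar_equiv_trans:
  assumes st: "is_structure M" and "lascar_equiv M B a b" "lascar_equiv M B b c" shows "lascar_equiv M B a c"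
proof -
  obtain \<sigma> \<tau> where "\<sigma> \<in> Autf M B" "b = \<sigma> \<circ> a" "\<tau> \<in> Autf M B" "c = \<tau> \<circ> b"
    using assms(2,3) by (auto simp: lascar_equiv_def)
  then have "c = (\<tau> \<circ> \<sigma>) \<circ> a" "\<tau> \<circ> \<sigma> \<in> Autf M B" using Autf_props(3)[OF st] by (auto simp: comp_assoc)
  then show ?thesis unfolding lascar_equiv_def by blast
qed

lemma lascar_equiv_aut:
  assumes st: "is_structure M" and "lascar_equiv M B a b" and \<tau>: "\<tau> \<in> Auts M B"
  shows "lascar_equiv M B (\<tau> \<circ> a) (\<tau> \<circ> b)"
proof -
  obtain \<sigma> where \<sigma>: "\<sigma> \<in> Autf M B" "b = \<sigma> \<circ> a" using assms(2) by (auto simp: lascar_equiv_def)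
  have "\<tau> \<circ> b = (\<tau> \<circ> \<sigma> \<circ> finv \<tau>) \<circ> (\<tau> \<circ> a)"
    unfolding \<sigma>(2) comp_assoc finv_comp_simps[OF \<tau>] ..
  moreover have "\<tau> \<circ> \<sigma> \<circ> finv \<tau> \<in> Autf M B" by (rule Autf_props(5)[OF st \<sigma>(1) \<tau>])
  ultimately show ?thesis unfolding lascar_equiv_def by blast
qed

text \<open>The automorphisms which preserve the Lascar strong types of all tuples in \<open>\<A>\<close>.\<close>

definition lascar_fix :: "('f, 'r, 's, 'a) struct \<Rightarrow> 'a set \<Rightarrow> ('j \<Rightarrow> 'a) set \<Rightarrow> ('a \<Rightarrow> 'a) set" where
  "lascar_fix M B \<A> = {\<sigma> \<in> Auts M B. \<forall>a\<in>\<A>. lascar_equiv M B a (\<sigma> \<circ> a)}"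

lemma normal_lascar_fix:
  assumes st: "is_structure M" and inv: "\<And>\<sigma> a. \<sigma> \<in> Auts M B \<Longrightarrow> a \<in> \<A> \<Longrightarrow> \<sigma> \<circ> a \<in> \<A>"
  shows "lascar_fix M B \<A> \<lhd> Aut_group M B"
proof (rule group.normal_invI[OF group_Aut_group[OF st]])
  let ?L = "lascar_fix M B \<A>"
  have fin: "finv \<sigma> \<in> ?L" if \<sigma>: "\<sigma> \<in> ?L" for \<sigma>
  proof -
    have A: "\<sigma> \<in> Auts M B" using \<sigma> by (simp add: lascar_fix_def)
    have "lascar_equiv M B a (finv \<sigma> \<circ> a)" if "a \<in> \<A>" for a
      using \<sigma> inv[OF inv_Auts[OF st A] that] finv_comp_simps(1)[OF A, of a] lascar_equiv_sym[OF st]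
      unfolding lascar_fix_def by fastforce
    then show ?thesis using inv_Auts[OF st A] by (simp add: lascar_fix_def)
  qed
  show "subgroup ?L (Aut_group M B)"
  proof (rule group.subgroupI[OF group_Aut_group[OF st]])
    show "?L \<subseteq> carrier (Aut_group M B)" by (auto simp: lascar_fix_def)
    have "id \<in> ?L" using id_Auts lascar_equiv_refl[OF st] by (auto simp: lascar_fix_def)
    then show "?L \<noteq> {}" by blast
    show "inv\<^bsub>Aut_group M B\<^esub> \<sigma> \<in> ?L" if "\<sigma> \<in> ?L" for \<sigma>
    proof -
      have "\<sigma> \<in> Auts M B" using that by (simp add: lascar_fix_def)
      then show ?thesis using fin[OF that] by (simp add: inv_Aut_group[OF st])
    qed
    show "\<sigma> \<otimes>\<^bsub>Aut_group M B\<^esub> \<tau> \<in> ?L" if "\<sigma> \<in> ?L" "\<tau> \<in> ?L" for \<sigma> \<tau>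
    proof -
      have A: "\<sigma> \<in> Auts M B" "\<tau> \<in> Auts M B" using that by (simp_all add: lascar_fix_def)
      have "lascar_equiv M B a (\<sigma> \<circ> \<tau> \<circ> a)" if "a \<in> \<A>" for a
        using \<open>\<sigma> \<in> ?L\<close> \<open>\<tau> \<in> ?L\<close> inv[OF A(2) that] that lascar_equiv_trans[OF st, of B a "\<tau> \<circ> a"]
        unfolding lascar_fix_def comp_assoc by blast
      then show ?thesis using comp_Auts[OF A] by (simp add: lascar_fix_def mult_Aut_group[OF A])
    qed
  qed
  fix \<tau> \<sigma> assume \<tau>: "\<tau> \<in> carrier (Aut_group M B)" and \<sigma>: "\<sigma> \<in> ?L"
  have A: "\<sigma> \<in> Auts M B" "\<tau> \<in> Auts M B" "finv \<tau> \<in> Auts M B"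
    using \<sigma> \<tau> inv_Auts[OF st, of \<tau> B] by (simp_all add: lascar_fix_def)
  have "lascar_equiv M B a ((\<tau> \<circ> \<sigma> \<circ> finv \<tau>) \<circ> a)" if "a \<in> \<A>" for a
  proof -
    have "lascar_equiv M B (finv \<tau> \<circ> a) (\<sigma> \<circ> (finv \<tau> \<circ> a))"
      using \<sigma> inv[OF A(3) that] by (simp add: lascar_fix_def)
    from lascar_equiv_aut[OF st this A(2)] show ?thesis
      unfolding finv_comp_simps(1)[OF A(2)] by (simp only: comp_assoc)
  qed
  then show "\<tau> \<otimes>\<^bsub>Aut_group M B\<^esub> \<sigma> \<otimes>\<^bsub>Aut_group M B\<^esub> inv\<^bsub>Aut_group M B\<^esub> \<tau> \<in> ?L"
    using A by (simp add: inv_Aut_group[OF st] mult_Aut_group comp_Auts lascar_fix_def)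
qed

section \<open>Quotient groups\<close>

text \<open>The quotient is abelian if and only if all commutators lie in the normal subgroup.\<close>

lemma comm_Mod_iff:
  assumes "group G" "H \<lhd> G"
  shows "comm_group (G Mod H) \<longleftrightarrow> (\<forall>x\<in>carrier G. \<forall>y\<in>carrier G. \<exists>h\<in>H. x \<otimes>\<^bsub>G\<^esub> y = h \<otimes>\<^bsub>G\<^esub> (y \<otimes>\<^bsub>G\<^esub> x))"
proof -
  interpret group G by (rule assms(1))
  interpret H: normal H G by (rule assms(2))
  have grp: "group (G Mod H)" by (rule H.factorgroup_is_group)
  have eq: "H #>\<^bsub>G\<^esub> u = H #>\<^bsub>G\<^esub> v \<longleftrightarrow> (\<exists>h\<in>H. u = h \<otimes>\<^bsub>G\<^esub> v)" if "u \<in> carrier G" "v \<in> carrier G" for u v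
  proof
    assume "H #>\<^bsub>G\<^esub> u = H #>\<^bsub>G\<^esub> v"
    then have "u \<in> H #>\<^bsub>G\<^esub> v" using rcos_self[OF that(1) H.subgroup_axioms] by simp
    then show "\<exists>h\<in>H. u = h \<otimes>\<^bsub>G\<^esub> v" by (auto simp: r_coset_def)
  next
    assume "\<exists>h\<in>H. u = h \<otimes>\<^bsub>G\<^esub> v"
    then have "u \<in> H #>\<^bsub>G\<^esub> v" by (auto simp: r_coset_def)
    then show "H #>\<^bsub>G\<^esub> u = H #>\<^bsub>G\<^esub> v" using repr_independence[OF _ that(2) H.subgroup_axioms] by simp
  qed
  have mult: "(H #>\<^bsub>G\<^esub> x) \<otimes>\<^bsub>G Mod H\<^esub> (H #>\<^bsub>G\<^esub> y) = H #>\<^bsub>G\<^esub> (x \<otimes>\<^bsub>G\<^esub> y)" if "x \<in> carrier G" "y \<in> carrier G" for x y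
    using H.rcos_sum[OF that] by (simp add: FactGroup_def)
  have carr: "carrier (G Mod H) = (\<lambda>x. H #>\<^bsub>G\<^esub> x) ` carrier G" by (auto simp: FactGroup_def RCOSETS_def)
  show ?thesis
  proof
    assume "comm_group (G Mod H)"
    then have "(H #>\<^bsub>G\<^esub> x) \<otimes>\<^bsub>G Mod H\<^esub> (H #>\<^bsub>G\<^esub> y) = (H #>\<^bsub>G\<^esub> y) \<otimes>\<^bsub>G Mod H\<^esub> (H #>\<^bsub>G\<^esub> x)"
      if "x \<in> carrier G" "y \<in> carrier G" for x y
      using that by (intro comm_monoid.m_comm) (auto simp: carr comm_group_def)
    then have "H #>\<^bsub>G\<^esub> (x \<otimes>\<^bsub>G\<^esub> y) = H #>\<^bsub>G\<^esub> (y \<otimes>\<^bsub>G\<^esub> x)" if "x \<in> carrier G" "y \<in> carrier G" for x y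
      using that by (metis mult)
    then show "\<forall>x\<in>carrier G. \<forall>y\<in>carrier G. \<exists>h\<in>H. x \<otimes>\<^bsub>G\<^esub> y = h \<otimes>\<^bsub>G\<^esub> (y \<otimes>\<^bsub>G\<^esub> x)"
      by (intro ballI) (simp add: eq[symmetric])
  next
    assume *: "\<forall>x\<in>carrier G. \<forall>y\<in>carrier G. \<exists>h\<in>H. x \<otimes>\<^bsub>G\<^esub> y = h \<otimes>\<^bsub>G\<^esub> (y \<otimes>\<^bsub>G\<^esub> x)"
    show "comm_group (G Mod H)"
    proof (rule group.group_comm_groupI[OF grp])
      fix X Y assume "X \<in> carrier (G Mod H)" "Y \<in> carrier (G Mod H)"
      then obtain x y where xy: "x \<in> carrier G" "y \<in> carrier G" "X = H #>\<^bsub>G\<^esub> x" "Y = H #>\<^bsub>G\<^esub> y" by (auto simp: carr)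
      have "H #>\<^bsub>G\<^esub> (x \<otimes>\<^bsub>G\<^esub> y) = H #>\<^bsub>G\<^esub> (y \<otimes>\<^bsub>G\<^esub> x)"
        using * xy(1,2) by (subst eq) auto
      then show "X \<otimes>\<^bsub>G Mod H\<^esub> Y = Y \<otimes>\<^bsub>G Mod H\<^esub> X" unfolding xy(3,4) mult[OF xy(1,2)] mult[OF xy(2,1)] .
    qed
  qed
qed

lemma trivial_Mod:
  assumes "group G" "H \<lhd> G" "carrier G \<subseteq> H"
  shows "trivial_group (G Mod H)"
proof -
  interpret group G by (rule assms(1))
  interpret H: normal H G by (rule assms(2))
  have "H #>\<^bsub>G\<^esub> x = H" if "x \<in> carrier G" for x
    using H.rcos_const[OF _ ] assms(3) that by (metis subsetD coset_join2 H.subgroup_axioms)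
  then have "carrier (G Mod H) = {\<one>\<^bsub>G Mod H\<^esub>}" by (auto simp: FactGroup_def RCOSETS_def)
  then show ?thesis using H.factorgroup_is_group by (simp add: trivial_group_def)
qed

lemma trivial_imp_comm_group:
  assumes "trivial_group G" shows "comm_group G"
proof -
  interpret group G using assms by (simp add: trivial_group_def)
  show ?thesis by (rule group_comm_groupI) (use assms in \<open>auto simp: trivial_group_def\<close>)
qed

section \<open>The action on the realizations of a type\<close>

lemma realizations_aut:
  "is_structure M \<Longrightarrow> \<sigma> \<in> Auts M B \<Longrightarrow> b \<in> realizations M B p \<Longrightarrow> \<sigma> \<circ> b \<in> realizations M B p"
  by (simp add: realizations_def tp_aut)

lemma realizations_conj:
  assumes "monster M" "small M B" "small M (UNIV :: 'i set)"
    and "b \<in> realizations M B p" "c \<in> realizations M B (p :: ('f, 'r, 's, 'a, 'i) tuple_type)"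
  shows "\<exists>\<sigma>\<in>Auts M B. c = \<sigma> \<circ> b"
  by (rule homogeneity_tp[OF assms(1,2)]) (use assms in \<open>auto simp: realizations_def small_image\<close>)

lemma restr_Bij:
  assumes st: "is_structure M" and \<sigma>: "\<sigma> \<in> Auts M B"
  shows "restr M B p \<sigma> \<in> Bij (realizations M B p)"
proof -
  let ?R = "realizations M B p"
  have "bij_betw (restr M B p \<sigma>) ?R ?R"
  proof (rule bij_betw_byWitness[where f' = "\<lambda>a. finv \<sigma> \<circ> a"])
    show "\<forall>a\<in>?R. finv \<sigma> \<circ> restr M B p \<sigma> a = a"
      by (simp add: restr_def finv_comp_simps[OF \<sigma>])
    have fR: "finv \<sigma> \<circ> a \<in> ?R" if "a \<in> ?R" for a using realizations_aut[OF st inv_Auts[OF st \<sigma>] that] .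
    have R: "\<sigma> \<circ> a \<in> ?R" if "a \<in> ?R" for a using realizations_aut[OF st \<sigma> that] .
    show "\<forall>a\<in>?R. restr M B p \<sigma> (finv \<sigma> \<circ> a) = a"
      unfolding restr_def by (intro ballI) (simp only: restrict_apply' fR finv_comp_simps[OF \<sigma>])
    show "restr M B p \<sigma> ` ?R \<subseteq> ?R" using R unfolding restr_def by (intro image_subsetI) (simp only: restrict_apply')
    show "(\<lambda>a. finv \<sigma> \<circ> a) ` ?R \<subseteq> ?R" using fR by (rule image_subsetI)
  qed
  then show ?thesis by (simp add: Bij_def restr_def)
qed

lemma restr_hom:
  assumes st: "is_structure M"
  shows "group_hom (Aut_group M B) (BijGroup (realizations M B p)) (restr M B p)"
proof (rule group_hom.intro[OF group_Aut_group[OF st] group_BijGroup], unfold_locales, rule homI)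
  fix \<sigma> assume "\<sigma> \<in> carrier (Aut_group M B)"
  then show "restr M B p \<sigma> \<in> carrier (BijGroup (realizations M B p))"
    using restr_Bij[OF st] by (simp add: BijGroup_def)
next
  fix \<sigma> \<tau> assume A: "\<sigma> \<in> carrier (Aut_group M B)" "\<tau> \<in> carrier (Aut_group M B)"
  then have "restr M B p \<sigma> \<in> Bij (realizations M B p)" "restr M B p \<tau> \<in> Bij (realizations M B p)"
    using restr_Bij[OF st] by simp_all
  then have "restr M B p \<sigma> \<otimes>\<^bsub>BijGroup (realizations M B p)\<^esub> restr M B p \<tau> =
      compose (realizations M B p) (restr M B p \<sigma>) (restr M B p \<tau>)"
    by (simp add: BijGroup_def)
  also have "\<dots> = restr M B p (\<sigma> \<circ> \<tau>)"
  proof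
    fix b
    have "\<tau> \<circ> b \<in> realizations M B p" if "b \<in> realizations M B p"
      using realizations_aut[OF st _ that] A by simp
    then show "compose (realizations M B p) (restr M B p \<sigma>) (restr M B p \<tau>) b = restr M B p (\<sigma> \<circ> \<tau>) b"
      unfolding compose_def restr_def restrict_def by (simp only: comp_assoc if_True cong: if_cong)
  qed
  finally show "restr M B p (\<sigma> \<otimes>\<^bsub>Aut_group M B\<^esub> \<tau>) =
      restr M B p \<sigma> \<otimes>\<^bsub>BijGroup (realizations M B p)\<^esub> restr M B p \<tau>"
    using A by (simp add: mult_Aut_group)
qed

lemma carrier_Aut_p_group [simp]: "carrier (Aut_p_group M B p) = restr M B p ` Auts M B"
  by (simp add: Aut_p_group_def)

lemma group_Aut_p_group: "is_structure M \<Longrightarrow> group (Aut_p_group M B p)"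
  unfolding Aut_p_group_def
  using subgroup.subgroup_is_group[OF group_hom.img_is_subgroup[OF restr_hom] group_BijGroup, of M B p] by simp

lemma mult_Aut_p_group:
  assumes "is_structure M" "\<sigma> \<in> Auts M B" "\<tau> \<in> Auts M B"
  shows "restr M B p \<sigma> \<otimes>\<^bsub>Aut_p_group M B p\<^esub> restr M B p \<tau> = restr M B p (\<sigma> \<circ> \<tau>)"
  using group_hom.hom_mult[OF restr_hom[OF assms(1), of B p], of \<sigma> \<tau>] assms(2,3)
  by (simp add: Aut_p_group_def mult_Aut_group)

lemma restr_hom':
  assumes st: "is_structure M"
  shows "group_hom (Aut_group M B) (Aut_p_group M B p) (restr M B p)"
  by (rule group_hom.intro[OF group_Aut_group[OF st] group_Aut_p_group[OF st]], unfold_locales, rule homI)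
    (auto simp: mult_Aut_group mult_Aut_p_group[OF st] comp_Auts)

lemma normal_restr:
  assumes st: "is_structure M" and L: "L \<lhd> Aut_group M B"
  shows "restr M B p ` L \<lhd> Aut_p_group M B p"
proof (rule group.normal_invI[OF group_Aut_p_group[OF st]])
  interpret h: group_hom "Aut_group M B" "Aut_p_group M B p" "restr M B p" by (rule restr_hom'[OF st])
  interpret L: normal L "Aut_group M B" by (rule L)
  show "subgroup (restr M B p ` L) (Aut_p_group M B p)"
    by (rule h.subgroup_img_is_subgroup[OF L.subgroup_axioms])
  fix x l assume "x \<in> carrier (Aut_p_group M B p)" "l \<in> restr M B p ` L"
  then obtain \<tau> \<sigma> where *: "\<tau> \<in> Auts M B" "x = restr M B p \<tau>" "\<sigma> \<in> L" "l = restr M B p \<sigma>" by auto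
  then have "\<sigma> \<in> carrier (Aut_group M B)" "\<tau> \<in> carrier (Aut_group M B)" using L.subset by auto
  then have "x \<otimes>\<^bsub>Aut_p_group M B p\<^esub> l \<otimes>\<^bsub>Aut_p_group M B p\<^esub> inv\<^bsub>Aut_p_group M B p\<^esub> x =
      restr M B p (\<tau> \<otimes>\<^bsub>Aut_group M B\<^esub> \<sigma> \<otimes>\<^bsub>Aut_group M B\<^esub> inv\<^bsub>Aut_group M B\<^esub> \<tau>)"
    unfolding *(2,4) by (simp only: h.hom_mult h.hom_inv h.G.m_closed h.G.inv_closed)
  moreover have "\<tau> \<otimes>\<^bsub>Aut_group M B\<^esub> \<sigma> \<otimes>\<^bsub>Aut_group M B\<^esub> inv\<^bsub>Aut_group M B\<^esub> \<tau> \<in> L"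
    using * by (intro L.inv_op_closed2) auto
  ultimately show "x \<otimes>\<^bsub>Aut_p_group M B p\<^esub> l \<otimes>\<^bsub>Aut_p_group M B p\<^esub> inv\<^bsub>Aut_p_group M B p\<^esub> x \<in> restr M B p ` L"
    by simp
qed

text \<open>
  Automorphisms commute up to Lascar equivalence on the realizations of \<open>p\<close>. This is the consequence
  common to the commutativity of \<open>Gal_L_fix_1\<close>, of \<open>Gal_L_fix\<close> and of \<open>Gal_L\<close>.
\<close>

definition commute_on :: "('f, 'r, 's, 'a) struct \<Rightarrow> 'a set \<Rightarrow> ('f, 'r, 's, 'a, 'i) tuple_type \<Rightarrow> bool" where
  "commute_on M B p \<longleftrightarrow> (\<forall>\<sigma>\<in>Auts M B. \<forall>\<tau>\<in>Auts M B. \<forall>b\<in>realizations M B p.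
     lascar_equiv M B (\<sigma> \<circ> (\<tau> \<circ> b)) (\<tau> \<circ> (\<sigma> \<circ> b)))"

lemma Autf_fix_1_eq: "Autf_fix_1 M B p = restr M B p ` lascar_fix M B (realizations M B p)"
  by (simp add: Autf_fix_1_def lascar_fix_def)

lemma Autf_fix_omega_eq:
  fixes p :: "('f, 'r, 's, 'a, 'i) tuple_type"
  shows "Autf_fix_omega M B p =
    restr M B p ` lascar_fix M B {case_prod b |b :: nat \<Rightarrow> 'i \<Rightarrow> 'a. \<forall>n. b n \<in> realizations M B p}"
proof -
  have "{\<sigma> \<in> Auts M B. \<forall>a :: nat \<Rightarrow> 'i \<Rightarrow> 'a. (\<forall>n. a n \<in> realizations M B p)
        \<longrightarrow> lascar_equiv M B (\<lambda>(n, i). a n i) (\<sigma> \<circ> (\<lambda>(n, i). a n i))} =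
      lascar_fix M B {case_prod b |b :: nat \<Rightarrow> 'i \<Rightarrow> 'a. \<forall>n. b n \<in> realizations M B p}"
    unfolding lascar_fix_def by blast
  then show ?thesis by (simp add: Autf_fix_omega_def)
qed

lemma normal_Autf_fix_1: "is_structure M \<Longrightarrow> Autf_fix_1 M B p \<lhd> Aut_p_group M B p"
  unfolding Autf_fix_1_eq by (intro normal_restr normal_lascar_fix realizations_aut)

lemma normal_Autf_fix_omega:
  fixes p :: "('f, 'r, 's, 'a, 'i) tuple_type"
  assumes st: "is_structure M" shows "Autf_fix_omega M B p \<lhd> Aut_p_group M B p"
  unfolding Autf_fix_omega_eq
proof (intro normal_restr normal_lascar_fix st)
  fix \<sigma> d assume \<sigma>: "\<sigma> \<in> Auts M B"
    and "d \<in> {case_prod b |b :: nat \<Rightarrow> 'i \<Rightarrow> 'a. \<forall>n. b n \<in> realizations M B p}"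
  then obtain b :: "nat \<Rightarrow> 'i \<Rightarrow> 'a" where b: "d = case_prod b" "\<forall>n. b n \<in> realizations M B p" by blast
  have "\<sigma> \<circ> d = case_prod (\<lambda>n. \<sigma> \<circ> b n)" by (auto simp: b(1))
  moreover have "\<forall>n. \<sigma> \<circ> b n \<in> realizations M B p" using b(2) realizations_aut[OF st \<sigma>] by blast
  ultimately show "\<sigma> \<circ> d \<in> {case_prod b |b :: nat \<Rightarrow> 'i \<Rightarrow> 'a. \<forall>n. b n \<in> realizations M B p}" by blast
qed

text \<open>
  \<open>L\<close> stands for the automorphisms fixing the Lascar types of single realizations, or of
  \<open>\<omega>\<close>-sequences of realizations.
\<close>

lemma commute_on_Mod:
  assumes st: "is_structure M" and n: "restr M B p ` L \<lhd> Aut_p_group M B p" and L: "L \<subseteq> Auts M B"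
    and comm: "comm_group (Aut_p_group M B p Mod restr M B p ` L)"
    and fix1: "\<And>h b. h \<in> L \<Longrightarrow> b \<in> realizations M B p \<Longrightarrow> lascar_equiv M B b (h \<circ> b)"
  shows "commute_on M B p"
  unfolding commute_on_def
proof (intro ballI)
  fix \<sigma> \<tau> b assume A: "\<sigma> \<in> Auts M B" "\<tau> \<in> Auts M B" and b: "b \<in> realizations M B p"
  from comm[unfolded comm_Mod_iff[OF group_Aut_p_group[OF st] n], rule_format, of "restr M B p \<tau>" "restr M B p \<sigma>"]
  obtain h where h: "h \<in> L" "restr M B p (\<tau> \<circ> \<sigma>) = restr M B p h \<otimes>\<^bsub>Aut_p_group M B p\<^esub> restr M B p (\<sigma> \<circ> \<tau>)"
    using A by (auto simp: mult_Aut_p_group[OF st])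
  then have "restr M B p (\<tau> \<circ> \<sigma>) = restr M B p (h \<circ> (\<sigma> \<circ> \<tau>))"
    using A L by (simp add: mult_Aut_p_group[OF st] comp_Auts subset_iff)
  then have "restr M B p (\<tau> \<circ> \<sigma>) b = restr M B p (h \<circ> (\<sigma> \<circ> \<tau>)) b" by simp
  then have "\<tau> \<circ> (\<sigma> \<circ> b) = h \<circ> (\<sigma> \<circ> (\<tau> \<circ> b))" using b by (simp add: restr_def comp_assoc)
  moreover have "\<sigma> \<circ> (\<tau> \<circ> b) \<in> realizations M B p" using A b realizations_aut[OF st] by blast
  ultimately show "lascar_equiv M B (\<sigma> \<circ> (\<tau> \<circ> b)) (\<tau> \<circ> (\<sigma> \<circ> b))" using fix1[OF h(1)] by simp
qed

lemma commute_on_Gal_L_fix_1: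
  assumes st: "is_structure M" and "comm_group (Gal_L_fix_1 M B p)"
  shows "commute_on M B p"
proof (rule commute_on_Mod[OF st])
  show "restr M B p ` lascar_fix M B (realizations M B p) \<lhd> Aut_p_group M B p"
    using normal_Autf_fix_1[OF st] unfolding Autf_fix_1_eq .
  show "comm_group (Aut_p_group M B p Mod restr M B p ` lascar_fix M B (realizations M B p))"
    using assms(2) unfolding Gal_L_fix_1_def Autf_fix_1_eq .
qed (auto simp: lascar_fix_def)

lemma commute_on_Gal_L_fix:
  fixes p :: "('f, 'r, 's, 'a, 'i) tuple_type"
  assumes st: "is_structure M" and "comm_group (Gal_L_fix M B p)"
  shows "commute_on M B p"
proof (rule commute_on_Mod[OF st])
  let ?L = "lascar_fix M B {case_prod b |b :: nat \<Rightarrow> 'i \<Rightarrow> 'a. \<forall>n. b n \<in> realizations M B p}"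
  show "restr M B p ` ?L \<lhd> Aut_p_group M B p"
    using normal_Autf_fix_omega[OF st] unfolding Autf_fix_omega_eq .
  show "comm_group (Aut_p_group M B p Mod restr M B p ` ?L)"
    using assms(2) unfolding Gal_L_fix_def Autf_fix_omega_eq .
  show "?L \<subseteq> Auts M B" by (auto simp: lascar_fix_def)
  fix h b assume h: "h \<in> ?L" and b: "b \<in> realizations M B p"
  have "lascar_equiv M B (case_prod (\<lambda>n :: nat. b)) (h \<circ> case_prod (\<lambda>n :: nat. b))"
    using h b unfolding lascar_fix_def by blast
  then obtain \<sigma> where \<sigma>: "\<sigma> \<in> Autf M B" "h \<circ> case_prod (\<lambda>n :: nat. b) = \<sigma> \<circ> case_prod (\<lambda>n :: nat. b)"
    by (auto simp: lascar_equiv_def)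
  have "h \<circ> b = \<sigma> \<circ> b"
  proof
    fix i show "(h \<circ> b) i = (\<sigma> \<circ> b) i" using fun_cong[OF \<sigma>(2), of "(0, i)"] by simp
  qed
  then show "lascar_equiv M B b (h \<circ> b)" using \<sigma>(1) unfolding lascar_equiv_def by blast
qed

lemma commute_on_Gal_L:
  assumes st: "is_structure M" and comm: "comm_group (Gal_L M B)"
  shows "commute_on M B p"
  unfolding commute_on_def
proof (intro ballI)
  fix \<sigma> \<tau> b assume A: "\<sigma> \<in> Auts M B" "\<tau> \<in> Auts M B" and b: "b \<in> realizations M B p"
  from comm[unfolded Gal_L_def comm_Mod_iff[OF group_Aut_group[OF st] normal_Autf[OF st]], rule_format, of \<tau> \<sigma>]
  obtain h where h: "h \<in> Autf M B" "\<tau> \<otimes>\<^bsub>Aut_group M B\<^esub> \<sigma> = h \<otimes>\<^bsub>Aut_group M B\<^esub> (\<sigma> \<otimes>\<^bsub>Aut_group M B\<^esub> \<tau>)"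
    using A by auto
  moreover have "h \<in> Auts M B" using h Autf_props(1)[OF st] by blast
  ultimately have "\<tau> \<circ> \<sigma> = h \<circ> (\<sigma> \<circ> \<tau>)" using A by (simp add: mult_Aut_group comp_Auts)
  then have "\<tau> \<circ> (\<sigma> \<circ> b) = h \<circ> (\<sigma> \<circ> (\<tau> \<circ> b))" by (metis comp_assoc)
  then show "lascar_equiv M B (\<sigma> \<circ> (\<tau> \<circ> b)) (\<tau> \<circ> (\<sigma> \<circ> b))" using h(1) unfolding lascar_equiv_def by blast
qed

lemma trivial_Gal_L_fix_1:
  assumes st: "is_structure M" and "lascar_strong_type M B p"
  shows "trivial_group (Gal_L_fix_1 M B p)"
  unfolding Gal_L_fix_1_def
proof (rule trivial_Mod[OF group_Aut_p_group[OF st] normal_Autf_fix_1[OF st]])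
  have "Auts M B \<subseteq> lascar_fix M B (realizations M B p)"
    using assms(2) realizations_aut[OF st] unfolding lascar_fix_def lascar_strong_type_def by blast
  then show "carrier (Aut_p_group M B p) \<subseteq> Autf_fix_1 M B p" unfolding Autf_fix_1_eq by auto
qed

lemma trivial_Gal_L:
  assumes st: "is_structure M" and "lascar_strong_type M B (tp M B m)"
    and m: "elem_submodel M (range m)" "B \<subseteq> range m" "small M (range m)"
  shows "trivial_group (Gal_L M B)"
  unfolding Gal_L_def
proof (rule trivial_Mod[OF group_Aut_group[OF st] normal_Autf[OF st]], rule subsetI)
  fix \<sigma> assume "\<sigma> \<in> carrier (Aut_group M B)"
  then have \<sigma>: "\<sigma> \<in> Auts M B" by simp
  have "m \<in> realizations M B (tp M B m)" by (simp add: realizations_def)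
  then have "lascar_equiv M B m (\<sigma> \<circ> m)"
    using assms(2) realizations_aut[OF st \<sigma>] unfolding lascar_strong_type_def by blast
  then obtain \<tau> where \<tau>: "\<tau> \<in> Autf M B" "\<sigma> \<circ> m = \<tau> \<circ> m" by (auto simp: lascar_equiv_def)
  have \<tau>A: "\<tau> \<in> Auts M B" using \<tau>(1) Autf_props(1)[OF st] by blast
  have "finv \<tau> \<circ> \<sigma> \<in> Auts M B" using comp_Auts[OF inv_Auts[OF st \<tau>A] \<sigma>] .
  moreover have "(finv \<tau> \<circ> \<sigma>) x = x" if x: "x \<in> range m" for x
  proof -
    obtain i where "x = m i" using x by auto
    then show ?thesis using fun_cong[OF \<tau>(2), of i] finv_simps(2)[OF \<tau>A] by simp
  qed
  ultimately have "finv \<tau> \<circ> \<sigma> \<in> Autf M B"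
    unfolding Autf_def using m by (intro generate.incl) blast
  then have "\<tau> \<circ> (finv \<tau> \<circ> \<sigma>) \<in> Autf M B" using Autf_props(3)[OF st \<tau>(1)] by blast
  then show "\<sigma> \<in> Autf M B" by (simp only: finv_comp_simps[OF \<tau>A])
qed

section \<open>Independence\<close>

text \<open>
  The data of the theorem: a strong type \<open>p\<close> over \<open>B\<close> of a tuple \<open>a0\<close> enumerating an algebraically
  closed set.
\<close>

locale strong_type =
  fixes M :: "('f, 'r, 's, 'a) struct"
    and ind :: "'a set \<Rightarrow> 'a set \<Rightarrow> 'a set \<Rightarrow> bool"
    and B :: "'a set"
    and a0 :: "'i \<Rightarrow> 'a"
    and p :: "('f, 'r, 's, 'a, 'i) tuple_type"
  assumes monster: "monster M" and indep: "indep_relation M ind"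
    and small_B: "small M B" and acl_B: "acl M B = B"
    and small_I: "small M (UNIV :: 'i set)"
    and p_eq: "p = tp M B a0" and range_a0: "range a0 = acl M (B \<union> range a0)"
begin

abbreviation R :: "('i \<Rightarrow> 'a) set" where "R \<equiv> realizations M B p"

lemmas st = monsterD(1)[OF monster]

lemma a0_R: "a0 \<in> R" by (simp add: realizations_def p_eq)

lemma R_aut: "\<sigma> \<in> Auts M B \<Longrightarrow> b \<in> R \<Longrightarrow> \<sigma> \<circ> b \<in> R"
  by (rule realizations_aut[OF st])

lemma R_conj: "b \<in> R \<Longrightarrow> c \<in> R \<Longrightarrow> \<exists>\<sigma>\<in>Auts M B. \<sigma> \<circ> b = c"
  using realizations_conj[OF monster small_B small_I, of b p c] by metis

lemma finv_Auts: "\<sigma> \<in> Auts M B \<Longrightarrow> finv \<sigma> \<in> Auts M B"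
  by (rule inv_Auts[OF st])

lemma small_range: "small M (range (b :: 'i \<Rightarrow> 'a))"
  by (rule small_image[OF small_I])

lemma acl_image: "\<sigma> \<in> Auts M B \<Longrightarrow> \<sigma> ` acl M (B \<union> X) = acl M (B \<union> \<sigma> ` X)"
  using acl_aut[OF st Auts_mono[of \<sigma> M B "{}"], of "B \<union> X"] by (simp add: image_Un Auts_image)

text \<open>Every realization of \<open>p\<close> enumerates an algebraically closed set, being conjugate to \<open>a0\<close>.\<close>

lemma R_acl: assumes "b \<in> R" shows "acl M (B \<union> range b) = range b"
proof -
  obtain \<sigma> where \<sigma>: "\<sigma> \<in> Auts M B" "\<sigma> \<circ> a0 = b" using R_conj[OF a0_R assms] by blast
  then have "range b = \<sigma> ` range a0" by auto
  also have "\<dots> = \<sigma> ` acl M (B \<union> range a0)" using range_a0 by simp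
  also have "\<dots> = acl M (B \<union> \<sigma> ` range a0)" by (rule acl_image[OF \<sigma>(1)])
  also have "\<sigma> ` range a0 = range b" using \<sigma>(2) by auto
  finally show ?thesis ..
qed

lemma ind_aut:
  assumes "\<sigma> \<in> Auts M B" "small M X" "small M Y" "ind X B Y"
  shows "ind (\<sigma> ` X) B (\<sigma> ` Y)"
proof -
  have "\<forall>\<sigma>\<in>Auts M {}. \<forall>A C D. small M A \<and> small M C \<and> small M D
       \<longrightarrow> (ind A C D \<longleftrightarrow> ind (\<sigma> ` A) (\<sigma> ` C) (\<sigma> ` D))"
    using indep unfolding indep_relation_def by (elim conjE)
  then have "ind (\<sigma> ` X) (\<sigma> ` B) (\<sigma> ` Y)"
    using assms small_B Auts_mono[OF assms(1), of "{}"] by blast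
  then show ?thesis by (simp add: Auts_image[OF assms(1)])
qed

lemma ind_mono:
  assumes "ind X C Y" "X' \<subseteq> X" "Y' \<subseteq> Y" "small M X" "small M C" "small M Y"
  shows "ind X' C Y'"
proof -
  have fc: "\<forall>A C D. small M A \<and> small M C \<and> small M D
       \<longrightarrow> (ind A C D \<longleftrightarrow> (\<forall>A0 D0. finite A0 \<and> A0 \<subseteq> A \<and> finite D0 \<and> D0 \<subseteq> D \<longrightarrow> ind A0 C D0))"
    using indep unfolding indep_relation_def by (elim conjE)
  have iff: "ind X1 C Y1 \<longleftrightarrow> (\<forall>A0 D0. finite A0 \<and> A0 \<subseteq> X1 \<and> finite D0 \<and> D0 \<subseteq> Y1 \<longrightarrow> ind A0 C D0)"
    if "small M X1" "small M Y1" for X1 Y1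
    using fc[THEN spec[of _ X1], THEN spec[of _ C], THEN spec[of _ Y1]] that assms(5) by simp
  have "\<forall>A0 D0. finite A0 \<and> A0 \<subseteq> X \<and> finite D0 \<and> D0 \<subseteq> Y \<longrightarrow> ind A0 C D0"
    using iff[OF assms(4,6)] assms(1) by simp
  then have "\<forall>A0 D0. finite A0 \<and> A0 \<subseteq> X' \<and> finite D0 \<and> D0 \<subseteq> Y' \<longrightarrow> ind A0 C D0"
    using assms(2,3) by (meson order_trans)
  then show ?thesis using iff[OF small_subset[OF assms(4,2)] small_subset[OF assms(6,3)]] by (simp only:)
qed

lemma ind_acl:
  assumes "ind X C Y" "small M X" "small M C" "small M Y"
  shows "ind X C (acl M (Y \<union> C))"
proof -
  have "\<forall>A C D. small M A \<and> small M C \<and> small M D \<longrightarrow> ind A C D \<longrightarrow> ind A C (acl M (D \<union> C))"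
    using indep unfolding indep_relation_def by (elim conjE)
  then show ?thesis using assms by blast
qed

lemma ind_base:
  assumes "ind X C Y" "small M X" "small M C" "small M Y"
  shows "ind X C (Y \<union> C)"
  by (rule ind_mono[OF ind_acl[OF assms] order_refl acl_superset assms(2,3)])
    (intro small_acl[OF monster] small_Un[OF monster] assms)

lemma ind_sym:
  assumes "ind X C Y" "small M X" "small M C" "small M Y"
  shows "ind Y C X"
proof -
  have "\<forall>A C D. small M A \<and> small M C \<and> small M D \<longrightarrow> (ind A C D \<longleftrightarrow> ind D C A)"
    using indep unfolding indep_relation_def by (elim conjE)
  then show ?thesis using assms by blast
qed

lemma ind_trans:
  assumes "small M X" "small M D" "E \<subseteq> C" "C \<subseteq> D"
  shows "ind X E D \<longleftrightarrow> ind X E C \<and> ind X C D"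
proof -
  have "\<forall>A E C D. small M A \<and> small M D \<and> E \<subseteq> C \<and> C \<subseteq> D \<longrightarrow> (ind A E D \<longleftrightarrow> ind A E C \<and> ind A C D)"
    using indep unfolding indep_relation_def by (elim conjE)
  then show ?thesis using assms by blast
qed

text \<open>Every small set admits a realization of \<open>p\<close> independent from it.\<close>

lemma exists_indep:
  assumes "small M D" shows "\<exists>c\<in>R. ind (range c) B D"
proof -
  have ext: "\<forall>A E C. small M A \<and> small M C \<and> E \<subseteq> C \<longrightarrow> (\<exists>h. elem_map_on M E A h \<and> ind (h ` A) E C)"
    using indep unfolding indep_relation_def by (elim conjE)
  have sm: "small M (D \<union> B)" by (intro small_Un[OF monster] assms small_B)
  then obtain h where h: "elem_map_on M B (range a0) h" "ind (h ` range a0) B (D \<union> B)"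
    using ext small_range[of a0] by blast
  obtain \<sigma> where \<sigma>: "\<sigma> \<in> Auts M B" "\<forall>x\<in>range a0. \<sigma> x = h x"
    using homogeneity_elem_map[OF monster small_B small_range h(1)] by blast
  then have r: "range (\<sigma> \<circ> a0) = h ` range a0" by (auto simp: image_iff)
  have "ind (range (\<sigma> \<circ> a0)) B D" unfolding r
    by (rule ind_mono[OF h(2) order_refl _ small_image[OF small_range] small_B sm]) simp
  then show ?thesis using R_aut[OF \<sigma>(1) a0_R] by blast
qed

text \<open>
  If \<open>X\<close> is independent from \<open>Y\<close>, and \<open>Z\<close> from \<open>X \<union> Y\<close>, then \<open>X\<close> is independent from \<open>Y \<union> Z\<close>. So an
  independent pair extended by an independent third element is an independent triple.
\<close>

lemma ind_shift:
  assumes Z: "ind Z B (X \<union> Y)" and X: "ind X B Y" and sm: "small M X" "small M Y" "small M Z"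
  shows "ind X B (Y \<union> Z)"
proof -
  have s: "small M (B \<union> Y)" "small M (B \<union> Y \<union> X)" "small M (X \<union> Y)" "small M (Z \<union> (B \<union> Y))"
    by (intro small_Un[OF monster] small_B sm)+
  have s': "small M (X \<union> Y \<union> B)" "small M (Y \<union> B)" by (intro small_Un[OF monster] small_B sm)+
  have "ind Z B (B \<union> Y \<union> X)"
    by (rule ind_mono[OF ind_base[OF Z sm(3) small_B s(3)] _ _ sm(3) small_B s'(1)]) auto
  then have "ind Z (B \<union> Y) (B \<union> Y \<union> X)"
    using ind_trans[OF sm(3) s(2), of B "B \<union> Y"] by simp
  then have "ind Z (B \<union> Y) X" by (rule ind_mono[OF _ _ _ sm(3) s(1) s(2)]) auto
  then have "ind X (B \<union> Y) Z" by (rule ind_sym[OF _ sm(3) s(1) sm(1)])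
  from ind_base[OF this sm(1) s(1) sm(3)] have "ind X (B \<union> Y) (Z \<union> (B \<union> Y))" .
  moreover have "ind X B (B \<union> Y)"
    by (rule ind_mono[OF ind_base[OF X sm(1) small_B sm(2)] _ _ sm(1) small_B s'(2)]) auto
  ultimately have "ind X B (Z \<union> (B \<union> Y))"
    using ind_trans[OF sm(1) s(4), of B "B \<union> Y"] by auto
  then show ?thesis by (rule ind_mono[OF _ _ _ sm(1) small_B s(4)]) auto
qed

text \<open>The family of the sets \<open>A i\<close>, \<open>i \<in> s\<close>, is independent over \<open>B\<close>.\<close>

definition indep_fam :: "nat set \<Rightarrow> (nat \<Rightarrow> 'a set) \<Rightarrow> bool" where
  "indep_fam s A \<longleftrightarrow> (\<forall>i\<in>s. ind (A i) B (\<Union>j\<in>s - {i}. A j))"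

section \<open>Simplices in normal form\<close>

text \<open>
  A simplex with vertex set \<open>s\<close> in normal form is given by sets \<open>A i\<close>, \<open>i \<in> s\<close>, and by automorphisms
  \<open>\<tau> u\<close>, \<open>u \<subseteq> s\<close>: the object at \<open>u\<close> is the \<open>\<tau> u\<close>-image of the algebraic closure \<open>acl_span A u\<close> of the union
  of the \<open>A i\<close> with \<open>i \<in> u\<close>, and the map from \<open>u\<close> to \<open>v\<close> is the inclusion of these closures, transported
  by \<open>\<tau> u\<close> and \<open>\<tau> v\<close>.
\<close>

definition acl_span :: "(nat \<Rightarrow> 'a set) \<Rightarrow> nat set \<Rightarrow> 'a set" where
  "acl_span A u = acl M (B \<union> (\<Union>i\<in>u. A i))"

definition normal_form :: "nat set \<Rightarrow> (nat \<Rightarrow> 'a set) \<Rightarrow> (nat set \<Rightarrow> 'a \<Rightarrow> 'a) \<Rightarrow> 'a simplex" where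
  "normal_form s A \<tau> = \<lparr>supp = s, ob = restrict (\<lambda>u. \<tau> u ` acl_span A u) (Pow s),
     mor = restrict (\<lambda>w. restrict (\<lambda>x. \<tau> (snd w) (finv (\<tau> (fst w)) x)) (\<tau> (fst w) ` acl_span A (fst w))) (arrows s)\<rparr>"

text \<open>
  The conditions under which the normal form is a simplex of \<open>p\<close>: the \<open>A i\<close> are enumerated by
  realizations of \<open>p\<close> and independent, the \<open>\<tau> u\<close> are automorphisms over \<open>B\<close>.
\<close>

definition simplex_data :: "nat set \<Rightarrow> (nat \<Rightarrow> 'a set) \<Rightarrow> (nat set \<Rightarrow> 'a \<Rightarrow> 'a) \<Rightarrow> bool" where
  "simplex_data s A \<tau> \<longleftrightarrow> finite s \<and> (\<forall>i\<in>s. \<exists>b\<in>R. A i = range b) \<and> indep_fam s A \<and> (\<forall>u\<subseteq>s. \<tau> u \<in> Auts M B)"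

lemma supp_nf [simp]: "supp (normal_form s A \<tau>) = s" by (simp add: normal_form_def)

lemma ob_nf: "u \<subseteq> s \<Longrightarrow> ob (normal_form s A \<tau>) u = \<tau> u ` acl_span A u" by (simp add: normal_form_def)

lemma mor_nf: "u \<subseteq> v \<Longrightarrow> v \<subseteq> s \<Longrightarrow> mor (normal_form s A \<tau>) (u, v) = restrict (\<lambda>x. \<tau> v (finv (\<tau> u) x)) (\<tau> u ` acl_span A u)"
  by (simp add: normal_form_def arrows_def)

lemma acl_span_mono: "u \<subseteq> v \<Longrightarrow> acl_span A u \<subseteq> acl_span A v"
  unfolding acl_span_def by (rule acl_mono) auto

lemma acl_span_B: "B \<subseteq> acl_span A u"
  unfolding acl_span_def using acl_superset[of "B \<union> (\<Union>i\<in>u. A i)" M] by blast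

lemma acl_span_empty: "acl_span A {} = B"
  by (simp add: acl_span_def acl_B)

lemma acl_span_single: "A i = range b \<Longrightarrow> b \<in> R \<Longrightarrow> acl_span A {i} = A i"
  by (simp add: acl_span_def R_acl)

lemma acl_span_aut: "\<sigma> \<in> Auts M B \<Longrightarrow> \<sigma> ` acl_span A u = acl_span (\<lambda>i. \<sigma> ` A i) u"
  unfolding acl_span_def by (simp add: acl_image image_UN)

lemma simplex_dataD:
  assumes "simplex_data s A \<tau>"
  shows "finite s" "i \<in> s \<Longrightarrow> \<exists>b\<in>R. A i = range b" "i \<in> s \<Longrightarrow> small M (A i)" "u \<subseteq> s \<Longrightarrow> \<tau> u \<in> Auts M B"
    "i \<in> s \<Longrightarrow> acl_span A {i} = A i" "u \<subseteq> s \<Longrightarrow> small M (\<Union>i\<in>u. A i)" "u \<subseteq> s \<Longrightarrow> small M (acl_span A u)"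
proof -
  have R: "\<exists>b\<in>R. A i = range b" if "i \<in> s" for i
    using assms that by (auto simp: simplex_data_def)
  then show "i \<in> s \<Longrightarrow> \<exists>b\<in>R. A i = range b" .
  show "finite s" using assms by (simp add: simplex_data_def)
  show "u \<subseteq> s \<Longrightarrow> \<tau> u \<in> Auts M B"
    using assms by (auto simp: simplex_data_def)
  have sm: "small M (A i)" if "i \<in> s" for i using R[OF that] small_range by auto
  then show "i \<in> s \<Longrightarrow> small M (A i)" .
  show "i \<in> s \<Longrightarrow> acl_span A {i} = A i" using R acl_span_single by blast
  have smU: "small M (\<Union>i\<in>u. A i)" if "u \<subseteq> s" for u
    by (rule small_UN[OF monster]) (use assms that sm in \<open>auto simp: simplex_data_def intro: finite_subset\<close>)
  then show "u \<subseteq> s \<Longrightarrow> small M (\<Union>i\<in>u. A i)" .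
  show "u \<subseteq> s \<Longrightarrow> small M (acl_span A u)" unfolding acl_span_def
    by (intro small_acl[OF monster] small_Un[OF monster] small_B smU)
qed

lemma simplex_data_ind:
  assumes "simplex_data s A \<tau>" "u \<subseteq> s" "i \<in> u"
  shows "ind (A i) B (\<Union>j\<in>u - {i}. A j)"
proof (rule ind_mono)
  show "ind (A i) B (\<Union>j\<in>s - {i}. A j)" using assms by (auto simp: simplex_data_def indep_fam_def)
  show "small M (\<Union>j\<in>s - {i}. A j)" by (rule simplex_dataD(6)[OF assms(1)]) auto
  show "small M (A i)" using simplex_dataD(3)[OF assms(1)] assms(2,3) by blast
qed (use assms small_B in auto)

lemma simplex_data_subset: "simplex_data s A \<tau> \<Longrightarrow> u \<subseteq> s \<Longrightarrow> simplex_data u A \<tau>"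
  using simplex_data_ind[of s A \<tau> u] by (auto simp: simplex_data_def indep_fam_def intro: finite_subset)

lemma vertex_nf:
  assumes g: "simplex_data s A \<tau>" and i: "i \<in> u" "u \<subseteq> s"
  shows "vertex (normal_form s A \<tau>) u i = \<tau> u ` A i"
proof -
  have si: "{i} \<subseteq> s" "{i} \<subseteq> u" using i by auto
  have h: "acl_span A {i} = A i" using simplex_dataD(5)[OF g] si by auto
  have "(\<lambda>x. \<tau> u (finv (\<tau> {i}) x)) ` \<tau> {i} ` A i = \<tau> u ` A i"
    by (simp only: image_image finv_simps(2)[OF simplex_dataD(4)[OF g si(1)]])
  then show ?thesis
    unfolding vertex_def mor_nf[OF si(2) i(2)] ob_nf[OF si(1)] h by simp
qed

lemma nf_functor:
  assumes g: "simplex_data s A \<tau>" shows "is_functor M B (normal_form s A \<tau>)"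
  unfolding is_functor_def supp_nf
proof (intro conjI allI impI)
  show "ob (normal_form s A \<tau>) \<in> extensional (Pow s)" by (simp add: normal_form_def)
  show "mor (normal_form s A \<tau>) \<in> extensional (arrows s)" by (simp add: normal_form_def)
next
  fix u assume u: "u \<subseteq> s"
  note \<tau>u = simplex_dataD(4)[OF g u]
  show "B \<subseteq> ob (normal_form s A \<tau>) u" unfolding ob_nf[OF u]
    using image_mono[OF acl_span_B, of "\<tau> u" A u] Auts_image[OF \<tau>u] by simp
  show "small M (ob (normal_form s A \<tau>) u)" unfolding ob_nf[OF u] by (intro small_image simplex_dataD(7)[OF g u])
  show "mor (normal_form s A \<tau>) (u, u) = restrict (\<lambda>x. x) (ob (normal_form s A \<tau>) u)"
    unfolding ob_nf[OF u] mor_nf[OF order_refl u] by (simp only: finv_simps(1)[OF \<tau>u])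
next
  fix u v assume "(u, v) \<in> arrows s"
  then have uv: "u \<subseteq> v" "v \<subseteq> s" "u \<subseteq> s" by (auto simp: arrows_def)
  note \<tau>u = simplex_dataD(4)[OF g uv(3)] and \<tau>v = simplex_dataD(4)[OF g uv(2)]
  show "mor (normal_form s A \<tau>) (u, v) \<in> ob (normal_form s A \<tau>) u \<rightarrow>\<^sub>E ob (normal_form s A \<tau>) v"
    unfolding mor_nf[OF uv(1,2)] ob_nf[OF uv(3)] ob_nf[OF uv(2)]
    using acl_span_mono[OF uv(1), of A] finv_simps(2)[OF \<tau>u] by auto
  show "elem_map_on M B (ob (normal_form s A \<tau>) u) (mor (normal_form s A \<tau>) (u, v))"
    unfolding mor_nf[OF uv(1,2)] ob_nf[OF uv(3)]
    by (rule elem_map_aut[OF st comp_Auts[OF \<tau>v finv_Auts[OF \<tau>u]]]) simp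
next
  fix u v w assume "(u, v) \<in> arrows s \<and> (v, w) \<in> arrows s"
  then have uv: "u \<subseteq> v" "v \<subseteq> s" "u \<subseteq> s" "v \<subseteq> w" "w \<subseteq> s" "u \<subseteq> w" by (auto simp: arrows_def)
  note \<tau>u = simplex_dataD(4)[OF g uv(3)] and \<tau>v = simplex_dataD(4)[OF g uv(2)]
  show "mor (normal_form s A \<tau>) (u, w) = compose (ob (normal_form s A \<tau>) u) (mor (normal_form s A \<tau>) (v, w)) (mor (normal_form s A \<tau>) (u, v))"
  proof
    fix x
    show "mor (normal_form s A \<tau>) (u, w) x = compose (ob (normal_form s A \<tau>) u) (mor (normal_form s A \<tau>) (v, w)) (mor (normal_form s A \<tau>) (u, v)) x"
    proof (cases "x \<in> \<tau> u ` acl_span A u")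
      case True
      then obtain y where y: "x = \<tau> u y" "y \<in> acl_span A u" by blast
      then have "y \<in> acl_span A v" using acl_span_mono[OF uv(1)] by blast
      then have "\<tau> v y \<in> \<tau> v ` acl_span A v" by blast
      then show ?thesis
        using True y unfolding mor_nf[OF uv(6,5)] mor_nf[OF uv(1,2)] mor_nf[OF uv(4,5)] ob_nf[OF uv(3)]
        by (simp add: compose_def finv_simps(2)[OF \<tau>u] finv_simps(2)[OF \<tau>v])
    next
      case False
      then show ?thesis unfolding mor_nf[OF uv(6,5)] ob_nf[OF uv(3)] by (simp add: compose_def)
    qed
  qed
qed

lemma nf_simplex:
  assumes g: "simplex_data s A \<tau>" and n: "card s = n + 1"
  shows "normal_form s A \<tau> \<in> simplices M ind B p n"
  unfolding simplices_def supp_nf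
proof (intro CollectI conjI ballI allI impI)
  show "finite (supp (normal_form s A \<tau>))" using simplex_dataD(1)[OF g] by simp
  show "card (supp (normal_form s A \<tau>)) = n + 1" using n by simp
  show "is_functor M B (normal_form s A \<tau>)" by (rule nf_functor[OF g])
  have e: "{} \<subseteq> s" by simp
  show "ob (normal_form s A \<tau>) {} = B" unfolding ob_nf[OF e] acl_span_empty by (rule Auts_image[OF simplex_dataD(4)[OF g e]])
next
  fix i assume "i \<in> supp (normal_form s A \<tau>)"
  then have i: "i \<in> s" "{i} \<subseteq> s" by auto
  obtain b where b: "b \<in> R" "A i = range b" using simplex_dataD(2)[OF g i(1)] by blast
  have "\<tau> {i} \<circ> b \<in> R" by (rule R_aut[OF simplex_dataD(4)[OF g i(2)] b(1)])
  moreover have "ob (normal_form s A \<tau>) {i} = acl M (B \<union> range (\<tau> {i} \<circ> b))"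
    unfolding ob_nf[OF i(2)] simplex_dataD(5)[OF g i(1)] R_acl[OF calculation] b(2) by (rule image_comp)
  ultimately show "\<exists>b\<in>R. ob (normal_form s A \<tau>) {i} = acl M (B \<union> range b)" by blast
next
  fix u assume "u \<noteq> {} \<and> u \<subseteq> supp (normal_form s A \<tau>)"
  then have u: "u \<subseteq> s" by simp
  have v: "vertex (normal_form s A \<tau>) u i = \<tau> u ` A i" if "i \<in> u" for i by (rule vertex_nf[OF g that u])
  show "ob (normal_form s A \<tau>) u = acl M (B \<union> (\<Union>i\<in>u. vertex (normal_form s A \<tau>) u i))"
    unfolding ob_nf[OF u] acl_span_def acl_image[OF simplex_dataD(4)[OF g u]] by (simp add: v image_UN)
  fix i assume i: "i \<in> u"
  have "ind (\<tau> u ` A i) B (\<tau> u ` (\<Union>j\<in>u - {i}. A j))"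
    by (rule ind_aut[OF simplex_dataD(4)[OF g u] _ _ simplex_data_ind[OF g u i]]) (use simplex_dataD(3,6)[OF g] u i in blast)+
  then show "ind (vertex (normal_form s A \<tau>) u i) B (\<Union>j\<in>u - {i}. vertex (normal_form s A \<tau>) u j)"
    using i by (simp add: v image_UN)
qed

text \<open>
  Replacing the \<open>A i\<close> by their images under \<open>\<sigma>\<close>, and the \<open>\<tau> u\<close> by automorphisms \<open>\<tau>' u\<close> with
  \<open>\<tau> u = \<tau>' u \<circ> \<sigma>\<close> where it matters, does not change the simplex.
\<close>

lemma nf_cong:
  assumes \<sigma>: "\<sigma> \<in> Auts M B" and A': "\<And>i. i \<in> s \<Longrightarrow> A' i = \<sigma> ` A i"
    and t: "\<And>u. u \<subseteq> s \<Longrightarrow> \<tau> u \<in> Auts M B" "\<And>u. u \<subseteq> s \<Longrightarrow> \<tau>' u \<in> Auts M B"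
    and eq: "\<And>u x. u \<subseteq> s \<Longrightarrow> x \<in> acl_span A u \<Longrightarrow> \<tau> u x = \<tau>' u (\<sigma> x)"
  shows "normal_form s A \<tau> = normal_form s A' \<tau>'"
proof -
  have K: "acl_span A' u = \<sigma> ` acl_span A u" if "u \<subseteq> s" for u
  proof -
    have "(\<Union>i\<in>u. A' i) = (\<Union>i\<in>u. \<sigma> ` A i)" by (rule SUP_cong) (use A' that in auto)
    then show ?thesis unfolding acl_span_aut[OF \<sigma>] by (simp add: acl_span_def)
  qed
  have im: "\<tau>' u ` acl_span A' u = \<tau> u ` acl_span A u" if "u \<subseteq> s" for u
    unfolding K[OF that] image_image using eq[OF that] by (intro image_cong) auto
  have "ob (normal_form s A \<tau>) = ob (normal_form s A' \<tau>')"
    unfolding normal_form_def simplex.simps by (rule restrict_ext) (simp add: im)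
  moreover have "mor (normal_form s A \<tau>) = mor (normal_form s A' \<tau>')"
  proof (rule extensionalityI[of _ "arrows s"])
    fix w assume "w \<in> arrows s"
    then obtain u v where w: "w = (u, v)" and uv: "u \<subseteq> v" "v \<subseteq> s" "u \<subseteq> s" by (auto simp: arrows_def)
    show "mor (normal_form s A \<tau>) w = mor (normal_form s A' \<tau>') w"
      unfolding w mor_nf[OF uv(1,2)] im[OF uv(3)]
    proof (rule restrict_ext)
      fix x assume "x \<in> \<tau> u ` acl_span A u"
      then obtain y where y: "x = \<tau> u y" "y \<in> acl_span A u" by blast
      then have "y \<in> acl_span A v" using acl_span_mono[OF uv(1)] by blast
      have x': "x = \<tau>' u (\<sigma> y)" using y eq[OF uv(3)] by simp
      have "\<tau> v (finv (\<tau> u) x) = \<tau> v y" unfolding y(1) finv_simps(2)[OF t(1)[OF uv(3)]] ..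
      also have "\<dots> = \<tau>' v (\<sigma> y)" using eq[OF uv(2) \<open>y \<in> acl_span A v\<close>] .
      also have "\<dots> = \<tau>' v (finv (\<tau>' u) x)" unfolding x' finv_simps(2)[OF t(2)[OF uv(3)]] ..
      finally show "\<tau> v (finv (\<tau> u) x) = \<tau>' v (finv (\<tau>' u) x)" .
    qed
  qed (simp_all add: normal_form_def)
  ultimately show ?thesis by (simp add: normal_form_def)
qed

lemma face_nf: "face k (normal_form s A \<tau>) = normal_form (s - {sorted_list_of_set s ! k}) A \<tau>"
proof -
  have "Pow s \<inter> Pow s' = Pow s'" "arrows s \<inter> arrows s' = arrows s'" if "s' \<subseteq> s" for s'
    using that by (auto simp: arrows_def)
  then show ?thesis by (simp add: face_def Let_def normal_form_def)
qed

text \<open>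
  Every simplex is in normal form: \<open>A i\<close> is the image of the \<open>i\<close>th vertex in the top object, and
  \<open>\<tau> u\<close> inverts an automorphism extending the map from the object at \<open>u\<close> into the top object.
\<close>

theorem simplex_normal_form:
  assumes f: "f \<in> simplices M ind B p n"
  obtains A \<tau> where "simplex_data (supp f) A \<tau>" "f = normal_form (supp f) A \<tau>"
proof -
  let ?s = "supp f"
  have fin: "finite ?s" and card: "card ?s = n + 1" and func: "is_functor M B f" and e: "ob f {} = B"
    and vert: "\<And>i. i \<in> ?s \<Longrightarrow> \<exists>b\<in>R. ob f {i} = acl M (B \<union> range b)"
    and face: "\<And>u. u \<noteq> {} \<Longrightarrow> u \<subseteq> ?s \<Longrightarrow> ob f u = acl M (B \<union> (\<Union>i\<in>u. vertex f u i))"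
    and ind: "\<And>u i. u \<noteq> {} \<Longrightarrow> u \<subseteq> ?s \<Longrightarrow> i \<in> u \<Longrightarrow> ind (vertex f u i) B (\<Union>j\<in>u - {i}. vertex f u j)"
    using f unfolding simplices_def by blast+
  have ne: "?s \<noteq> {}" using card by auto
  note func' = func[unfolded is_functor_def]
  have ext: "ob f \<in> extensional (Pow ?s)" using func' by (elim conjE)
  have ext': "mor f \<in> extensional (arrows ?s)" using func' by (elim conjE)
  have sm0: "\<forall>u. u \<subseteq> ?s \<longrightarrow> B \<subseteq> ob f u \<and> small M (ob f u)" using func' by (elim conjE)
  have mor0: "\<forall>u v. (u, v) \<in> arrows ?s \<longrightarrow>
        mor f (u, v) \<in> ob f u \<rightarrow>\<^sub>E ob f v \<and> elem_map_on M B (ob f u) (mor f (u, v))"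
    using func' by (elim conjE)
  have comp0: "\<forall>u v w. (u, v) \<in> arrows ?s \<and> (v, w) \<in> arrows ?s
        \<longrightarrow> mor f (u, w) = compose (ob f u) (mor f (v, w)) (mor f (u, v))"
    using func' by (elim conjE)
  have sm: "small M (ob f u)" if "u \<subseteq> ?s" for u using sm0 that by simp
  have mor: "mor f (u, v) \<in> ob f u \<rightarrow>\<^sub>E ob f v" "elem_map_on M B (ob f u) (mor f (u, v))"
    if "u \<subseteq> v" "v \<subseteq> ?s" for u v
    using mor0 that by (simp_all add: arrows_def)
  have comp: "mor f (u, w) x = mor f (v, w) (mor f (u, v) x)" if "u \<subseteq> v" "v \<subseteq> w" "w \<subseteq> ?s" "x \<in> ob f u" for u v w x
  proof -
    have "(u, v) \<in> arrows ?s \<and> (v, w) \<in> arrows ?s" using that by (auto simp: arrows_def)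
    then have "mor f (u, w) = compose (ob f u) (mor f (v, w)) (mor f (u, v))" using comp0 by blast
    then show ?thesis using that(4) by (simp add: compose_def)
  qed
  \<comment> \<open>All maps into the top object extend to automorphisms.\<close>
  have "\<exists>\<sigma>\<in>Auts M B. \<forall>x\<in>ob f u. \<sigma> x = mor f (u, ?s) x" if "u \<subseteq> ?s" for u
    by (rule homogeneity_elem_map[OF monster small_B sm[OF that] mor(2)[OF that order_refl]])
  then obtain \<rho> where \<rho>: "\<And>u. u \<subseteq> ?s \<Longrightarrow> \<rho> u \<in> Auts M B"
    "\<And>u x. u \<subseteq> ?s \<Longrightarrow> x \<in> ob f u \<Longrightarrow> \<rho> u x = mor f (u, ?s) x" by metis
  define A where "A i = vertex f ?s i" for i
  define \<tau> where "\<tau> u = finv (\<rho> u)" for u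
  have \<tau>: "\<tau> u \<in> Auts M B" if "u \<subseteq> ?s" for u unfolding \<tau>_def by (rule finv_Auts[OF \<rho>(1)[OF that]])
  have finv\<tau>: "finv (\<tau> u) = \<rho> u" if "u \<subseteq> ?s" for u
    unfolding \<tau>_def by (rule inv_inv_eq[OF AutsD(1)[OF \<rho>(1)[OF that]]])
  have A: "\<exists>b\<in>R. A i = range b" if i: "i \<in> ?s" for i
  proof -
    obtain b where b: "b \<in> R" "ob f {i} = acl M (B \<union> range b)" using vert[OF i] by blast
    have si: "{i} \<subseteq> ?s" using i by simp
    have "A i = \<rho> {i} ` ob f {i}" unfolding A_def vertex_def using \<rho>(2)[OF si] by (intro image_cong) auto
    also have "\<dots> = range (\<rho> {i} \<circ> b)" unfolding b(2) R_acl[OF b(1)] by (rule image_comp)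
    finally show ?thesis using R_aut[OF \<rho>(1)[OF si] b(1)] by blast
  qed
  have g: "simplex_data ?s A \<tau>"
    unfolding simplex_data_def indep_fam_def using fin A \<tau> ind[OF ne order_refl] by (simp add: A_def)
  have \<rho>v: "\<rho> u ` vertex f u i = A i" if u: "u \<subseteq> ?s" "i \<in> u" for u i
  proof -
    have iu: "{i} \<subseteq> u" using u by simp
    have "\<rho> u (mor f ({i}, u) x) = mor f ({i}, ?s) x" if "x \<in> ob f {i}" for x
      using \<rho>(2)[OF u(1), of "mor f ({i}, u) x"] mor(1)[OF iu u(1)] comp[OF iu u(1) order_refl that] that by auto
    then show ?thesis unfolding A_def vertex_def image_image by (intro image_cong) auto
  qed
  have K: "\<rho> u ` ob f u = acl_span A u" if u: "u \<subseteq> ?s" for u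
  proof (cases "u = {}")
    case True
    then show ?thesis using e acl_span_empty Auts_image[OF \<rho>(1)[OF u]] by simp
  next
    case False
    show ?thesis unfolding face[OF False u] acl_image[OF \<rho>(1)[OF u]] acl_span_def image_UN
      using \<rho>v[OF u] by simp
  qed
  have obu: "ob f u = \<tau> u ` acl_span A u" if u: "u \<subseteq> ?s" for u
    unfolding K[OF u, symmetric] \<tau>_def finv_simps(6)[OF \<rho>(1)[OF u]] ..
  have "ob f = ob (normal_form ?s A \<tau>)"
  proof (rule extensionalityI[OF ext])
    show "ob (normal_form ?s A \<tau>) \<in> extensional (Pow ?s)" by (simp add: normal_form_def)
    show "ob f u = ob (normal_form ?s A \<tau>) u" if "u \<in> Pow ?s" for u using that obu by (simp add: ob_nf)
  qed
  moreover have "mor f = mor (normal_form ?s A \<tau>)"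
  proof (rule extensionalityI[OF ext'])
    show "mor (normal_form ?s A \<tau>) \<in> extensional (arrows ?s)" by (simp add: normal_form_def)
    fix w assume "w \<in> arrows ?s"
    then obtain u v where w: "w = (u, v)" and uv: "u \<subseteq> v" "v \<subseteq> ?s" "u \<subseteq> ?s" by (auto simp: arrows_def)
    show "mor f w = mor (normal_form ?s A \<tau>) w"
      unfolding w mor_nf[OF uv(1,2)] obu[OF uv(3), symmetric]
    proof (rule extensionalityI[of _ "ob f u"])
      show "mor f (u, v) \<in> extensional (ob f u)" using mor(1)[OF uv(1,2)] by (simp add: PiE_def)
      fix x assume x: "x \<in> ob f u"
      have "mor f (u, v) x \<in> ob f v" using mor(1)[OF uv(1,2)] x by auto
      then have "\<rho> v (mor f (u, v) x) = \<rho> u x"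
        using \<rho>(2)[OF uv(2)] \<rho>(2)[OF uv(3) x] comp[OF uv(1,2) order_refl x] by simp
      then have m: "mor f (u, v) x = finv (\<rho> v) (\<rho> u x)"
        by (metis finv_simps(2)[OF \<rho>(1)[OF uv(2)]])
      have "mor f (u, v) x = \<tau> v (finv (\<tau> u) x)"
        by (subst finv\<tau>[OF uv(3)]) (simp only: m \<tau>_def)
      then show "mor f (u, v) x = restrict (\<lambda>x. \<tau> v (finv (\<tau> u) x)) (ob f u) x" using x by simp
    qed simp
  qed
  ultimately have "f = normal_form ?s A \<tau>" by (intro simplex.equality) (simp_all add: normal_form_def)
  then show thesis using that g by blast
qed

end

section \<open>Edges and triangles\<close>

lemma sorted_list_pair: "(i::nat) < j \<Longrightarrow> sorted_list_of_set {i, j} = [i, j]"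
  by (rule sorted_list_of_set_unique[THEN iffD1]) auto

lemma sorted_list_triple: "(i::nat) < j \<Longrightarrow> j < k \<Longrightarrow> sorted_list_of_set {i, j, k} = [i, j, k]"
  by (rule sorted_list_of_set_unique[THEN iffD1]) auto

text \<open>
  Finite vertex sets are listed in increasing order, as the face maps require.
\<close>

lemma card_2_less: assumes "card (s :: nat set) = 2" obtains i j where "i < j" "s = {i, j}"
proof -
  obtain x y where "s = {x, y}" "x \<noteq> y" using assms by (auto simp: card_2_iff)
  then show thesis using that[of x y] that[of y x] by (cases "x < y") auto
qed

lemma card_3_less: assumes "card (s :: nat set) = 3" obtains i j k where "i < j" "j < k" "s = {i, j, k}"
proof -
  have fin: "finite s" using assms by (intro card_ge_0_finite) simp
  let ?l = "sorted_list_of_set s"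
  have "\<exists>x y z. l = [x, y, z]" if "length l = 3" for l :: "nat list"
    using that by (auto simp: length_Suc_conv numeral_3_eq_3)
  moreover have "length ?l = 3" using assms by simp
  ultimately obtain x y z where l: "?l = [x, y, z]" by blast
  have "sorted_wrt (<) ?l" by simp
  moreover have "set ?l = s" using fin by simp
  ultimately show thesis using that[of x y z] l by auto
qed

context strong_type
begin

text \<open>The sets which occur as the vertex objects of simplices.\<close>

definition V :: "'a set set" where "V = (\<lambda>b. range b) ` R"

text \<open>A chosen enumeration of a vertex object by a realization of \<open>p\<close>.\<close>

definition enumeration :: "'a set \<Rightarrow> 'i \<Rightarrow> 'a" where "enumeration S = (SOME b. b \<in> R \<and> range b = S)"

text \<open>A chosen automorphism taking the realization \<open>x\<close> to the realization \<open>y\<close>.\<close>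

definition aut :: "('i \<Rightarrow> 'a) \<Rightarrow> ('i \<Rightarrow> 'a) \<Rightarrow> 'a \<Rightarrow> 'a" where
  "aut x y = (SOME \<sigma>. \<sigma> \<in> Auts M B \<and> \<sigma> \<circ> x = y)"

lemma enumeration: assumes "S \<in> V" shows "enumeration S \<in> R" "range (enumeration S) = S"
proof -
  have "\<exists>b. b \<in> R \<and> range b = S" using assms by (auto simp: V_def)
  from someI_ex[OF this] show "enumeration S \<in> R" "range (enumeration S) = S" by (simp_all add: enumeration_def)
qed

lemma aut: assumes "x \<in> R" "y \<in> R" shows "aut x y \<in> Auts M B" "aut x y \<circ> x = y"
proof -
  have "\<exists>\<sigma>. \<sigma> \<in> Auts M B \<and> \<sigma> \<circ> x = y" using R_conj[OF assms] by blast
  from someI_ex[OF this] show "aut x y \<in> Auts M B" "aut x y \<circ> x = y" by (simp_all add: aut_def)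
qed

text \<open>The \<open>0\<close>-simplex with vertex \<open>i\<close> and object \<open>S\<close>.\<close>

definition vert :: "nat \<Rightarrow> 'a set \<Rightarrow> 'a simplex" where
  "vert i S = normal_form {i} (\<lambda>_. S) (\<lambda>_. id)"

text \<open>
  The \<open>1\<close>-simplex \<open>edge i S j T a c\<close> has the vertices \<open>(i, S)\<close> and \<open>(j, T)\<close>, which are embedded into
  its top object by sending the chosen enumerations of \<open>S\<close> and \<open>T\<close> to \<open>a\<close> and \<open>c\<close>.
\<close>

abbreviation edge_sets :: "nat \<Rightarrow> ('i \<Rightarrow> 'a) \<Rightarrow> ('i \<Rightarrow> 'a) \<Rightarrow> nat \<Rightarrow> 'a set" where
  "edge_sets i a c \<equiv> \<lambda>k. if k = i then range a else range c"

abbreviation edge_auts :: "nat \<Rightarrow> 'a set \<Rightarrow> nat \<Rightarrow> 'a set \<Rightarrow> ('i \<Rightarrow> 'a) \<Rightarrow> ('i \<Rightarrow> 'a) \<Rightarrow> nat set \<Rightarrow> 'a \<Rightarrow> 'a" where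
  "edge_auts i S j T a c \<equiv> \<lambda>u. if u = {i} then aut a (enumeration S) else if u = {j} then aut c (enumeration T) else id"

definition edge :: "nat \<Rightarrow> 'a set \<Rightarrow> nat \<Rightarrow> 'a set \<Rightarrow> ('i \<Rightarrow> 'a) \<Rightarrow> ('i \<Rightarrow> 'a) \<Rightarrow> 'a simplex" where
  "edge i S j T a c = normal_form {i, j} (edge_sets i a c) (edge_auts i S j T a c)"

text \<open>Independence over \<open>B\<close> of two realizations.\<close>

definition indR :: "('i \<Rightarrow> 'a) \<Rightarrow> ('i \<Rightarrow> 'a) \<Rightarrow> bool" where
  "indR a c \<longleftrightarrow> ind (range a) B (range c)"

lemma indR_sym: "indR a c \<Longrightarrow> indR c a"
  unfolding indR_def by (rule ind_sym[OF _ small_range small_B small_range])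

lemma indR_aut: "\<sigma> \<in> Auts M B \<Longrightarrow> indR a c \<Longrightarrow> indR (\<sigma> \<circ> a) (\<sigma> \<circ> c)"
  unfolding indR_def using ind_aut[OF _ small_range small_range] by (simp add: image_comp)

text \<open>
  In a simplex in normal form, \<open>label A \<tau> i\<close> is the object at the vertex \<open>i\<close>, and \<open>point A \<tau> i\<close> is the
  enumeration of \<open>A i\<close> corresponding to the chosen enumeration of this object.
\<close>

definition label :: "(nat \<Rightarrow> 'a set) \<Rightarrow> (nat set \<Rightarrow> 'a \<Rightarrow> 'a) \<Rightarrow> nat \<Rightarrow> 'a set" where
  "label A \<tau> i = \<tau> {i} ` A i"

definition point :: "(nat \<Rightarrow> 'a set) \<Rightarrow> (nat set \<Rightarrow> 'a \<Rightarrow> 'a) \<Rightarrow> nat \<Rightarrow> 'i \<Rightarrow> 'a" where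
  "point A \<tau> i = finv (\<tau> {i}) \<circ> enumeration (label A \<tau> i)"

lemma point:
  assumes g: "simplex_data s A \<tau>" and i: "i \<in> s"
  shows "label A \<tau> i \<in> V" "point A \<tau> i \<in> R" "range (point A \<tau> i) = A i" "\<tau> {i} \<circ> point A \<tau> i = enumeration (label A \<tau> i)"
proof -
  have \<tau>: "\<tau> {i} \<in> Auts M B" using simplex_dataD(4)[OF g] i by simp
  obtain b where b: "b \<in> R" "A i = range b" using simplex_dataD(2)[OF g i] by blast
  have l: "label A \<tau> i = range (\<tau> {i} \<circ> b)" unfolding label_def b(2) by (rule image_comp)
  show V: "label A \<tau> i \<in> V" unfolding l V_def by (rule imageI[OF R_aut[OF \<tau> b(1)]])
  show "point A \<tau> i \<in> R" unfolding point_def by (rule R_aut[OF finv_Auts[OF \<tau>] enumeration(1)[OF V]])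
  have "range (point A \<tau> i) = finv (\<tau> {i}) ` range (enumeration (label A \<tau> i))" unfolding point_def by (rule image_comp[symmetric])
  also have "\<dots> = A i" unfolding enumeration(2)[OF V] unfolding label_def by (rule finv_simps(6)[OF \<tau>])
  finally show "range (point A \<tau> i) = A i" .
  show "\<tau> {i} \<circ> point A \<tau> i = enumeration (label A \<tau> i)" unfolding point_def by (rule finv_comp_simps(1)[OF \<tau>])
qed

lemma nf_vert:
  assumes g: "simplex_data s A \<tau>" and i: "i \<in> s" shows "normal_form {i} A \<tau> = vert i (label A \<tau> i)"
  unfolding vert_def
proof (rule nf_cong)
  have g': "simplex_data {i} A \<tau>" using simplex_data_subset[OF g, of "{i}"] i by simp
  show \<tau>: "\<tau> {i} \<in> Auts M B" using simplex_dataD(4)[OF g'] by simp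
  show "\<tau> u \<in> Auts M B" if "u \<subseteq> {i}" for u by (rule simplex_dataD(4)[OF g' that])
  show "id \<in> Auts M B" by (rule id_Auts)
  show "label A \<tau> i = \<tau> {i} ` A k" if "k \<in> {i}" for k using that by (simp add: label_def)
  show "\<tau> u x = id (\<tau> {i} x)" if "u \<subseteq> {i}" "x \<in> acl_span A u" for u x
  proof (cases "u = {}")
    case True
    then have "x \<in> B" using that acl_span_empty by simp
    then show ?thesis using AutsD(4)[OF \<tau>] AutsD(4)[OF simplex_dataD(4)[OF g' that(1)]] by simp
  next
    case False
    then have "u = {i}" using that by auto
    then show ?thesis by simp
  qed
qed

lemma nf_edge:
  assumes g: "simplex_data s A \<tau>" and ij: "i \<in> s" "j \<in> s" "i < j"
  shows "normal_form {i, j} A \<tau> = edge i (label A \<tau> i) j (label A \<tau> j) (\<tau> {i, j} \<circ> point A \<tau> i) (\<tau> {i, j} \<circ> point A \<tau> j)"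
    and "indR (\<tau> {i, j} \<circ> point A \<tau> i) (\<tau> {i, j} \<circ> point A \<tau> j)"
proof -
  let ?s = "{i, j}" and ?\<sigma> = "\<tau> {i, j}"
  let ?a = "?\<sigma> \<circ> point A \<tau> i" and ?c = "?\<sigma> \<circ> point A \<tau> j"
  have g': "simplex_data ?s A \<tau>" using simplex_data_subset[OF g, of "{i, j}"] ij by simp
  have \<sigma>: "?\<sigma> \<in> Auts M B" using simplex_dataD(4)[OF g'] by simp
  note pi = point[OF g ij(1)] and pj = point[OF g ij(2)]
  have a: "?a \<in> R" "?c \<in> R" using R_aut[OF \<sigma>] pi(2) pj(2) by blast+
  note ai = aut[OF a(1) enumeration(1)[OF pi(1)]] and aj = aut[OF a(2) enumeration(1)[OF pj(1)]]
  have hi: "acl_span A {i} = A i" "acl_span A {j} = A j" using simplex_dataD(5)[OF g] ij by auto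
  show "normal_form {i, j} A \<tau> = edge i (label A \<tau> i) j (label A \<tau> j) ?a ?c"
    unfolding edge_def
  proof (rule nf_cong[OF \<sigma>])
    show "\<tau> u \<in> Auts M B" if "u \<subseteq> ?s" for u by (rule simplex_dataD(4)[OF g' that])
    show "(if u = {i} then aut ?a (enumeration (label A \<tau> i)) else if u = {j} then aut ?c (enumeration (label A \<tau> j)) else id) \<in> Auts M B" for u
      using ai(1) aj(1) id_Auts[of M B] by simp
    show "(if k = i then range ?a else range ?c) = ?\<sigma> ` A k" if "k \<in> ?s" for k
    proof -
      have "range ?a = ?\<sigma> ` A i" "range ?c = ?\<sigma> ` A j" by (simp_all only: pi(3)[symmetric] pj(3)[symmetric] image_comp)
      then show ?thesis using that by auto
    qed
    show "\<tau> u x = (if u = {i} then aut ?a (enumeration (label A \<tau> i)) else if u = {j} then aut ?c (enumeration (label A \<tau> j)) else id) (?\<sigma> x)"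
      if u: "u \<subseteq> ?s" and x: "x \<in> acl_span A u" for u x
    proof -
      consider "u = {}" | "u = {i}" | "u = {j}" | "u = ?s" using u by auto
      then show ?thesis
      proof cases
        case 1
        then have "x \<in> B" using x acl_span_empty by simp
        then show ?thesis using 1 AutsD(4)[OF \<sigma>] AutsD(4)[OF simplex_dataD(4)[OF g' u]] by simp
      next
        case 2
        then have "x \<in> range (point A \<tau> i)" unfolding pi(3) using x hi by simp
        then obtain t where t: "x = point A \<tau> i t" by (rule rangeE)
        have "aut ?a (enumeration (label A \<tau> i)) (?\<sigma> x) = enumeration (label A \<tau> i) t" using fun_cong[OF ai(2), of t] by (simp add: t)
        also have "\<dots> = \<tau> u x" using fun_cong[OF pi(4), of t] 2 by (simp add: t)
        finally show ?thesis using 2 by simp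
      next
        case 3
        then have "x \<in> range (point A \<tau> j)" unfolding pj(3) using x hi by simp
        then obtain t where t: "x = point A \<tau> j t" by (rule rangeE)
        have "aut ?c (enumeration (label A \<tau> j)) (?\<sigma> x) = enumeration (label A \<tau> j) t" using fun_cong[OF aj(2), of t] by (simp add: t)
        also have "\<dots> = \<tau> u x" using fun_cong[OF pj(4), of t] 3 by (simp add: t)
        finally show ?thesis using 3 ij(3) by simp
      next
        case 4
        then show ?thesis using ij(3) by auto
      qed
    qed
  qed
  have "ind (A i) B (\<Union>k\<in>?s - {i}. A k)" by (rule simplex_data_ind[OF g' order_refl]) simp
  moreover have "?s - {i} = {j}" using ij by auto
  ultimately have "indR (point A \<tau> i) (point A \<tau> j)" using pi(3) pj(3) by (simp add: indR_def)
  then show "indR ?a ?c" by (rule indR_aut[OF \<sigma>])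
qed

lemma simplices_1:
  assumes "f \<in> simplices M ind B p 1"
  obtains i S j T a c where "i < j" "S \<in> V" "T \<in> V" "a \<in> R" "c \<in> R" "indR a c" "f = edge i S j T a c"
proof -
  obtain A \<tau> where g: "simplex_data (supp f) A \<tau>" and f: "f = normal_form (supp f) A \<tau>" using simplex_normal_form[OF assms] by blast
  have "card (supp f) = 2" using assms by (simp add: simplices_def)
  then obtain i j where ij: "i < j" "supp f = {i, j}" by (rule card_2_less)
  have m: "i \<in> supp f" "j \<in> supp f" using ij(2) by auto
  have \<sigma>: "\<tau> {i, j} \<in> Auts M B" using simplex_dataD(4)[OF g] ij(2) by simp
  have "f = edge i (label A \<tau> i) j (label A \<tau> j) (\<tau> {i, j} \<circ> point A \<tau> i) (\<tau> {i, j} \<circ> point A \<tau> j)"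
    using f nf_edge(1)[OF g m ij(1)] ij(2) by simp
  then show thesis
    using that[OF ij(1) point(1)[OF g m(1)] point(1)[OF g m(2)] R_aut[OF \<sigma> point(2)[OF g m(1)]] R_aut[OF \<sigma> point(2)[OF g m(2)]]
        nf_edge(2)[OF g m ij(1)]] by blast
qed

lemma boundary_1_nf:
  assumes g: "simplex_data {i, j} A \<tau>" and ij: "i < j"
  shows "boundary 1 (frag_of (normal_form {i, j} A \<tau>)) = frag_of (vert j (label A \<tau> j)) - frag_of (vert i (label A \<tau> i))"
proof -
  have "{i, j} - {i} = {j}" "{i, j} - {j} = {i}" using ij by auto
  then have "face 0 (normal_form {i, j} A \<tau>) = normal_form {j} A \<tau>" "face 1 (normal_form {i, j} A \<tau>) = normal_form {i} A \<tau>"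
    by (simp_all add: face_nf sorted_list_pair[OF ij])
  moreover have "{..1::nat} = {0, 1}" by auto
  ultimately show ?thesis using nf_vert[OF g, of i] nf_vert[OF g, of j]
    by (simp add: boundary_def)
qed

lemma boundary_2_nf:
  assumes ijk: "i < j" "j < k"
  shows "boundary 2 (frag_of (normal_form {i, j, k} A \<tau>)) =
    frag_of (normal_form {j, k} A \<tau>) - frag_of (normal_form {i, k} A \<tau>) + frag_of (normal_form {i, j} A \<tau>)"
proof -
  have "{i, j, k} - {i} = {j, k}" "{i, j, k} - {j} = {i, k}" "{i, j, k} - {k} = {i, j}" using ijk by auto
  then have "face 0 (normal_form {i, j, k} A \<tau>) = normal_form {j, k} A \<tau>" "face 1 (normal_form {i, j, k} A \<tau>) = normal_form {i, k} A \<tau>"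
    "face 2 (normal_form {i, j, k} A \<tau>) = normal_form {i, j} A \<tau>"
    by (simp_all add: face_nf sorted_list_triple[OF ijk])
  moreover have "{..2::nat} = {0, 1, 2}" by auto
  ultimately show ?thesis by (simp add: boundary_def)
qed

text \<open>The data defining an edge, and what they determine.\<close>

lemma edge_data:
  assumes ij: "i < j" and S: "S \<in> V" "T \<in> V" and a: "a \<in> R" "c \<in> R" "indR a c"
  shows "simplex_data {i, j} (edge_sets i a c) (edge_auts i S j T a c)"
    and "label (edge_sets i a c) (edge_auts i S j T a c) i = S"
    and "label (edge_sets i a c) (edge_auts i S j T a c) j = T"
proof -
  let ?A = "edge_sets i a c" and ?\<tau> = "edge_auts i S j T a c"
  have ai: "aut a (enumeration S) \<in> Auts M B" "aut a (enumeration S) \<circ> a = enumeration S" "aut c (enumeration T) \<in> Auts M B" "aut c (enumeration T) \<circ> c = enumeration T"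
    using aut a enumeration(1) S by blast+
  have "{i, j} - {i} = {j}" "{i, j} - {j} = {i}" using ij by auto
  then have "indep_fam {i, j} ?A"
    unfolding indep_fam_def using ij a(3) indR_sym[OF a(3)] by (auto simp: indR_def)
  then show "simplex_data {i, j} ?A ?\<tau>"
    unfolding simplex_data_def using a ai id_Auts[of M B] by auto
  show "label ?A ?\<tau> i = S" using enumeration(2)[OF S(1)] ai(2) by (simp add: label_def image_comp)
  show "label ?A ?\<tau> j = T" using enumeration(2)[OF S(2)] ai(4) ij by (simp add: label_def image_comp)
qed

lemma edge_simplex:
  assumes "i < j" "S \<in> V" "T \<in> V" "a \<in> R" "c \<in> R" "indR a c"
  shows "edge i S j T a c \<in> simplices M ind B p 1"
  unfolding edge_def by (rule nf_simplex[OF edge_data(1)[OF assms]]) (use assms in simp)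

lemma boundary_edge:
  assumes "i < j" "S \<in> V" "T \<in> V" "a \<in> R" "c \<in> R" "indR a c"
  shows "boundary 1 (frag_of (edge i S j T a c)) = frag_of (vert j T) - frag_of (vert i S)"
  unfolding edge_def boundary_1_nf[OF edge_data(1)[OF assms] assms(1)] edge_data(2,3)[OF assms] ..

text \<open>The end points of an edge, as tuples in its top object.\<close>

definition ends :: "'a simplex \<Rightarrow> ('i \<Rightarrow> 'a) \<times> ('i \<Rightarrow> 'a)" where
  "ends f = (mor f ({Min (supp f)}, supp f) \<circ> enumeration (ob f {Min (supp f)}),
     mor f ({Max (supp f)}, supp f) \<circ> enumeration (ob f {Max (supp f)}))"

lemma ends_edge:
  assumes e: "i < j" "S \<in> V" "T \<in> V" "a \<in> R" "c \<in> R" "indR a c"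
  shows "ends (edge i S j T a c) = (a, c)"
proof -
  let ?A = "edge_sets i a c" and ?\<tau> = "edge_auts i S j T a c"
  let ?f = "normal_form {i, j} ?A ?\<tau>"
  note g = edge_data[OF e]
  have ai: "aut a (enumeration S) \<in> Auts M B" "aut a (enumeration S) \<circ> a = enumeration S" "aut c (enumeration T) \<in> Auts M B" "aut c (enumeration T) \<circ> c = enumeration T"
    using aut e enumeration(1) by blast+
  have ss: "{i} \<subseteq> {i, j}" "{j} \<subseteq> {i, j}" by auto
  have top: "{i, j} \<noteq> {i}" "{i, j} \<noteq> {j}" using e(1) by auto
  have "acl_span ?A {i} = ?A i" "acl_span ?A {j} = ?A j" using simplex_dataD(5)[OF g(1)] by auto
  then have ob: "ob ?f {i} = S" "ob ?f {j} = T"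
    unfolding ob_nf[OF ss(1)] ob_nf[OF ss(2)] using g(2,3) by (simp_all only: label_def)
  have "(mor ?f ({i}, {i, j}) \<circ> enumeration S) t = a t" for t
  proof -
    have "enumeration S t \<in> ob ?f {i}" unfolding ob using enumeration(2)[OF e(2)] by blast
    then have "(mor ?f ({i}, {i, j}) \<circ> enumeration S) t = finv (aut a (enumeration S)) (enumeration S t)"
      unfolding mor_nf[OF ss(1) order_refl] ob_nf[OF ss(1)] using top by simp
    then show ?thesis using finv_simps(2)[OF ai(1), of "a t"] fun_cong[OF ai(2), of t] by simp
  qed
  moreover have "(mor ?f ({j}, {i, j}) \<circ> enumeration T) t = c t" for t
  proof -
    have "enumeration T t \<in> ob ?f {j}" unfolding ob using enumeration(2)[OF e(3)] by blast
    then have "(mor ?f ({j}, {i, j}) \<circ> enumeration T) t = finv (aut c (enumeration T)) (enumeration T t)"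
      unfolding mor_nf[OF ss(2) order_refl] ob_nf[OF ss(2)] using top e(1) by simp
    then show ?thesis using finv_simps(2)[OF ai(3), of "c t"] fun_cong[OF ai(4), of t] by simp
  qed
  moreover have "Min {i, j} = i" "Max {i, j} = j" using e(1) by auto
  ultimately show ?thesis unfolding edge_def ends_def supp_nf
    by (simp only: ob) (simp add: fun_eq_iff)
qed

text \<open>The group of \<open>1\<close>-dimensional boundaries.\<close>

definition boundaries :: "('a simplex \<Rightarrow>\<^sub>0 int) set" where
  "boundaries = boundary 2 ` carrier (chain_group M ind B p 2)"

lemma boundary_add: "boundary n (x + y) = boundary n x + boundary n y"
  by (simp add: boundary_def frag_extend_add)

lemma boundary_minus: "boundary n (- x) = - boundary n x"
  by (simp add: boundary_def frag_extend_minus)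

lemma boundaries_0: "0 \<in> boundaries"
  unfolding boundaries_def by (intro image_eqI[of _ _ 0]) (simp_all add: boundary_def chain_group_def)

lemma boundaries_add: assumes "x \<in> boundaries" "y \<in> boundaries" shows "x + y \<in> boundaries"
proof -
  obtain u v where uv: "x = boundary 2 u" "y = boundary 2 v" "Poly_Mapping.keys u \<subseteq> simplices M ind B p 2"
    "Poly_Mapping.keys v \<subseteq> simplices M ind B p 2"
    using assms by (auto simp: boundaries_def chain_group_def)
  have "Poly_Mapping.keys (u + v) \<subseteq> simplices M ind B p 2"
    using uv(3,4) Poly_Mapping.keys_add[of u v] by blast
  then show ?thesis unfolding boundaries_def uv(1,2)
    by (intro image_eqI[of _ _ "u + v"]) (simp_all add: boundary_add chain_group_def)
qed

lemma boundaries_uminus: assumes "x \<in> boundaries" shows "- x \<in> boundaries"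
proof -
  obtain u where u: "x = boundary 2 u" "Poly_Mapping.keys u \<subseteq> simplices M ind B p 2"
    using assms by (auto simp: boundaries_def chain_group_def)
  then show ?thesis unfolding boundaries_def u(1)
    by (intro image_eqI[of _ _ "- u"]) (simp_all add: boundary_minus chain_group_def)
qed

lemma boundaries_diff: "x \<in> boundaries \<Longrightarrow> y \<in> boundaries \<Longrightarrow> x - y \<in> boundaries"
  using boundaries_add[of x "- y"] boundaries_uminus[of y] by simp

text \<open>
  The triangle relation \<open>[a, b] + [b, c] = [a, c]\<close>. Conjugating the first edge by \<open>\<sigma>\<close> amounts to
  taking \<open>\<sigma>\<close> for the automorphism at the face \<open>{i, j}\<close> of the triangle.
\<close>

lemma triangle:
  assumes ijk: "i < j" "j < k" and V: "S \<in> V" "T \<in> V" "U \<in> V" and abc: "a \<in> R" "b \<in> R" "c \<in> R"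
    and ab: "indR a b" and c: "ind (range c) B (range a \<union> range b)" and \<sigma>: "\<sigma> \<in> Auts M B"
  shows "frag_of (edge i S j T (\<sigma> \<circ> a) (\<sigma> \<circ> b)) + frag_of (edge j T k U b c) - frag_of (edge i S k U a c) \<in> boundaries"
    and "indR a c" "indR b c"
proof -
  define A where "A n = (if n = i then range a else if n = j then range b else range c)" for n
  define \<tau> where "\<tau> u = (if u = {i} then aut a (enumeration S) else if u = {j} then aut b (enumeration T)
    else if u = {k} then aut c (enumeration U) else if u = {i, j} then \<sigma> else id)" for u
  have A: "A i = range a" "A j = range b" "A k = range c" using ijk by (auto simp: A_def)
  have ne: "{i, j} \<noteq> {i}" "{i, j} \<noteq> {j}" "{i, j} \<noteq> {k}" "{j, k} \<noteq> {i}" "{j, k} \<noteq> {j}" "{j, k} \<noteq> {k}"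
    "{i, k} \<noteq> {i}" "{i, k} \<noteq> {j}" "{i, k} \<noteq> {k}" "{j, k} \<noteq> {i, j}" "{i, k} \<noteq> {i, j}"
    using ijk by auto
  have \<tau>: "\<tau> {i} = aut a (enumeration S)" "\<tau> {j} = aut b (enumeration T)" "\<tau> {k} = aut c (enumeration U)" "\<tau> {i, j} = \<sigma>"
    "\<tau> {j, k} = id" "\<tau> {i, k} = id"
    using ijk ne by (simp_all add: \<tau>_def)
  have au: "aut a (enumeration S) \<in> Auts M B" "aut a (enumeration S) \<circ> a = enumeration S" "aut b (enumeration T) \<in> Auts M B" "aut b (enumeration T) \<circ> b = enumeration T"
    "aut c (enumeration U) \<in> Auts M B" "aut c (enumeration U) \<circ> c = enumeration U"
    using aut abc enumeration(1) V by blast+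
  note sr = small_range and sU = small_Un[OF monster small_range small_range]
  have a': "ind (range a) B (range b \<union> range c)"
    by (rule ind_shift[OF c _ sr sr sr]) (use ab in \<open>simp add: indR_def\<close>)
  have b': "ind (range b) B (range a \<union> range c)"
    by (rule ind_shift[OF _ _ sr sr sr]) (use c indR_sym[OF ab] in \<open>simp_all add: indR_def Un_commute\<close>)
  show "indR a c" unfolding indR_def by (rule ind_mono[OF a' _ _ sr small_B sU]) auto
  show "indR b c" unfolding indR_def by (rule ind_mono[OF b' _ _ sr small_B sU]) auto
  have "{i, j, k} - {i} = {j, k}" "{i, j, k} - {j} = {i, k}" "{i, j, k} - {k} = {i, j}" using ijk by auto
  then have "indep_fam {i, j, k} A"
    unfolding indep_fam_def using a' b' c by (auto simp: A)
  moreover have "\<tau> u \<in> Auts M B" for u unfolding \<tau>_def using au(1,3,5) \<sigma> id_Auts[of M B] by simp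
  ultimately have g: "simplex_data {i, j, k} A \<tau>" unfolding simplex_data_def using A abc by auto
  have l: "label A \<tau> i = S" "label A \<tau> j = T" "label A \<tau> k = U"
    unfolding label_def A \<tau> image_comp au using V enumeration(2) by simp_all
  have point: "point A \<tau> i = a" "point A \<tau> j = b" "point A \<tau> k = c"
    unfolding point_def l \<tau> using finv_comp_simps(2)[OF au(1), of a] finv_comp_simps(2)[OF au(3), of b]
      finv_comp_simps(2)[OF au(5), of c] unfolding au(2,4,6) by simp_all
  have m: "i \<in> {i, j, k}" "j \<in> {i, j, k}" "k \<in> {i, j, k}" by auto
  have ik: "i < k" using ijk by simp
  have "boundary 2 (frag_of (normal_form {i, j, k} A \<tau>)) \<in> boundaries"
    unfolding boundaries_def using nf_simplex[OF g, of 2] ijk by (intro imageI) (simp add: chain_group_def)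
  then have "frag_of (edge j T k U b c) - frag_of (edge i S k U a c) + frag_of (edge i S j T (\<sigma> \<circ> a) (\<sigma> \<circ> b)) \<in> boundaries"
    unfolding boundary_2_nf[OF ijk] nf_edge(1)[OF g m(1,2) ijk(1)] nf_edge(1)[OF g m(2,3) ijk(2)]
      nf_edge(1)[OF g m(1,3) ik] l point \<tau> id_comp .
  then show "frag_of (edge i S j T (\<sigma> \<circ> a) (\<sigma> \<circ> b)) + frag_of (edge j T k U b c) - frag_of (edge i S k U a c) \<in> boundaries"
    by (simp add: algebra_simps)
qed

end

section \<open>Lascar strong types have trivial first homology\<close>

context strong_type
begin

abbreviation edge_chain :: "nat \<Rightarrow> 'a set \<Rightarrow> nat \<Rightarrow> 'a set \<Rightarrow> ('i \<Rightarrow> 'a) \<Rightarrow> ('i \<Rightarrow> 'a) \<Rightarrow> 'a simplex \<Rightarrow>\<^sub>0 int" where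
  "edge_chain i S j T a c \<equiv> frag_of (edge i S j T a c)"

text \<open>Congruence of \<open>1\<close>-chains modulo boundaries.\<close>

definition homologous :: "('a simplex \<Rightarrow>\<^sub>0 int) \<Rightarrow> ('a simplex \<Rightarrow>\<^sub>0 int) \<Rightarrow> bool" (infix "\<simeq>" 50) where
  "x \<simeq> y \<longleftrightarrow> x - y \<in> boundaries"

lemma homologous_refl: "x \<simeq> x" by (simp add: homologous_def boundaries_0)

lemma homologous_sym: "x \<simeq> y \<Longrightarrow> y \<simeq> x"
  unfolding homologous_def using boundaries_uminus[of "x - y"] by simp

lemma homologous_add: "x \<simeq> y \<Longrightarrow> x' \<simeq> y' \<Longrightarrow> x + x' \<simeq> y + y'"
  unfolding homologous_def using boundaries_add[of "x - y" "x' - y'"] by (simp add: algebra_simps)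

lemma homologous_diff: "x \<simeq> y \<Longrightarrow> x' \<simeq> y' \<Longrightarrow> x - x' \<simeq> y - y'"
  unfolding homologous_def using boundaries_diff[of "x - y" "x' - y'"] by (simp add: algebra_simps)

lemma homologous_trans [trans]: "x \<simeq> y \<Longrightarrow> y \<simeq> z \<Longrightarrow> x \<simeq> z"
  unfolding homologous_def using boundaries_add[of "x - y" "y - z"] by simp

lemma triangle_homologous:
  assumes "i < j" "j < k" "S \<in> V" "T \<in> V" "U \<in> V" "a \<in> R" "b \<in> R" "c \<in> R"
    and "indR a b" "ind (range c) B (range a \<union> range b)"
  shows "edge_chain i S j T a b \<simeq> edge_chain i S k U a c - edge_chain j T k U b c"
  using triangle(1)[OF assms id_Auts] unfolding homologous_def by (simp add: algebra_simps)

lemma exists_R_indep: "finite F \<Longrightarrow> \<exists>c\<in>R. ind (range c) B (\<Union>b\<in>F. range (b :: 'i \<Rightarrow> 'a))"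
  by (rule exists_indep[OF small_UN[OF monster _ small_range]])

lemma ind_range_subset:
  assumes "ind (range (c :: 'i \<Rightarrow> 'a)) B (\<Union>b\<in>F. range (b :: 'i \<Rightarrow> 'a))" "finite F" "Y \<subseteq> (\<Union>b\<in>F. range b)"
  shows "ind (range c) B Y"
  by (rule ind_mono[OF assms(1) order_refl assms(3) small_range small_B small_UN[OF monster assms(2) small_range]])

lemma indR_member:
  assumes "ind (range c) B (\<Union>b\<in>F. range (b :: 'i \<Rightarrow> 'a))" "finite F" "b \<in> F"
  shows "indR b c"
  by (rule indR_sym) (unfold indR_def, rule ind_range_subset[OF assms(1,2)], use assms(3) in blast)

text \<open>The class of an edge only depends on the type of its end points.\<close>

lemma edge_aut:
  assumes e: "i < j" "S \<in> V" "T \<in> V" "a \<in> R" "b \<in> R" "indR a b" and \<sigma>: "\<sigma> \<in> Auts M B"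
  shows "edge_chain i S j T (\<sigma> \<circ> a) (\<sigma> \<circ> b) \<simeq> edge_chain i S j T a b"
proof -
  obtain c where c: "c \<in> R" "ind (range c) B (range a \<union> range b)"
    using exists_R_indep[of "{a, b}"] by auto
  note t = triangle(1)[OF e(1) lessI e(2,3,3,4,5) c(1) e(6) c(2)]
  show ?thesis using boundaries_diff[OF t[OF \<sigma>] t[OF id_Auts]] unfolding homologous_def by simp
qed

text \<open>
  For \<open>c\<close> independent from \<open>a a'\<close> the difference of the edges \<open>[a, c]\<close> and \<open>[a', c]\<close> does not depend on
  \<open>c\<close> modulo boundaries.
\<close>

definition edge_diff :: "nat \<Rightarrow> 'a set \<Rightarrow> nat \<Rightarrow> 'a set \<Rightarrow> ('i \<Rightarrow> 'a) \<Rightarrow> ('i \<Rightarrow> 'a) \<Rightarrow> 'a simplex \<Rightarrow>\<^sub>0 int" where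
  "edge_diff i S j T a a' = (let c = SOME c. c \<in> R \<and> ind (range c) B (range a \<union> range a')
     in edge_chain i S j T a c - edge_chain i S j T a' c)"

text \<open>The edges from \<open>c\<close> to \<open>d\<close> in the two triangles on \<open>a, c, d\<close> and \<open>a', c, d\<close> cancel.\<close>

lemma edge_diff_shift:
  assumes e: "i < j" "j < k" "S \<in> V" "T \<in> V" "U \<in> V" and R: "a \<in> R" "a' \<in> R" "c \<in> R" "d \<in> R"
    and c: "indR a c" "indR a' c"
    and d: "ind (range d) B (range a \<union> range c)" "ind (range d) B (range a' \<union> range c)"
  shows "edge_chain i S j T a c - edge_chain i S j T a' c \<simeq> edge_chain i S k U a d - edge_chain i S k U a' d"
  using homologous_diff[OF triangle_homologous[OF e R(1,3,4) c(1) d(1)] triangle_homologous[OF e R(2,3,4) c(2) d(2)]]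
  by simp

lemma edge_diff_eq:
  assumes e: "i < j" "S \<in> V" "T \<in> V" and R: "a \<in> R" "a' \<in> R" "c \<in> R"
    and c: "ind (range c) B (range a \<union> range a')"
  shows "edge_chain i S j T a c - edge_chain i S j T a' c \<simeq> edge_diff i S j T a a'"
proof -
  define c' where "c' = (SOME c. c \<in> R \<and> ind (range c) B (range a \<union> range a'))"
  have "\<exists>c. c \<in> R \<and> ind (range c) B (range a \<union> range a')" using R(3) c by blast
  from someI_ex[OF this] have c': "c' \<in> R" "ind (range c') B (range a \<union> range a')" by (simp_all add: c'_def)
  have i: "indR a x \<and> indR a' x" if "ind (range x) B (range a \<union> range a')" for x
    using indR_member[of x "{a, a'}"] that by simp
  obtain d where d: "d \<in> R" "ind (range d) B (\<Union>b\<in>{a, a', c, c'}. range b)"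
    using exists_R_indep[of "{a, a', c, c'}"] by auto
  have ds: "ind (range d) B (range x \<union> range y)" if "x \<in> {a, a', c, c'}" "y \<in> {a, a', c, c'}" for x y
    by (rule ind_range_subset[OF d(2)]) (use that in auto)
  have s: "edge_chain i S j T a x - edge_chain i S j T a' x \<simeq> edge_chain i S (Suc j) T a d - edge_chain i S (Suc j) T a' d"
    if "x \<in> R" "ind (range x) B (range a \<union> range a')" "x \<in> {c, c'}" for x
    using i[OF that(2)] that(1,3) by (intro edge_diff_shift e R d(1) lessI ds) auto
  have "edge_chain i S j T a c - edge_chain i S j T a' c \<simeq> edge_chain i S (Suc j) T a d - edge_chain i S (Suc j) T a' d"
    using s[OF R(3) c] by simp
  also have "\<dots> \<simeq> edge_chain i S j T a c' - edge_chain i S j T a' c'" using homologous_sym[OF s[OF c']] by simp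
  finally show ?thesis unfolding edge_diff_def Let_def c'_def .
qed

lemma edge_diff_add:
  assumes e: "i < j" "S \<in> V" "T \<in> V" and R: "a \<in> R" "b \<in> R" "c \<in> R"
  shows "edge_diff i S j T a b + edge_diff i S j T b c \<simeq> edge_diff i S j T a c"
proof -
  obtain d where d: "d \<in> R" "ind (range d) B (\<Union>b\<in>{a, b, c}. range b)"
    using exists_R_indep[of "{a, b, c}"] by auto
  have ds: "ind (range d) B (range x \<union> range y)" if "x \<in> {a, b, c}" "y \<in> {a, b, c}" for x y
    by (rule ind_range_subset[OF d(2)]) (use that in auto)
  have "edge_diff i S j T a b + edge_diff i S j T b c \<simeq>
      (edge_chain i S j T a d - edge_chain i S j T b d) + (edge_chain i S j T b d - edge_chain i S j T c d)"
    by (intro homologous_add homologous_sym[OF edge_diff_eq] e R d(1) ds) auto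
  also have "(edge_chain i S j T a d - edge_chain i S j T b d) + (edge_chain i S j T b d - edge_chain i S j T c d) \<simeq> edge_diff i S j T a c"
    using edge_diff_eq[OF e R(1,3) d(1) ds] by simp
  finally show ?thesis .
qed

lemma edge_diff_aut:
  assumes e: "i < j" "S \<in> V" "T \<in> V" and R: "a \<in> R" "b \<in> R" and \<sigma>: "\<sigma> \<in> Auts M B"
  shows "edge_diff i S j T (\<sigma> \<circ> a) (\<sigma> \<circ> b) \<simeq> edge_diff i S j T a b"
proof -
  obtain c where c: "c \<in> R" "ind (range c) B (range a \<union> range b)"
    using exists_R_indep[of "{a, b}"] by auto
  have i: "indR a c" "indR b c" using indR_member[of c "{a, b}"] c(2) by simp_all
  have "ind (range (\<sigma> \<circ> c)) B (range (\<sigma> \<circ> a) \<union> range (\<sigma> \<circ> b))"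
    using ind_aut[OF \<sigma> small_range small_Un[OF monster small_range small_range] c(2)]
    by (simp only: image_Un image_comp)
  from homologous_sym[OF edge_diff_eq[OF e R_aut[OF \<sigma> R(1)] R_aut[OF \<sigma> R(2)] R_aut[OF \<sigma> c(1)] this]]
  have "edge_diff i S j T (\<sigma> \<circ> a) (\<sigma> \<circ> b) \<simeq> edge_chain i S j T (\<sigma> \<circ> a) (\<sigma> \<circ> c) - edge_chain i S j T (\<sigma> \<circ> b) (\<sigma> \<circ> c)" .
  also have "\<dots> \<simeq> edge_chain i S j T a c - edge_chain i S j T b c"
    by (intro homologous_diff edge_aut e R c(1) i \<sigma>)
  also have "\<dots> \<simeq> edge_diff i S j T a b" by (rule edge_diff_eq[OF e R c])
  finally show ?thesis .
qed

lemma edge_diff_refl: "edge_diff i S j T a a \<simeq> 0"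
  by (simp add: edge_diff_def homologous_refl)

text \<open>
  Modulo boundaries, \<open>\<sigma> \<mapsto> edge_diff a (\<sigma> \<circ> a)\<close> does not depend on \<open>a\<close>; so it vanishes if \<open>\<sigma>\<close> fixes a
  realization \<open>c\<close>.
\<close>

lemma edge_diff_stabilizer:
  assumes e: "i < j" "S \<in> V" "T \<in> V" and R: "a \<in> R" "c \<in> R" and \<sigma>: "\<sigma> \<in> Auts M B" "\<sigma> \<circ> c = c"
  shows "edge_diff i S j T a (\<sigma> \<circ> a) \<simeq> 0"
proof -
  have "edge_diff i S j T a (\<sigma> \<circ> a) \<simeq> edge_diff i S j T a c + edge_diff i S j T c (\<sigma> \<circ> a)"
    by (rule homologous_sym[OF edge_diff_add[OF e R R_aut[OF \<sigma>(1) R(1)]]])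
  also have "\<dots> \<simeq> edge_diff i S j T a c + edge_diff i S j T c a"
    using edge_diff_aut[OF e R(2,1) \<sigma>(1)] unfolding \<sigma>(2) by (intro homologous_add homologous_refl)
  also have "\<dots> \<simeq> edge_diff i S j T a a" by (rule edge_diff_add[OF e R R(1)])
  also have "\<dots> \<simeq> 0" by (rule edge_diff_refl)
  finally show ?thesis .
qed

lemma edge_diff_model:
  assumes e: "i < j" "S \<in> V" "T \<in> V" and R: "a \<in> R"
    and \<sigma>: "\<sigma> \<in> Auts M B" and N: "elem_submodel M N" "B \<subseteq> N" "small M N" "\<forall>x\<in>N. \<sigma> x = x"
  shows "edge_diff i S j T a (\<sigma> \<circ> a) \<simeq> 0"
proof -
  have "\<sigma> \<in> Auts M N" using \<sigma> N(4) by (simp add: Auts_def)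
  from fixes_conjugate[OF monster N(1,3) small_I this, of a] obtain \<rho> \<tau> where
    *: "\<rho> \<in> Auts M N" "\<tau> \<in> Auts M N" "\<tau> \<circ> (\<rho> \<circ> a) = \<rho> \<circ> a" "\<tau> \<circ> a = \<sigma> \<circ> a" by blast
  have "\<rho> \<circ> a \<in> R" by (rule R_aut[OF Auts_mono[OF *(1) N(2)] R])
  from edge_diff_stabilizer[OF e R this Auts_mono[OF *(2) N(2)] *(3)] show ?thesis unfolding *(4) .
qed

lemma edge_diff_Autf:
  assumes e: "i < j" "S \<in> V" "T \<in> V" and \<sigma>: "\<sigma> \<in> Autf M B"
  shows "\<forall>a\<in>R. edge_diff i S j T a (\<sigma> \<circ> a) \<simeq> 0"
  using \<sigma> unfolding Autf_def
proof (induction rule: generate.induct)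
  case one
  show ?case using edge_diff_refl by (simp add: one_Aut_group)
next
  case (incl h)
  then show ?case using edge_diff_model[OF e] by blast
next
  case (inv h)
  then obtain N where h: "h \<in> Auts M B" and N: "elem_submodel M N" "B \<subseteq> N" "small M N" "\<forall>x\<in>N. h x = x" by blast
  have f: "\<forall>x\<in>N. finv h x = x" using N(4) finv_simps(2)[OF h] by metis
  show ?case unfolding inv_Aut_group[OF st h]
    by (rule ballI) (rule edge_diff_model[OF e _ finv_Auts[OF h] N(1-3) f])
next
  case (eng h1 h2)
  have A: "h1 \<in> Auts M B" "h2 \<in> Auts M B"
    using eng(1,2) Autf_props(1)[OF st, of B] unfolding Autf_def by blast+
  show ?case
  proof
    fix a assume a: "a \<in> R"
    have b: "h2 \<circ> a \<in> R" by (rule R_aut[OF A(2) a])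
    have "edge_diff i S j T a (h1 \<circ> (h2 \<circ> a)) \<simeq> edge_diff i S j T a (h2 \<circ> a) + edge_diff i S j T (h2 \<circ> a) (h1 \<circ> (h2 \<circ> a))"
      by (rule homologous_sym[OF edge_diff_add[OF e a b R_aut[OF A(1) b]]])
    also have "\<dots> \<simeq> 0 + 0" by (rule homologous_add[OF bspec[OF eng(4) a] bspec[OF eng(3) b]])
    finally show "edge_diff i S j T a (h1 \<otimes>\<^bsub>Aut_group M B\<^esub> h2 \<circ> a) \<simeq> 0"
      by (simp add: mult_Aut_group[OF A] comp_assoc)
  qed
qed

lemma edge_diff_lascar:
  assumes L: "lascar_strong_type M B p" and e: "i < j" "S \<in> V" "T \<in> V" and R: "a \<in> R" "a' \<in> R"
  shows "edge_diff i S j T a a' \<simeq> 0"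
proof -
  obtain \<sigma> where "\<sigma> \<in> Autf M B" "a' = \<sigma> \<circ> a"
    using L R unfolding lascar_strong_type_def lascar_equiv_def by blast
  then show ?thesis using edge_diff_Autf[OF e] R(1) by blast
qed

text \<open>
  After conjugation both edges end in \<open>c\<close>; their starting points need not be jointly independent
  from \<open>c\<close>, so \<open>c\<close> is exchanged for an element \<open>d\<close> independent from everything.
\<close>

lemma edge_unique:
  assumes L: "lascar_strong_type M B p" and e: "i < j" "S \<in> V" "T \<in> V"
    and R: "a \<in> R" "c \<in> R" "indR a c" and R': "a' \<in> R" "c' \<in> R" "indR a' c'"
  shows "edge_chain i S j T a c \<simeq> edge_chain i S j T a' c'"
proof -
  obtain \<sigma> where \<sigma>: "\<sigma> \<in> Auts M B" "\<sigma> \<circ> c' = c" using R_conj[OF R'(2) R(2)] by blast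
  define b where "b = \<sigma> \<circ> a'"
  have b: "b \<in> R" "indR b c" using R_aut[OF \<sigma>(1) R'(1)] indR_aut[OF \<sigma>(1) R'(3)] by (simp_all add: b_def \<sigma>(2))
  obtain d where d: "d \<in> R" "ind (range d) B (\<Union>x\<in>{a, b, c}. range x)"
    using exists_R_indep[of "{a, b, c}"] by auto
  have ds: "ind (range d) B (range x \<union> range y)" if "x \<in> {a, b, c}" "y \<in> {a, b, c}" for x y
    by (rule ind_range_subset[OF d(2)]) (use that in auto)
  have ij: "i < Suc j" using e(1) by simp
  have "edge_chain i S j T a c - edge_chain i S j T b c \<simeq> edge_chain i S (Suc j) T a d - edge_chain i S (Suc j) T b d"
    by (rule edge_diff_shift[OF e(1) lessI e(2,3,3) R(1) b(1) R(2) d(1) R(3) b(2)]) (intro ds; simp)+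
  also have "\<dots> \<simeq> edge_diff i S (Suc j) T a b" by (rule edge_diff_eq[OF ij e(2,3) R(1) b(1) d(1)]) (intro ds; simp)
  also have "\<dots> \<simeq> 0" by (rule edge_diff_lascar[OF L ij e(2,3) R(1) b(1)])
  finally have "edge_chain i S j T a c \<simeq> edge_chain i S j T b c" by (simp add: homologous_def)
  also have "\<dots> \<simeq> edge_chain i S j T a' c'" using edge_aut[OF e R' \<sigma>(1)] by (simp add: b_def \<sigma>(2))
  finally show ?thesis .
qed

text \<open>For a Lascar strong type, all edges from one vertex to another are homologous to a chosen one.\<close>

definition edge_class :: "nat \<Rightarrow> 'a set \<Rightarrow> nat \<Rightarrow> 'a set \<Rightarrow> 'a simplex \<Rightarrow>\<^sub>0 int" where
  "edge_class i S j T = (let (a, c) = SOME (a, c). a \<in> R \<and> c \<in> R \<and> indR a c in edge_chain i S j T a c)"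

lemma edge_class_eq:
  assumes L: "lascar_strong_type M B p" and e: "i < j" "S \<in> V" "T \<in> V" and R: "a \<in> R" "c \<in> R" "indR a c"
  shows "edge_chain i S j T a c \<simeq> edge_class i S j T"
proof -
  obtain x y where xy: "(SOME (a, c). a \<in> R \<and> c \<in> R \<and> indR a c) = (x, y)" by force
  have "\<exists>z. case z of (a, c) \<Rightarrow> a \<in> R \<and> c \<in> R \<and> indR a c" using R by blast
  from someI_ex[OF this] have "x \<in> R \<and> y \<in> R \<and> indR x y" unfolding xy by simp
  then show ?thesis unfolding edge_class_def xy using edge_unique[OF L e R] by simp
qed

lemma edge_class_triangle:
  assumes L: "lascar_strong_type M B p" and e: "i < j" "j < k" "S \<in> V" "T \<in> V" "U \<in> V"
  shows "edge_class i S j T \<simeq> edge_class i S k U - edge_class j T k U"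
proof -
  obtain b where b: "b \<in> R" "indR a0 b" using exists_R_indep[of "{a0}"] indR_member[of _ "{a0}" a0] by auto
  obtain c where c: "c \<in> R" "ind (range c) B (range a0 \<union> range b)" using exists_R_indep[of "{a0, b}"] by auto
  note t = triangle[OF e a0_R b(1) c(1) b(2) c(2) id_Auts]
  have ik: "i < k" using e by simp
  have "edge_class i S j T \<simeq> edge_chain i S j T a0 b" by (rule homologous_sym[OF edge_class_eq[OF L e(1,3,4) a0_R b]])
  also have "\<dots> \<simeq> edge_chain i S k U a0 c - edge_chain j T k U b c" by (rule triangle_homologous[OF e a0_R b(1) c(1) b(2) c(2)])
  also have "\<dots> \<simeq> edge_class i S k U - edge_class j T k U"
    by (intro homologous_diff edge_class_eq[OF L] ik e a0_R b c t(2,3))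
  finally show ?thesis .
qed

text \<open>
  The potential of a vertex \<open>(i, S)\<close> is a path to it from the base vertex \<open>(0, base_object)\<close>. The path
  passes through the vertex \<open>(i + 1, base_object)\<close> because edges have increasing vertices and \<open>i\<close> may be \<open>0\<close>.
\<close>

definition base_object :: "'a set" where "base_object = range a0"

definition potential :: "'a simplex \<Rightarrow> 'a simplex \<Rightarrow>\<^sub>0 int" where
  "potential v = (let i = the_elem (supp v) in edge_class 0 base_object (Suc i) base_object - edge_class i (ob v {i}) (Suc i) base_object)"

lemma base_object_V: "base_object \<in> V" using a0_R by (auto simp: base_object_def V_def)

lemma ob_vert: assumes "S \<in> V" shows "ob (vert i S) {i} = S"
proof -
  have "acl_span (\<lambda>_. S) {i} = S" using acl_span_single[of "\<lambda>_. S" i "enumeration S"] enumeration[OF assms] by simp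
  then show ?thesis using ob_nf[of "{i}" "{i}" "\<lambda>_. S" "\<lambda>_. id"] unfolding vert_def by simp
qed

lemma potential_vert: "S \<in> V \<Longrightarrow> potential (vert i S) = edge_class 0 base_object (Suc i) base_object - edge_class i S (Suc i) base_object"
  unfolding potential_def using ob_vert[of S i] by (simp add: vert_def)

lemma edge_class_potential:
  assumes L: "lascar_strong_type M B p" and e: "i < j" "S \<in> V" "T \<in> V"
  shows "edge_class i S j T \<simeq> potential (vert j T) - potential (vert i S)"
proof -
  have ij: "i < Suc j" "Suc i < Suc j" using e(1) by auto
  have 1: "edge_class 0 base_object (Suc i) base_object \<simeq> edge_class 0 base_object (Suc j) base_object - edge_class (Suc i) base_object (Suc j) base_object"
    by (rule edge_class_triangle[OF L _ ij(2) base_object_V base_object_V base_object_V]) simp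
  have 2: "edge_class i S (Suc i) base_object \<simeq> edge_class i S (Suc j) base_object - edge_class (Suc i) base_object (Suc j) base_object"
    by (rule edge_class_triangle[OF L lessI ij(2) e(2) base_object_V base_object_V])
  have 3: "edge_class i S j T \<simeq> edge_class i S (Suc j) base_object - edge_class j T (Suc j) base_object"
    by (rule edge_class_triangle[OF L e(1) lessI e(2,3) base_object_V])
  have "edge_class i S j T + (edge_class 0 base_object (Suc i) base_object - edge_class i S (Suc i) base_object) \<simeq>
    (edge_class i S (Suc j) base_object - edge_class j T (Suc j) base_object) + ((edge_class 0 base_object (Suc j) base_object - edge_class (Suc i) base_object (Suc j) base_object)
      - (edge_class i S (Suc j) base_object - edge_class (Suc i) base_object (Suc j) base_object))"
    by (intro homologous_add homologous_diff 1 2 3)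
  then show ?thesis unfolding potential_vert[OF e(2)] potential_vert[OF e(3)] homologous_def by (simp add: algebra_simps)
qed

text \<open>The group of \<open>1\<close>-cycles.\<close>

definition cycles :: "('a simplex \<Rightarrow>\<^sub>0 int) set" where
  "cycles = {z \<in> carrier (chain_group M ind B p 1). boundary 1 z = 0}"

lemma carrier_chain: "z \<in> carrier (chain_group M ind B p n) \<longleftrightarrow> Poly_Mapping.keys z \<subseteq> simplices M ind B p n"
  by (simp add: chain_group_def)

theorem lascar_imp_cycles:
  assumes L: "lascar_strong_type M B p" shows "cycles \<subseteq> boundaries"
proof
  fix z assume z: "z \<in> cycles"
  then have "Poly_Mapping.keys z \<subseteq> simplices M ind B p 1" by (simp add: cycles_def carrier_chain)
  then have "z \<simeq> frag_extend potential (boundary 1 z)"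
  proof (induction z rule: frag_induction)
    case zero
    show ?case by (simp add: boundary_def homologous_refl)
  next
    case (one f)
    then obtain i S j T a c where f: "i < j" "S \<in> V" "T \<in> V" "a \<in> R" "c \<in> R" "indR a c" "f = edge i S j T a c"
      by (rule simplices_1)
    have "frag_of f \<simeq> edge_class i S j T" unfolding f(7) by (rule edge_class_eq[OF L f(1-6)])
    also have "\<dots> \<simeq> potential (vert j T) - potential (vert i S)" by (rule edge_class_potential[OF L f(1-3)])
    finally show ?case unfolding f(7) boundary_edge[OF f(1-6)] by (simp add: frag_extend_diff)
  next
    case (diff x y)
    then show ?case using homologous_diff[OF diff] boundary_add[of 1 x "- y"] boundary_minus[of 1 y]
      by (simp add: frag_extend_diff)
  qed
  then show "z \<in> boundaries" using z by (simp add: cycles_def homologous_def)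
qed

section \<open>The first homology group\<close>

lemma simplices_2:
  assumes "f \<in> simplices M ind B p 2"
  obtains i j k A \<tau> where "i < j" "j < k" "simplex_data {i, j, k} A \<tau>" "f = normal_form {i, j, k} A \<tau>"
proof -
  obtain A \<tau> where g: "simplex_data (supp f) A \<tau>" and f: "f = normal_form (supp f) A \<tau>" using simplex_normal_form[OF assms] by blast
  have "card (supp f) = 3" using assms by (simp add: simplices_def)
  then obtain i j k where ijk: "i < j" "j < k" "supp f = {i, j, k}" by (rule card_3_less)
  show thesis using that[OF ijk(1,2)] g f unfolding ijk(3) by blast
qed

lemma keys_of_diff:
  assumes "Poly_Mapping.keys x \<subseteq> S" "Poly_Mapping.keys y \<subseteq> S"
  shows "Poly_Mapping.keys (x - y :: 'x \<Rightarrow>\<^sub>0 int) \<subseteq> S"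
  using keys_diff[of x y] assms by blast

lemma boundaries_subset_cycles: "boundaries \<subseteq> cycles"
proof
  fix x assume "x \<in> boundaries"
  then obtain c where c: "Poly_Mapping.keys c \<subseteq> simplices M ind B p 2" "x = boundary 2 c"
    by (auto simp: boundaries_def carrier_chain)
  from c(1) have "boundary 2 c \<in> cycles"
  proof (induction c rule: frag_induction)
    case zero
    show ?case by (simp add: boundary_def cycles_def carrier_chain)
  next
    case (one f)
    then obtain i j k A \<tau> where f: "i < j" "j < k" "simplex_data {i, j, k} A \<tau>" "f = normal_form {i, j, k} A \<tau>"
      by (rule simplices_2)
    have g: "simplex_data {i, j} A \<tau>" "simplex_data {j, k} A \<tau>" "simplex_data {i, k} A \<tau>"
      by (rule simplex_data_subset[OF f(3)]; blast)+
    have ik: "i < k" using f by simp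
    have e: "normal_form {i, j} A \<tau> \<in> simplices M ind B p 1" "normal_form {j, k} A \<tau> \<in> simplices M ind B p 1" "normal_form {i, k} A \<tau> \<in> simplices M ind B p 1"
      by (rule nf_simplex[OF g(1)] nf_simplex[OF g(2)] nf_simplex[OF g(3)]; use f in simp)+
    have b: "boundary 2 (frag_of f) = frag_of (normal_form {j, k} A \<tau>) - (frag_of (normal_form {i, k} A \<tau>) - frag_of (normal_form {i, j} A \<tau>))"
      unfolding f(4) boundary_2_nf[OF f(1,2)] by simp
    have bd: "boundary 1 (u - v) = boundary 1 u - boundary 1 v" for u v :: "'a simplex \<Rightarrow>\<^sub>0 int"
      using boundary_add[of 1 u "- v"] boundary_minus[of 1 v] by simp
    have "boundary 1 (boundary 2 (frag_of f)) = 0"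
      unfolding b bd boundary_1_nf[OF g(1) f(1)] boundary_1_nf[OF g(2) f(2)] boundary_1_nf[OF g(3) ik] by simp
    moreover have "Poly_Mapping.keys (boundary 2 (frag_of f)) \<subseteq> simplices M ind B p 1"
      unfolding b by (intro keys_of_diff) (use e in auto)
    ultimately show ?case by (simp add: cycles_def carrier_chain)
  next
    case (diff u v)
    have "boundary n (u - v) = boundary n u - boundary n v" for n and u v :: "'a simplex \<Rightarrow>\<^sub>0 int"
      using boundary_add[of n u "- v"] boundary_minus[of n v] by simp
    moreover have "Poly_Mapping.keys (boundary 2 u - boundary 2 v) \<subseteq> simplices M ind B p 1"
      by (rule keys_of_diff) (use diff in \<open>auto simp: cycles_def carrier_chain\<close>)
    ultimately show ?case using diff by (simp add: cycles_def carrier_chain)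
  qed
  then show "x \<in> cycles" using c(2) by simp
qed

theorem trivial_homology_iff: "trivial_group (homology_group M ind B p 1) \<longleftrightarrow> cycles \<subseteq> boundaries"
proof -
  let ?C = "chain_group M ind B p 1"
  define G where "G = ?C\<lparr>carrier := cycles\<rparr>"
  have one0: "\<one>\<^bsub>chain_group M ind B p n\<^esub> = 0" for n by (simp add: chain_group_def)
  have ker: "kernel ?C (chain_group M ind B p 0) (boundary 1) = cycles"
    by (auto simp: kernel_def cycles_def one0)
  have H: "homology_group M ind B p 1 = G Mod boundaries"
    using ker by (simp add: homology_group_def G_def boundaries_def numeral_2_eq_2)
  have gC: "group ?C" by (simp add: chain_group_def)
  have sub: "subgroup cycles ?C"
  proof (rule group.subgroupI[OF gC])
    show "cycles \<subseteq> carrier ?C" by (auto simp: cycles_def)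
    have "0 \<in> cycles" using boundaries_0 boundaries_subset_cycles by blast
    then show "cycles \<noteq> {}" by blast
    show "inv\<^bsub>?C\<^esub> x \<in> cycles" if "x \<in> cycles" for x
    proof -
      have "inv\<^bsub>?C\<^esub> x = - x" using that by (simp add: cycles_def chain_group_def)
      then show ?thesis using that by (simp add: cycles_def carrier_chain boundary_minus)
    qed
    show "x \<otimes>\<^bsub>?C\<^esub> y \<in> cycles" if "x \<in> cycles" "y \<in> cycles" for x y
    proof -
      have "Poly_Mapping.keys (x + y) \<subseteq> simplices M ind B p 1"
        using that Poly_Mapping.keys_add[of x y] by (auto simp: cycles_def carrier_chain)
      then show ?thesis using that by (simp add: cycles_def carrier_chain boundary_add chain_group_def)
    qed
  qed
  have gG: "group G" unfolding G_def by (rule subgroup.subgroup_is_group[OF sub gC])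
  have cG: "carrier G = cycles" by (simp add: G_def)
  have mG: "x \<otimes>\<^bsub>G\<^esub> y = x + y" for x y by (simp add: G_def chain_group_def)
  show ?thesis
  proof
    assume "trivial_group (homology_group M ind B p 1)"
    then have "trivial_group (G Mod boundaries)" unfolding H .
    then have car: "carrier (G Mod boundaries) = {boundaries}" by (simp add: trivial_group_def FactGroup_def)
    show "cycles \<subseteq> boundaries"
    proof
      fix z assume "z \<in> cycles"
      then have "boundaries #>\<^bsub>G\<^esub> z \<in> carrier (G Mod boundaries)" by (auto simp: FactGroup_def RCOSETS_def cG)
      then have "boundaries #>\<^bsub>G\<^esub> z = boundaries" using car by simp
      moreover have "z \<in> boundaries #>\<^bsub>G\<^esub> z" using boundaries_0 by (force simp: r_coset_def mG)
      ultimately show "z \<in> boundaries" by simp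
    qed
  next
    assume "cycles \<subseteq> boundaries"
    then have eq: "boundaries = carrier G" using boundaries_subset_cycles cG by simp
    have "carrier G \<lhd> G"
    proof (rule group.normal_invI[OF gG group.subgroup_self[OF gG]])
      interpret group G by (rule gG)
      show "x \<otimes>\<^bsub>G\<^esub> h \<otimes>\<^bsub>G\<^esub> inv\<^bsub>G\<^esub> x \<in> carrier G" if "x \<in> carrier G" "h \<in> carrier G" for x h using that by simp
    qed
    then show "trivial_group (homology_group M ind B p 1)"
      unfolding H eq by (intro trivial_Mod[OF gG]) auto
  qed
qed

section \<open>Trivial first homology and commuting Lascar actions\<close>

text \<open>
  The homomorphism \<open>h\<close> of the proof sends an edge \<open>[a, c]\<close> to the class of an automorphism taking \<open>a\<close> to
  \<open>c\<close>, in the quotient by the automorphisms preserving all Lascar types of realizations.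
\<close>

theorem cycles_imp_lascar:
  assumes CC: "commute_on M B p" and Z: "cycles \<subseteq> boundaries"
  shows "lascar_strong_type M B p"
proof -
  define L where "L = lascar_fix M B R"
  let ?A = "Aut_group M B"
  note gA = group_Aut_group[OF st, of B]
  have nL: "L \<lhd> ?A" unfolding L_def by (rule normal_lascar_fix[OF st R_aut])
  interpret A: group ?A by (rule gA)
  interpret L: normal L ?A by (rule nL)
  define G where "G = ?A Mod L"
  define cl where "cl \<sigma> = L #>\<^bsub>?A\<^esub> \<sigma>" for \<sigma>
  have cc: "lascar_equiv M B (\<sigma> \<circ> (\<tau> \<circ> b)) (\<tau> \<circ> (\<sigma> \<circ> b))" if "\<sigma> \<in> Auts M B" "\<tau> \<in> Auts M B" "b \<in> R" for \<sigma> \<tau> b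
    using CC that unfolding commute_on_def by blast
  have clG: "cl \<sigma> \<in> carrier G" if "\<sigma> \<in> Auts M B" for \<sigma>
    using that by (auto simp: cl_def G_def FactGroup_def RCOSETS_def)
  have cl_mult: "cl \<sigma> \<otimes>\<^bsub>G\<^esub> cl \<tau> = cl (\<sigma> \<circ> \<tau>)" if "\<sigma> \<in> Auts M B" "\<tau> \<in> Auts M B" for \<sigma> \<tau>
    using L.rcos_sum[of \<sigma> \<tau>] that by (simp add: cl_def G_def FactGroup_def mult_Aut_group)
  \<comment> \<open>Since the action is commutative, a class is determined by its effect on one realization.\<close>
  have cl_eq: "cl \<sigma> = cl \<tau>"
    if A: "\<sigma> \<in> Auts M B" "\<tau> \<in> Auts M B" and b: "b \<in> R" "lascar_equiv M B (\<sigma> \<circ> b) (\<tau> \<circ> b)" for \<sigma> \<tau> b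
  proof -
    have "lascar_equiv M B b' ((\<sigma> \<circ> finv \<tau>) \<circ> b')" if b': "b' \<in> R" for b'
    proof -
      obtain \<rho> where \<rho>: "\<rho> \<in> Auts M B" "\<rho> \<circ> b = finv \<tau> \<circ> b'"
        using R_conj[OF b(1) R_aut[OF finv_Auts[OF A(2)] b']] by blast
      have b'_eq: "b' = \<tau> \<circ> (\<rho> \<circ> b)" unfolding \<rho>(2) finv_comp_simps(1)[OF A(2)] ..
      have "lascar_equiv M B (\<sigma> \<circ> (\<rho> \<circ> b)) (\<rho> \<circ> (\<sigma> \<circ> b))" by (rule cc[OF A(1) \<rho>(1) b(1)])
      moreover have "lascar_equiv M B (\<rho> \<circ> (\<sigma> \<circ> b)) (\<rho> \<circ> (\<tau> \<circ> b))" by (rule lascar_equiv_aut[OF st b(2) \<rho>(1)])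
      moreover have "lascar_equiv M B (\<rho> \<circ> (\<tau> \<circ> b)) b'" unfolding b'_eq by (rule cc[OF \<rho>(1) A(2) b(1)])
      ultimately have "lascar_equiv M B (\<sigma> \<circ> (\<rho> \<circ> b)) b'" by (blast intro: lascar_equiv_trans[OF st])
      then show ?thesis unfolding \<rho>(2) comp_assoc by (rule lascar_equiv_sym[OF st])
    qed
    then have l: "\<sigma> \<circ> finv \<tau> \<in> L"
      unfolding L_def lascar_fix_def using comp_Auts[OF A(1) finv_Auts[OF A(2)]] by blast
    have "\<sigma> = (\<sigma> \<circ> finv \<tau>) \<otimes>\<^bsub>?A\<^esub> \<tau>"
      using mult_Aut_group[OF comp_Auts[OF A(1) finv_Auts[OF A(2)]] A(2)] finv_simps(4)[OF A(2)]
      by (simp add: comp_assoc)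
    then have "\<sigma> \<in> L #>\<^bsub>?A\<^esub> \<tau>" using l by (auto simp: r_coset_def)
    then show ?thesis unfolding cl_def
      using A.repr_independence[OF _ _ L.subgroup_axioms, of \<sigma> \<tau>] A(2) by simp
  qed
  have grpG: "group G" unfolding G_def by (rule L.factorgroup_is_group)
  have carG: "carrier G = cl ` Auts M B" by (auto simp: G_def FactGroup_def RCOSETS_def cl_def)
  interpret G: comm_group G
  proof (rule group.group_comm_groupI[OF grpG])
    fix x y assume "x \<in> carrier G" "y \<in> carrier G"
    then obtain \<sigma> \<tau> where s: "\<sigma> \<in> Auts M B" "\<tau> \<in> Auts M B" "x = cl \<sigma>" "y = cl \<tau>" by (auto simp: carG)
    have "cl (\<sigma> \<circ> \<tau>) = cl (\<tau> \<circ> \<sigma>)"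
      by (rule cl_eq[OF comp_Auts[OF s(1,2)] comp_Auts[OF s(2,1)] a0_R])
        (unfold comp_assoc, rule cc[OF s(1,2) a0_R])
    then show "x \<otimes>\<^bsub>G\<^esub> y = y \<otimes>\<^bsub>G\<^esub> x" unfolding s(3,4) using s(1,2) by (simp add: cl_mult)
  qed
  define d where "d f = cl (aut (fst (ends f)) (snd (ends f)))" for f
  have d_edge: "d (edge i S j T a c) = cl (aut a c)"
    if "i < j" "S \<in> V" "T \<in> V" "a \<in> R" "c \<in> R" "indR a c" for i S j T a c
    using ends_edge[OF that] by (simp add: d_def)
  have dG: "d ` simplices M ind B p 1 \<subseteq> carrier G"
  proof (rule image_subsetI)
    fix f assume "f \<in> simplices M ind B p 1"
    then obtain i S j T a c where f: "i < j" "S \<in> V" "T \<in> V" "a \<in> R" "c \<in> R" "indR a c" "f = edge i S j T a c"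
      by (rule simplices_1)
    show "d f \<in> carrier G" unfolding f(7) d_edge[OF f(1-6)] by (rule clG[OF aut(1)[OF f(4,5)]])
  qed
  obtain h where h: "h \<in> hom (free_Abelian_group (simplices M ind B p 1)) G"
    and hd: "\<And>f. f \<in> simplices M ind B p 1 \<Longrightarrow> h (frag_of f) = d f"
    using G.free_Abelian_group_universal[OF dG] by metis
  let ?F = "free_Abelian_group (simplices M ind B p 1)"
  interpret h: group_hom ?F G h
    by (rule group_hom.intro[OF group_free_Abelian_group grpG group_hom_axioms.intro[OF h]])
  have h_diff: "h (x - y) = h x \<otimes>\<^bsub>G\<^esub> inv\<^bsub>G\<^esub> h y"
    if "Poly_Mapping.keys x \<subseteq> simplices M ind B p 1" "Poly_Mapping.keys y \<subseteq> simplices M ind B p 1" for x y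
  proof -
    have F: "x \<in> carrier ?F" "y \<in> carrier ?F"
      unfolding carrier_free_Abelian_group_iff by (rule that)+
    have "x - y = x \<otimes>\<^bsub>?F\<^esub> inv\<^bsub>?F\<^esub> y"
      unfolding mult_free_Abelian_group inv_free_Abelian_group[OF that(2)] by simp
    then show ?thesis
      by (simp only: h.hom_mult[OF F(1) h.G.inv_closed[OF F(2)]] h.hom_inv[OF F(2)])
  qed
  have h_bd: "h x = \<one>\<^bsub>G\<^esub>" if "x \<in> boundaries" for x
  proof -
    obtain c where c: "Poly_Mapping.keys c \<subseteq> simplices M ind B p 2" "x = boundary 2 c"
      using \<open>x \<in> boundaries\<close> by (auto simp: boundaries_def carrier_chain)
    from c(1) have "Poly_Mapping.keys (boundary 2 c) \<subseteq> simplices M ind B p 1 \<and> h (boundary 2 c) = \<one>\<^bsub>G\<^esub>"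
    proof (induction c rule: frag_induction)
      case zero
      show ?case using h.hom_one by (simp add: boundary_def)
    next
      case (one f)
      then obtain i j k A \<tau> where f: "i < j" "j < k" "simplex_data {i, j, k} A \<tau>" "f = normal_form {i, j, k} A \<tau>"
        by (rule simplices_2)
      have ik: "i < k" using f by simp
      have m: "i \<in> {i, j, k}" "j \<in> {i, j, k}" "k \<in> {i, j, k}" by auto
      have g: "simplex_data {i, j} A \<tau>" "simplex_data {j, k} A \<tau>" "simplex_data {i, k} A \<tau>"
        by (rule simplex_data_subset[OF f(3)]; blast)+
      have e: "normal_form {i, j} A \<tau> \<in> simplices M ind B p 1" "normal_form {j, k} A \<tau> \<in> simplices M ind B p 1" "normal_form {i, k} A \<tau> \<in> simplices M ind B p 1"
        by (rule nf_simplex[OF g(1)] nf_simplex[OF g(2)] nf_simplex[OF g(3)]; use f in simp)+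
      have b: "boundary 2 (frag_of f) = frag_of (normal_form {j, k} A \<tau>) - (frag_of (normal_form {i, k} A \<tau>) - frag_of (normal_form {i, j} A \<tau>))"
        unfolding f(4) boundary_2_nf[OF f(1,2)] by simp
      let ?c = "point A \<tau>"
      have d_nf: "d (normal_form {x, y} A \<tau>) = cl (aut (?c x) (?c y))"
        if xy: "x < y" "x \<in> {i, j, k}" "y \<in> {i, j, k}" for x y
      proof -
        let ?\<sigma> = "\<tau> {x, y}"
        have \<sigma>: "?\<sigma> \<in> Auts M B" using simplex_dataD(4)[OF f(3), of "{x, y}"] xy by simp
        note px = point[OF f(3) xy(2)] and py = point[OF f(3) xy(3)]
        have R: "?\<sigma> \<circ> ?c x \<in> R" "?\<sigma> \<circ> ?c y \<in> R" using R_aut[OF \<sigma>] px(2) py(2) by blast+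
        note a = aut[OF R] and a' = aut[OF px(2) py(2)]
        have "d (normal_form {x, y} A \<tau>) = cl (aut (?\<sigma> \<circ> ?c x) (?\<sigma> \<circ> ?c y))"
          unfolding nf_edge(1)[OF f(3) xy(2,3,1)]
          by (rule d_edge[OF xy(1) px(1) py(1) R nf_edge(2)[OF f(3) xy(2,3,1)]])
        also have "\<dots> = cl (aut (?c x) (?c y))"
        proof (rule cl_eq[OF a(1) a'(1) R(1)])
          have "lascar_equiv M B (?\<sigma> \<circ> (aut (?c x) (?c y) \<circ> ?c x)) (aut (?c x) (?c y) \<circ> (?\<sigma> \<circ> ?c x))"
            by (rule cc[OF \<sigma> a'(1) px(2)])
          then show "lascar_equiv M B (aut (?\<sigma> \<circ> ?c x) (?\<sigma> \<circ> ?c y) \<circ> (?\<sigma> \<circ> ?c x)) (aut (?c x) (?c y) \<circ> (?\<sigma> \<circ> ?c x))"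
            unfolding a(2) a'(2) .
        qed
        finally show ?thesis .
      qed
      note pi = point(2)[OF f(3) m(1)] and pj = point(2)[OF f(3) m(2)] and pk = point(2)[OF f(3) m(3)]
      note aij = aut[OF pi pj] and ajk = aut[OF pj pk] and aik = aut[OF pi pk]
      have "aut (?c j) (?c k) \<circ> aut (?c i) (?c j) \<circ> ?c i = aut (?c i) (?c k) \<circ> ?c i"
        by (simp only: comp_assoc aij(2) ajk(2) aik(2))
      then have "cl (aut (?c j) (?c k) \<circ> aut (?c i) (?c j)) = cl (aut (?c i) (?c k))"
        by (intro cl_eq[OF comp_Auts[OF ajk(1) aij(1)] aik(1) pi]) (simp only: lascar_equiv_refl[OF st])
      then have tri: "cl (aut (?c i) (?c k)) = cl (aut (?c j) (?c k)) \<otimes>\<^bsub>G\<^esub> cl (aut (?c i) (?c j))"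
        using cl_mult[OF ajk(1) aij(1)] by simp
      have k: "Poly_Mapping.keys (frag_of (normal_form {i, k} A \<tau>) - frag_of (normal_form {i, j} A \<tau>)) \<subseteq> simplices M ind B p 1"
        by (intro keys_of_diff) (use e in auto)
      have "h (boundary 2 (frag_of f)) = d (normal_form {j, k} A \<tau>) \<otimes>\<^bsub>G\<^esub> inv\<^bsub>G\<^esub> (d (normal_form {i, k} A \<tau>) \<otimes>\<^bsub>G\<^esub> inv\<^bsub>G\<^esub> d (normal_form {i, j} A \<tau>))"
        unfolding b using e k by (simp add: h_diff hd)
      also have "\<dots> = \<one>\<^bsub>G\<^esub>"
        unfolding d_nf[OF f(1) m(1,2)] d_nf[OF f(2) m(2,3)] d_nf[OF ik m(1,3)] tri
          G.m_assoc[OF clG[OF ajk(1)] clG[OF aij(1)] G.inv_closed[OF clG[OF aij(1)]]]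
          G.r_inv[OF clG[OF aij(1)]] G.r_one[OF clG[OF ajk(1)]]
        by (rule G.r_inv[OF clG[OF ajk(1)]])
      finally have "h (boundary 2 (frag_of f)) = \<one>\<^bsub>G\<^esub>" .
      moreover have "Poly_Mapping.keys (boundary 2 (frag_of f)) \<subseteq> simplices M ind B p 1"
        unfolding b by (intro keys_of_diff) (use e in auto)
      ultimately show ?case by simp
    next
      case (diff u v)
      have bd: "boundary 2 (u - v) = boundary 2 u - boundary 2 v"
        using boundary_add[of 2 u "- v"] boundary_minus[of 2 v] by simp
      note d = diff(1)[THEN conjunct1] diff(2)[THEN conjunct1]
      have "h (boundary 2 u - boundary 2 v) = \<one>\<^bsub>G\<^esub>"
        unfolding h_diff[OF d] diff(1)[THEN conjunct2] diff(2)[THEN conjunct2] by simp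
      then show ?case unfolding bd using keys_of_diff[OF d] by blast
    qed
    then show ?thesis using c(2) by simp
  qed
  show ?thesis unfolding lascar_strong_type_def
  proof (intro ballI)
    fix b b' assume b: "b \<in> R" "b' \<in> R"
    obtain c where c: "c \<in> R" "ind (range c) B (\<Union>x\<in>{b, b'}. range x)" using exists_R_indep[of "{b, b'}"] by auto
    have i: "indR b c" "indR b' c" using indR_member[OF c(2)] by auto
    let ?e = "edge 0 base_object 1 base_object b c" and ?e' = "edge 0 base_object 1 base_object b' c"
    have e: "?e \<in> simplices M ind B p 1" "?e' \<in> simplices M ind B p 1"
      using edge_simplex[of 0 1 base_object base_object _ c] base_object_V b c(1) i by auto
    have "boundary 1 (frag_of ?e - frag_of ?e') = boundary 1 (frag_of ?e) - boundary 1 (frag_of ?e')"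
      using boundary_add[of 1 "frag_of ?e" "- frag_of ?e'"] boundary_minus[of 1 "frag_of ?e'"] by simp
    also have "\<dots> = 0"
      using boundary_edge[of 0 1 base_object base_object _ c] base_object_V b c(1) i by simp
    finally have "frag_of ?e - frag_of ?e' \<in> cycles"
      unfolding cycles_def carrier_chain using e keys_of_diff[of "frag_of ?e" _ "frag_of ?e'"] by simp
    then have "h (frag_of ?e - frag_of ?e') = \<one>\<^bsub>G\<^esub>" using Z h_bd by blast
    then have one: "d ?e \<otimes>\<^bsub>G\<^esub> inv\<^bsub>G\<^esub> d ?e' = \<one>\<^bsub>G\<^esub>" using e by (simp add: h_diff hd)
    have de: "d ?e = cl (aut b c)" "d ?e' = cl (aut b' c)"
      using d_edge[of 0 1 base_object base_object _ c] base_object_V b c(1) i by auto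
    note ab = aut[OF b(1) c(1)] and ab' = aut[OF b(2) c(1)]
    have "cl (aut b c) = cl (aut b' c)"
      using one[unfolded de] clG[OF ab(1)] clG[OF ab'(1)] G.inv_solve_right[of "\<one>\<^bsub>G\<^esub>" "cl (aut b c)" "cl (aut b' c)"] by simp
    then have "aut b c \<in> L #>\<^bsub>?A\<^esub> aut b' c"
      unfolding cl_def using A.rcos_self[of "aut b c" L, OF _ L.subgroup_axioms] ab(1) by simp
    then obtain l where l: "l \<in> L" "aut b c = l \<otimes>\<^bsub>?A\<^esub> aut b' c" by (auto simp: r_coset_def)
    have lA: "l \<in> Auts M B" using l(1) by (simp add: L_def lascar_fix_def)
    have g: "aut b' c \<circ> b \<in> R" by (rule R_aut[OF ab'(1) b(1)])
    have "lascar_equiv M B (aut b' c \<circ> b) (l \<circ> (aut b' c \<circ> b))"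
      using l(1) g by (simp add: L_def lascar_fix_def)
    moreover have "l \<circ> (aut b' c \<circ> b) = aut b' c \<circ> b'"
      using ab(2) unfolding l(2) mult_Aut_group[OF lA ab'(1)] comp_assoc ab'(2) .
    ultimately have "lascar_equiv M B (finv (aut b' c) \<circ> (aut b' c \<circ> b)) (finv (aut b' c) \<circ> (aut b' c \<circ> b'))"
      using lascar_equiv_aut[OF st _ finv_Auts[OF ab'(1)]] by simp
    then show "lascar_equiv M B b b'" unfolding finv_comp_simps(2)[OF ab'(1)] .
  qed
qed

end

theorem corollary4p7:
  fixes M :: "('f, 'r, 's, 'a) struct"
    and ind :: "'a set \<Rightarrow> 'a set \<Rightarrow> 'a set \<Rightarrow> bool"
    and B :: "'a set"
    and a :: "'i \<Rightarrow> 'a"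
    and p :: "('f, 'r, 's, 'a, 'i) tuple_type"
  assumes "monster M"
    and "indep_relation M ind"
    and "small M B" and "acl M B = B"
    and "small M (UNIV :: 'i set)"
    and "p = tp M B a"
    and "range a = acl M (B \<union> range a)"
  shows
    "(lascar_strong_type M B p \<longleftrightarrow>
        comm_group (Gal_L_fix_1 M B p) \<and> trivial_group (homology_group M ind B p 1))
     \<and> (lascar_strong_type M B p \<longleftrightarrow>
        trivial_group (Gal_L_fix_1 M B p) \<and> trivial_group (homology_group M ind B p 1))
     \<and> (comm_group (Gal_L_fix M B p) \<longrightarrow>
        (lascar_strong_type M B p \<longleftrightarrow> trivial_group (homology_group M ind B p 1)))
     \<and> ((\<exists>m. p = tp M B m \<and> elem_submodel M (range m) \<and> B \<subseteq> range m) \<longrightarrow>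
        (lascar_strong_type M B p \<longleftrightarrow>
           comm_group (Gal_L M B) \<and> trivial_group (homology_group M ind B p 1)))"
proof -
  interpret strong_type M ind B a p by (rule strong_type.intro) (fact assms)+
  let ?L = "lascar_strong_type M B p" and ?H = "trivial_group (homology_group M ind B p 1)"
  have H: ?H if ?L using lascar_imp_cycles[OF that] unfolding trivial_homology_iff .
  have L: ?L if "commute_on M B p" ?H
    using cycles_imp_lascar[OF that(1)] that(2) unfolding trivial_homology_iff .
  have T: "trivial_group (Gal_L_fix_1 M B p)" if ?L by (rule trivial_Gal_L_fix_1[OF st that])
  have 1: "?L \<longleftrightarrow> comm_group (Gal_L_fix_1 M B p) \<and> ?H"
    using H L T trivial_imp_comm_group commute_on_Gal_L_fix_1[OF st] by blast
  have 2: "?L \<longleftrightarrow> trivial_group (Gal_L_fix_1 M B p) \<and> ?H"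
    using 1 T trivial_imp_comm_group by blast
  have 3: "?L \<longleftrightarrow> ?H" if "comm_group (Gal_L_fix M B p)"
    using H L commute_on_Gal_L_fix[OF st that] by blast
  have 4: "?L \<longleftrightarrow> comm_group (Gal_L M B) \<and> ?H"
    if m: "p = tp M B m" "elem_submodel M (range m)" "B \<subseteq> range m" for m
  proof
    assume l: ?L
    have "trivial_group (Gal_L M B)"
      by (rule trivial_Gal_L[OF st l[unfolded m(1)] m(2,3) small_range])
    then show "comm_group (Gal_L M B) \<and> ?H" using trivial_imp_comm_group H[OF l] by blast
  next
    assume "comm_group (Gal_L M B) \<and> ?H"
    then show ?L using L commute_on_Gal_L[OF st] by blast
  qed
  show ?thesis using 1 2 3 4 by blast
qed

end
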